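(* Let $K$ be an algebraically closed field of characteristic zero and let $m\ge 2$ be an integer. Any artinian Gorenstein standard graded $K$-algebra $A$ of codimension $3$ and odd socle degree $2m+1$ with $h$-vector $$(1,3,6,8,10,\dots,2m,2m+2,2m+2,2m,\dots,10,8,6,3,1),$$ i.e. $h_0=1$, $h_1=3$, $h_i=2i+2$ for $2\le i\le m$, and $h_{2m+1-i}=h_i$ for $0\le i\le m$, satisfies the weak Lefschetz property.
   Context: A standard graded artinian $K$-algebra is $A=R/I$ with $R=K[x_1,\dots,x_n]$ (standard grading) and $I$ a homogeneous ideal such that $\dim_K A<\infty$. The codimension of $A$ is the number of variables $n$ of $R$ (equal to $h_1$ when $I$ contains no linear forms). Its $h$-vector is $(h_0,\dots,h_d)$ with $h_i=\dim_K[A]_i>0$ for $0\le i\le d$, where $d$ is the largest degree in which $A$ is nonzero; $d$ is called the socle degree. $A$ is Gorenstein if its socle is one-dimensional, concentrated in degree $d$ (then its $h$-vector is symmetric). $A$ has the weak Lefschetz property (WLP) if there is a linear form $\ell\in[A]_1$ such that for every integer $i\ge 0$ the multiplication map $\times\ell\colon[A]_i\to[A]_{i+1}$ has maximal rank (i.e. is injective or surjective). *)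

theory Defs
  imports
    "HOL-Library.Poly_Mapping"
    "HOL-Library.Numeral_Type"
    "HOL-Algebra.Algebra"
    "HOL-Algebra.Algebraic_Closure_Type"
begin

text \<open>
  A polynomial over \<^typ>\<open>'k\<close> in the variables \<^typ>\<open>'v\<close> maps exponent vectors
  to coefficients, both with finite support; its ring operations are the
  convolution ring structure on \<^type>\<open>poly_mapping\<close>.
\<close>

type_synonym ('v, 'k) mpoly = "('v \<Rightarrow>\<^sub>0 nat) \<Rightarrow>\<^sub>0 'k"

definition mconst :: "'k::comm_ring_1 \<Rightarrow> ('v, 'k) mpoly" where
  "mconst c = Poly_Mapping.single 0 c"

definition mvar :: "'v \<Rightarrow> ('v, 'k::comm_ring_1) mpoly" where
  "mvar v = Poly_Mapping.single (Poly_Mapping.single v 1) 1"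

abbreviation mpoly_ring :: "('v, 'k::comm_ring_1) mpoly ring" where
  "mpoly_ring \<equiv> ring_of_type_algebra"

definition mdeg :: "('v::finite \<Rightarrow>\<^sub>0 nat) \<Rightarrow> nat" where
  "mdeg t = (\<Sum>v\<in>UNIV. Poly_Mapping.lookup t v)"

text \<open>The homogeneous polynomials of degree \<open>i\<close>, including \<open>0\<close>.\<close>

definition poly_comp :: "nat \<Rightarrow> ('v::finite, 'k::comm_ring_1) mpoly set" where
  "poly_comp i = {p. \<forall>t\<in>Poly_Mapping.keys p. mdeg t = i}"

definition homogeneous_ideal :: "('v::finite, 'k::comm_ring_1) mpoly set \<Rightarrow> bool" where
  "homogeneous_ideal I \<longleftrightarrow>
     (\<exists>S. S \<subseteq> (\<Union>i. poly_comp i) \<and> I = genideal mpoly_ring S)"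

text \<open>
  Everything below concerns the graded algebra \<open>A = R/I\<close> given by an ideal \<open>I\<close>
  of the polynomial ring \<open>R\<close>. Its elements are the cosets of \<open>I\<close>, and scalars
  act on it through the image of the constants, so that the library notions of
  dimension over a subfield of a ring apply.
\<close>

abbreviation quot_alg :: "('v, 'k::comm_ring_1) mpoly set \<Rightarrow> ('v, 'k) mpoly set ring" where
  "quot_alg I \<equiv> mpoly_ring Quot I"

definition residue :: "('v, 'k::comm_ring_1) mpoly set \<Rightarrow> ('v, 'k) mpoly \<Rightarrow> ('v, 'k) mpoly set" where
  "residue I p = I +>\<^bsub>mpoly_ring\<^esub> p"

definition scalars :: "('v, 'k::comm_ring_1) mpoly set \<Rightarrow> ('v, 'k) mpoly set set" where
  "scalars I = {residue I (mconst c) | c. True}"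

definition graded_comp ::
    "('v::finite, 'k::comm_ring_1) mpoly set \<Rightarrow> nat \<Rightarrow> ('v, 'k) mpoly set set" where
  "graded_comp I i = residue I ` poly_comp i"

definition artinian :: "('v, 'k::field) mpoly set \<Rightarrow> bool" where
  "artinian I \<longleftrightarrow>
     ring.finite_dimension (quot_alg I) (scalars I) (carrier (quot_alg I))"

definition hilb :: "('v::finite, 'k::field) mpoly set \<Rightarrow> nat \<Rightarrow> nat" where
  "hilb I i = ring.dim (quot_alg I) (scalars I) (graded_comp I i)"

text \<open>
  Meaningful only if \<open>A\<close> is nonzero and artinian: otherwise there is no largest
  degree to choose.
\<close>

definition socle_degree :: "('v::finite, 'k::field) mpoly set \<Rightarrow> nat" where
  "socle_degree I = (GREATEST i. graded_comp I i \<noteq> {\<zero>\<^bsub>quot_alg I\<^esub>})"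

definition irrelevant_ideal :: "('v, 'k::field) mpoly set \<Rightarrow> ('v, 'k) mpoly set set" where
  "irrelevant_ideal I = genideal (quot_alg I) {residue I (mvar v) | v. True}"

definition socle :: "('v, 'k::field) mpoly set \<Rightarrow> ('v, 'k) mpoly set set" where
  "socle I = {a \<in> carrier (quot_alg I).
     \<forall>b\<in>irrelevant_ideal I. b \<otimes>\<^bsub>quot_alg I\<^esub> a = \<zero>\<^bsub>quot_alg I\<^esub>}"

definition gorenstein :: "('v::finite, 'k::field) mpoly set \<Rightarrow> bool" where
  "gorenstein I \<longleftrightarrow>
     ring.dimension (quot_alg I) 1 (scalars I) (socle I) \<and>
     socle I \<subseteq> graded_comp I (socle_degree I)"

definition weak_lefschetz :: "('v::finite, 'k::field) mpoly set \<Rightarrow> bool" where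
  "weak_lefschetz I \<longleftrightarrow>
     (\<exists>l\<in>graded_comp I 1. \<forall>i.
        inj_on (\<lambda>a. l \<otimes>\<^bsub>quot_alg I\<^esub> a) (graded_comp I i) \<or>
        (\<lambda>a. l \<otimes>\<^bsub>quot_alg I\<^esub> a) ` graded_comp I i = graded_comp I (Suc i))"

end

theory Submission imports Defs "HOL-Library.Product_Plus" begin

text \<open>
  Macaulay duality replaces the algebra \<open>A\<close> by a linear functional \<open>\<phi>\<close> on the forms of degree
  \<open>d = 2m + 1\<close>: the ideal of \<open>A\<close> agrees in each degree with the ideal \<open>ann\<close> of all polynomials whose
  multiples are mapped to zero (\<open>ex_functional\<close>). As \<open>A\<close> has no socle below degree \<open>d\<close> and has the
  same dimension in degrees \<open>m\<close> and \<open>m + 1\<close>, a linear form is a Lefschetz element as soon as it acts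
  injectively on degree \<open>m\<close> (\<open>weak_lefschetz_if_injective\<close>). The proof is by contradiction: assume
  that every linear form \<open>u\<close> kills some nonzero class \<open>a\<close> of degree \<open>m\<close>.

  The main tool is differentiation. For generic \<open>u\<close> the rank of a family of linear maps is maximal,
  so an element of the kernel at \<open>u\<close> extends to first order in every direction \<open>v\<close>
  (\<open>generic_syzygies_lift\<close>). From \<open>u a = 0\<close> one obtains \<open>v a + u a' = 0\<close> for some \<open>a'\<close>; multiplied by \<open>a\<close>,
  this shows that all \<open>v\<close> kill \<open>a\<^sup>2\<close>, and so \<open>a\<^sup>2 = 0\<close> (\<open>generic_square_zero\<close>).

  The second tool is the geometry of \<open>ann\<close> in degree \<open>m + 1\<close>, whose codimension \<open>2m + 2\<close> is so small
  that it has finitely many common zeros in the projective plane (\<open>finite_base_locus\<close>). A class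
  killed by two independent linear forms is dual to the evaluation at their common zero, which is
  then one of these points. Since a generic line misses them, the multiples of \<open>u\<close> are the only linear
  forms that kill \<open>a\<close> (\<open>good_killers\<close>). Consequently the annihilator of \<open>a\<close>, restricted to the line
  \<open>u = 0\<close>, has dimension less than \<open>j\<close> in each degree \<open>j \<le> m\<close> in which it is nonzero (\<open>dim_line_ann\<close>).

  For \<open>m = 2\<close> these bounds make the annihilator on the line so small that the derivatives up to
  third order of \<open>u a = 0\<close> produce a second linear form that kills \<open>a\<close> (\<open>not_m_2\<close>).

  For \<open>m \<ge> 3\<close> there are no conics and exactly two independent cubics in \<open>ann\<close>. If the cubics satisfy a
  linear relation, they are multiples of a conic \<open>q\<close> that two linear forms kill. Then the annihilator
  of \<open>a\<close> is generated by \<open>u\<close> and \<open>q\<close> up to degree \<open>m\<close>. Starting from \<open>a\<^sup>2 = 0\<close>, differentiation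
  shows that \<open>a\<close> can be divided by \<open>u\<close> repeatedly, up to multiples of \<open>q\<close>, until nothing is left of it
  (\<open>iterated_division\<close>, \<open>no_conic_killed_twice\<close>). For \<open>m \<ge> 4\<close> a relation exists, since six linear
  multiples of the cubics do not fit into \<open>ann\<close> in degree four. For \<open>m = 3\<close> and cubics without a
  relation, the cubics restrict to a generic line without a common factor of degree two
  (\<open>generic_transversal\<close>); the annihilator of \<open>a\<close> is then generated by \<open>u\<close> and \<open>ann\<close>, and the same
  division works with \<open>q = 0\<close> (\<open>m_eq_3_contradiction\<close>).
\<close>

section \<open>Finite-dimensional subspaces\<close>

text \<open>
  Forms of one degree are a finite-dimensional space inside the polynomial ring, which is not.
  Dimension counts are therefore made for subspaces that lie in the span of a finite set.
\<close>

locale fd_space = vector_space scale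
  for scale :: "'a::field \<Rightarrow> 'b::ab_group_add \<Rightarrow> 'b"
begin

definition fin_dim :: "'b set \<Rightarrow> bool" where
  "fin_dim S \<longleftrightarrow> (\<exists>B. finite B \<and> S \<subseteq> span B)"

lemma fin_dim_subset: "fin_dim T \<Longrightarrow> S \<subseteq> T \<Longrightarrow> fin_dim S"
  unfolding fin_dim_def by blast

lemma fin_dim_basis:
  assumes "fin_dim S"
  obtains B where "B \<subseteq> S" "independent B" "finite B" "S \<subseteq> span B" "card B = dim S"
proof -
  obtain B where B: "B \<subseteq> S" "independent B" "S \<subseteq> span B" "card B = dim S"
    by (rule basis_exists)
  from assms obtain C where "finite C" "S \<subseteq> span C" unfolding fin_dim_def by blast
  with B independent_span_bound[of C B] have "finite B" by auto
  with B that show ?thesis by blast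
qed

lemma independent_card_le:
  assumes "fin_dim T" "B \<subseteq> T" "independent B"
  shows "finite B \<and> card B \<le> dim T"
proof -
  obtain C where C: "C \<subseteq> T" "independent C" "finite C" "T \<subseteq> span C" "card C = dim T"
    using fin_dim_basis[OF assms(1)] by blast
  show ?thesis using independent_span_bound[of C B] C assms by auto
qed

lemma dim_subset_le:
  assumes "fin_dim T" "S \<subseteq> T"
  shows "dim S \<le> dim T"
proof -
  obtain B where "B \<subseteq> S" "independent B" "card B = dim S"
    by (rule basis_exists)
  with independent_card_le[OF assms(1), of B] assms(2) show ?thesis by auto
qed

lemma complement_basis:
  assumes "fin_dim T" "S \<subseteq> T" "subspace S"
  obtains C where "finite C" "C \<subseteq> T" "T \<subseteq> span (S \<union> C)" "card C = dim T - dim S"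
    "card C + dim S = dim T"
proof -
  obtain B where B: "B \<subseteq> S" "independent B" "finite B" "S \<subseteq> span B" "card B = dim S"
    using fin_dim_basis[OF fin_dim_subset[OF assms(1,2)]] by blast
  obtain D where D: "B \<subseteq> D" "D \<subseteq> T" "independent D" "T \<subseteq> span D"
    using maximal_independent_subset_extend[of B T] B assms(2) by blast
  have fD: "finite D" using independent_card_le[OF assms(1) D(2,3)] by blast
  have cD: "card D = dim T" using basis_card_eq_dim[OF D(2,4,3)] .
  have "span D \<subseteq> span (S \<union> (D - B))" using B(1) by (intro span_mono) blast
  with D(4) have "T \<subseteq> span (S \<union> (D - B))" by blast
  moreover have "card (D - B) = dim T - dim S" using B cD D(1) by (simp add: card_Diff_subset)
  moreover have "card (D - B) + dim S = dim T"
    using card_Diff_subset[OF B(3) D(1)] card_mono[OF fD D(1)] B(5) cD by linarith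
  ultimately show ?thesis using that[of "D - B"] fD D(2) by blast
qed

lemma subspace_eq_if_dim_le:
  assumes "fin_dim T" "S \<subseteq> T" "subspace S" "dim T \<le> dim S"
  shows "S = T"
proof -
  obtain C where C: "finite C" "T \<subseteq> span (S \<union> C)" "card C = dim T - dim S"
    using complement_basis[OF assms(1-3)] by metis
  with assms(4) have "C = {}" by simp
  with C(2) assms(2,3) show ?thesis by (metis span_eq_iff sup_bot_right subset_antisym)
qed

text \<open>The basic codimension count: one condition costs at most one dimension.\<close>

lemma dim_le_Suc:
  assumes "fin_dim S" "subspace U" "U \<subseteq> S" "\<And>x. x \<in> S \<Longrightarrow> \<exists>c. x - scale c z \<in> U"
  shows "dim S \<le> Suc (dim U)"
proof -
  obtain B where B: "B \<subseteq> U" "independent B" "finite B" "U \<subseteq> span B" "card B = dim U"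
    using fin_dim_basis[OF fin_dim_subset[OF assms(1,3)]] by blast
  have "S \<subseteq> span (insert z B)"
  proof
    fix x assume "x \<in> S"
    then obtain c where "x - scale c z \<in> U" using assms(4) by blast
    then show "x \<in> span (insert z B)" using B(4) by (auto simp: span_insert)
  qed
  then have "dim S \<le> card (insert z B)" using dim_le_card B(3) by blast
  also have "\<dots> \<le> Suc (card B)" by (simp add: card_insert_le_m1 B(3) card_insert_if)
  finally show ?thesis using B(5) by simp
qed

lemma dim_le_one_functional:
  fixes f :: "'b \<Rightarrow> 'a"
  assumes S: "fin_dim S" "subspace S"
    and f: "\<And>x y. f (x + y) = f x + f y" "\<And>c x. f (scale c x) = c * f x"
  shows "dim S \<le> Suc (dim {x \<in> S. f x = 0})"
proof -
  have f0: "f 0 = 0" using f(2)[of 0 0] by simp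
  have fm: "f (x - y) = f x - f y" for x y using f(1)[of x "scale (-1) y"] f(2)[of "-1" y] by simp
  have sub: "subspace {x \<in> S. f x = 0}"
    using S(2) by (auto simp: subspace_def f f0)
  show ?thesis
  proof (cases "\<exists>z\<in>S. f z \<noteq> 0")
    case True
    then obtain z where z: "z \<in> S" "f z \<noteq> 0" by blast
    show ?thesis
    proof (rule dim_le_Suc[OF S(1) sub, of z])
      fix x assume "x \<in> S"
      then have "x - scale (f x / f z) z \<in> {x \<in> S. f x = 0}"
        using z S(2) by (auto simp: fm f subspace_diff subspace_scale)
      then show "\<exists>c. x - scale c z \<in> {x \<in> S. f x = 0}" by blast
    qed auto
  next
    case False
    then have "{x \<in> S. f x = 0} = S" by auto
    then show ?thesis by simp
  qed
qed

lemma dim_le_functionals: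
  fixes f :: "'i \<Rightarrow> 'b \<Rightarrow> 'a"
  assumes "finite F" and S: "fin_dim S" "subspace S"
    and f: "\<And>i x y. i \<in> F \<Longrightarrow> f i (x + y) = f i x + f i y" "\<And>i c x. i \<in> F \<Longrightarrow> f i (scale c x) = c * f i x"
  shows "dim S \<le> card F + dim {x \<in> S. \<forall>i\<in>F. f i x = 0}"
  using assms(1) f
proof (induction F)
  case (insert i F)
  let ?S = "{x \<in> S. \<forall>i\<in>F. f i x = 0}"
  have f0: "f j 0 = 0" if "j \<in> F" for j using insert.prems(2)[of j 0 0] that by simp
  have sub: "subspace ?S" using S(2) insert.prems by (auto simp: subspace_def f0)
  have "dim S \<le> card F + dim ?S" using insert by auto
  also have "dim ?S \<le> Suc (dim {x \<in> ?S. f i x = 0})"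
    by (rule dim_le_one_functional[OF fin_dim_subset[OF S(1)] sub]) (use insert.prems in auto)
  also have "{x \<in> ?S. f i x = 0} = {x \<in> S. \<forall>i\<in>insert i F. f i x = 0}" by auto
  finally show ?case using insert by simp
qed simp

lemma vanishing_on_few:
  fixes f :: "'i \<Rightarrow> 'b \<Rightarrow> 'a"
  assumes "finite F" and S: "fin_dim S" "subspace S"
    and f: "\<And>i x y. i \<in> F \<Longrightarrow> f i (x + y) = f i x + f i y" "\<And>i c x. i \<in> F \<Longrightarrow> f i (scale c x) = c * f i x"
    and less: "card F < dim S"
  obtains x where "x \<in> S" "x \<noteq> 0" "\<And>i. i \<in> F \<Longrightarrow> f i x = 0"
proof -
  have "dim {x \<in> S. \<forall>i\<in>F. f i x = 0} \<noteq> 0"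
    using dim_le_functionals[of F S f, OF assms(1-5)] less by linarith
  moreover have "dim Z \<le> card ({} :: 'b set)" if "Z \<subseteq> {0}" for Z
    by (rule dim_le_card) (use that in auto)
  ultimately have "\<not> {x \<in> S. \<forall>i\<in>F. f i x = 0} \<subseteq> {0}"
    by fastforce
  then show ?thesis using that by blast
qed

text \<open>The row rank of a pairing is at most its column rank.\<close>

lemma dim_radical_le:
  fixes b :: "'b \<Rightarrow> 'b \<Rightarrow> 'a"
  assumes P: "fin_dim P" "subspace P" and Q: "fin_dim Q" "subspace Q"
    and l: "\<And>x y z. b (x + y) z = b x z + b y z" "\<And>c x z. b (scale c x) z = c * b x z"
    and r: "\<And>x y z. b z (x + y) = b z x + b z y" "\<And>c x z. b z (scale c x) = c * b z x"
  shows "dim P + dim {y \<in> Q. \<forall>x\<in>P. b x y = 0} \<le> dim Q + dim {x \<in> P. \<forall>y\<in>Q. b x y = 0}"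
proof -
  let ?R = "{y \<in> Q. \<forall>x\<in>P. b x y = 0}"
  have r0: "b z 0 = 0" for z using r(2)[of z 0 0] by simp
  have "subspace ?R" using Q(2) by (auto simp: subspace_def r r0)
  then obtain C where C: "finite C" "C \<subseteq> Q" "Q \<subseteq> span (?R \<union> C)" "card C + dim ?R = dim Q"
    using complement_basis[OF Q(1) _ \<open>subspace ?R\<close>] by (metis (no_types, lifting) mem_Collect_eq subsetI)
  have "{x \<in> P. \<forall>y\<in>C. b x y = 0} \<subseteq> {x \<in> P. \<forall>y\<in>Q. b x y = 0}"
  proof safe
    fix x y assume x: "x \<in> P" "\<forall>y\<in>C. b x y = 0" and "y \<in> Q"
    then have "y \<in> span (?R \<union> C)" using C(3) by blast
    then show "b x y = 0"
    proof (induction rule: span_induct_alt)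
      case base then show ?case by (rule r0)
    next
      case (step c y z) then show ?case using x by (auto simp: r)
    qed
  qed
  then have "dim {x \<in> P. \<forall>y\<in>C. b x y = 0} \<le> dim {x \<in> P. \<forall>y\<in>Q. b x y = 0}"
    by (intro dim_subset_le fin_dim_subset[OF P(1)]) auto
  moreover have "dim P \<le> card C + dim {x \<in> P. \<forall>y\<in>C. b x y = 0}"
    by (rule dim_le_functionals[OF C(1) P, of "\<lambda>y x. b x y"]) (auto simp: l)
  ultimately show ?thesis using C(4) by linarith
qed

lemma dim_image_le':
  assumes "fin_dim S" and f: "\<And>x y. f (x + y) = f x + f y" "\<And>c x. f (scale c x) = scale c (f x)"
  shows "dim (f ` S) \<le> dim S" and "fin_dim (f ` S)"
proof -
  obtain B where B: "B \<subseteq> S" "finite B" "S \<subseteq> span B" "card B = dim S"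
    using fin_dim_basis[OF assms(1)] by metis
  have f0: "f 0 = 0" using f(2)[of 0 0] by simp
  have sp: "f ` S \<subseteq> span (f ` B)"
  proof safe
    fix x assume "x \<in> S"
    then have "x \<in> span B" using B by blast
    then show "f x \<in> span (f ` B)"
    proof (induction rule: span_induct_alt)
      case base then show ?case by (simp add: f0 span_zero)
    next
      case (step c y z) then show ?case
        by (simp add: f) (meson span_add span_base span_scale imageI)
    qed
  qed
  show "dim (f ` S) \<le> dim S" using dim_le_card[OF sp] B card_image_le[of B f] by auto
  show "fin_dim (f ` S)" using sp B(2) unfolding fin_dim_def by blast
qed

lemma dim_image_inj:
  assumes "fin_dim S" "subspace S"
    and f: "\<And>x y. f (x + y) = f x + f y" "\<And>c x. f (scale c x) = scale c (f x)"
    and inj: "\<And>x. x \<in> S \<Longrightarrow> f x = 0 \<Longrightarrow> x = 0"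
  shows "dim (f ` S) = dim S"
proof -
  obtain B where B: "B \<subseteq> S" "independent B" "finite B" "S \<subseteq> span B" "card B = dim S"
    using fin_dim_basis[OF assms(1)] by metis
  interpret p: vector_space_pair scale scale ..
  have lin: "Vector_Spaces.linear scale scale f"
    by (simp add: Vector_Spaces.linear_iff f vector_space_axioms)
  have sS: "span B \<subseteq> S" using B(1) assms(2) by (metis span_minimal)
  have fm: "f (x - y) = f x - f y" for x y using f(1)[of x "scale (-1) y"] f(2)[of "-1" y] by simp
  have "inj_on f (span B)" using inj sS fm assms(2) unfolding inj_on_def
    by (metis eq_iff_diff_eq_0 subsetD subspace_diff)
  then have "independent (f ` B)" "inj_on f B"
    using p.linear_independent_injective_image[OF lin B(2)] inj_on_subset[OF _ span_superset] by blast+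
  then have "card (f ` B) \<le> dim (f ` S)"
    using independent_card_le[OF dim_image_le'(2)[OF assms(1) f], of "f ` B"] B(1) by blast
  then show ?thesis using B(5) card_image[OF \<open>inj_on f B\<close>] dim_image_le'(1)[OF assms(1) f] by simp
qed

text \<open>Taking preimages under a linear map does not increase codimension.\<close>

lemma dim_preimage_ge:
  assumes V: "fin_dim V" "subspace V" and W: "fin_dim W" "subspace U" "U \<subseteq> W"
    and f: "\<And>x y. f (x + y) = f x + f y" "\<And>c x. f (scale c x) = scale c (f x)"
    and im: "\<And>x. x \<in> V \<Longrightarrow> f x \<in> W"
  shows "dim V + dim U \<le> dim W + dim {x \<in> V. f x \<in> U}"
proof -
  obtain C where C: "finite C" "C \<subseteq> W" "W \<subseteq> span (U \<union> C)" "card C + dim U = dim W"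
    using complement_basis[OF W(1,3,2)] by metis
  have fm: "f (x - y) = f x - f y" for x y using f(1)[of x "scale (-1) y"] f(2)[of "-1" y] by simp
  have f0: "f 0 = 0" using f(2)[of 0 0] by simp
  have "dim {x \<in> V. f x \<in> span (U \<union> C)} \<le> card C + dim {x \<in> V. f x \<in> U}"
    using C(1)
  proof (induction C)
    case empty
    then show ?case using W(2) by (simp add: span_eq_iff[THEN iffD2])
  next
    case (insert c C)
    let ?A = "{x \<in> V. f x \<in> span (U \<union> insert c C)}" and ?B = "{x \<in> V. f x \<in> span (U \<union> C)}"
    have sB: "subspace ?B" using V(2) by (auto simp: subspace_def f f0 span_add span_scale span_zero)
    have BA: "?B \<subseteq> ?A" using span_mono[of "U \<union> C" "U \<union> insert c C"] by auto
    have mem: "\<exists>a. f x - scale a c \<in> span (U \<union> C)" if "x \<in> ?A" for x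
      using that by (auto simp: span_insert)
    have "dim ?A \<le> Suc (dim ?B)"
    proof (cases "\<exists>z\<in>?A. f z \<notin> span (U \<union> C)")
      case True
      then obtain z where z: "z \<in> ?A" "f z \<notin> span (U \<union> C)" by blast
      obtain a where a: "f z - scale a c \<in> span (U \<union> C)" using mem[OF z(1)] by blast
      then have a0: "a \<noteq> 0" using z(2) by auto
      show ?thesis
      proof (rule dim_le_Suc[OF fin_dim_subset[OF V(1)] sB BA, where z = z])
        fix x assume x: "x \<in> ?A"
        obtain b where b: "f x - scale b c \<in> span (U \<union> C)" using mem[OF x] by blast
        have "f (x - scale (b / a) z) = (f x - scale b c) - scale (b / a) (f z - scale a c)"
          using a0 by (simp add: fm f scale_right_diff_distrib)
        then have "f (x - scale (b / a) z) \<in> span (U \<union> C)"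
          using a b by (metis span_diff span_scale)
        then show "\<exists>d. x - scale d z \<in> ?B"
          using x z V(2) by (intro exI[of _ "b / a"]) (auto simp: subspace_diff subspace_scale)
      qed auto
    next
      case False
      then have "?A = ?B" using BA by auto
      then show ?thesis by simp
    qed
    then show ?case using insert by simp
  qed
  moreover have "{x \<in> V. f x \<in> span (U \<union> C)} = V" using im C(3) by auto
  ultimately show ?thesis using C(4) by simp
qed

end

section \<open>Families of linear maps at points of maximal rank\<close>

text \<open>
  Linear independence of \<open>f 0, \<dots>, f (n - 1)\<close> as an indexed family: a repeated member makes
  it dependent.
\<close>

definition indep :: "nat \<Rightarrow> (nat \<Rightarrow> 'i \<Rightarrow> 'k::field) \<Rightarrow> bool" where
  "indep n f \<longleftrightarrow> (\<forall>c. (\<forall>i. (\<Sum>j<n. c j * f j i) = 0) \<longrightarrow> (\<forall>j<n. c j = 0))"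

lemma indep_0 [simp]: "indep 0 f"
  by (simp add: indep_def)

text \<open>
  Independence is an open condition. One pivot coordinate of the last function
  is used to eliminate it from the others, so that no determinants are needed.
\<close>

lemma indep_open:
  fixes F :: "nat \<Rightarrow> 'i \<Rightarrow> 'k::field poly"
  assumes "indep n (\<lambda>j i. poly (F j i) 0)"
  shows "finite {t. \<not> indep n (\<lambda>j i. poly (F j i) t)}"
  using assms
proof (induction n arbitrary: F)
  case (Suc n)
  have "\<exists>i. poly (F n i) 0 \<noteq> 0"
  proof (rule ccontr)
    assume "\<nexists>i. poly (F n i) 0 \<noteq> 0"
    then have "\<forall>i. (\<Sum>j<Suc n. (if j = n then 1 else 0) * poly (F j i) 0) = 0"
      by (auto intro!: sum.neutral)
    with Suc.prems[unfolded indep_def, rule_format, of "\<lambda>j. if j = n then 1 else 0" n] show False by simp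
  qed
  then obtain p where p: "poly (F n p) 0 \<noteq> 0" by blast
  define G where "G j i = F n p * F j i - F j p * F n i" for j i
  have sumG: "(\<Sum>j<n. c j * poly (G j i) t) =
      poly (F n p) t * (\<Sum>j<n. c j * poly (F j i) t) - (\<Sum>j<n. c j * poly (F j p) t) * poly (F n i) t" for c i t
    by (simp add: G_def algebra_simps sum_subtractf sum_distrib_left sum_distrib_right)
  have "indep n (\<lambda>j i. poly (G j i) 0)"
    unfolding indep_def
  proof (intro allI impI)
    fix c j assume c: "\<forall>i. (\<Sum>j<n. c j * poly (G j i) 0) = 0" and j: "j < n"
    define d where "d j = (if j < n then poly (F n p) 0 * c j else - (\<Sum>j<n. c j * poly (F j p) 0))" for j
    have "(\<Sum>j<Suc n. d j * poly (F j i) 0) = 0" for i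
      using c[rule_format, of i] unfolding sumG
      by (simp add: d_def sum_distrib_left mult.assoc)
    then have "d j = 0" using Suc.prems j unfolding indep_def by (metis less_SucI)
    with p j show "c j = 0" by (simp add: d_def)
  qed
  then have "finite {t. \<not> indep n (\<lambda>j i. poly (G j i) t)}" by (rule Suc.IH)
  moreover have "finite {t. poly (F n p) t = 0}" using p by (intro poly_roots_finite) auto
  moreover have "indep (Suc n) (\<lambda>j i. poly (F j i) t)"
    if "indep n (\<lambda>j i. poly (G j i) t)" "poly (F n p) t \<noteq> 0" for t
    unfolding indep_def
  proof (intro allI impI)
    fix c j assume c: "\<forall>i. (\<Sum>j<Suc n. c j * poly (F j i) t) = 0" and j: "j < Suc n"
    then have *: "(\<Sum>j<n. c j * poly (F j i) t) = - c n * poly (F n i) t" for i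
      by (simp add: add_eq_0_iff2)
    have "(\<Sum>j<n. c j * poly (G j i) t) = 0" for i
      unfolding sumG * by (simp add: algebra_simps)
    then have z: "c j = 0" if "j < n" for j using that \<open>indep n (\<lambda>j i. poly (G j i) t)\<close>
      unfolding indep_def by blast
    with *[of p] \<open>poly (F n p) t \<noteq> 0\<close> have "c n = 0" by simp
    with z j show "c j = 0" by (metis less_SucE)
  qed
  then have "{t. \<not> indep (Suc n) (\<lambda>j i. poly (F j i) t)}
      \<subseteq> {t. \<not> indep n (\<lambda>j i. poly (G j i) t)} \<union> {t. poly (F n p) t = 0}" by blast
  ultimately show ?case by (meson finite_UnI finite_subset)
qed auto

context fd_space
begin

lemma indep_image_le_dim:
  assumes S: "fin_dim S"
    and f: "\<And>x y i. f (x + y) i = f x i + f y i" "\<And>c x i. f (scale c x) i = c * f x i"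
    and ys: "\<And>j. ys j \<in> S" and ind: "indep n (\<lambda>j. f (ys j))"
  shows "n \<le> dim S"
proof -
  have f0: "f 0 i = 0" for i using f(2)[of 0 0] by simp
  have fsum: "f (\<Sum>j\<in>A. scale (c j) (z j)) i = (\<Sum>j\<in>A. c j * f (z j) i)" for A c z i
    by (induction A rule: infinite_finite_induct) (auto simp: f f0)
  have zero: "c j = 0" if "(\<Sum>j<n. scale (c j) (ys j)) = 0" "j < n" for c j
    using ind fsum[of c ys "{..<n}"] that f0 unfolding indep_def by metis
  have inj: "inj_on ys {..<n}"
  proof (rule inj_onI, rule ccontr)
    fix a b assume ab: "a \<in> {..<n}" "b \<in> {..<n}" "ys a = ys b" "a \<noteq> b"
    let ?c = "\<lambda>j. if j = a then 1 else if j = b then -1 else 0 :: 'a"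
    have "(\<Sum>j<n. scale (?c j) (ys j)) = (\<Sum>j\<in>{a, b}. scale (?c j) (ys j))"
      by (rule sum.mono_neutral_right) (use ab in auto)
    also have "\<dots> = 0" using ab by auto
    finally show False using zero[of ?c a] ab by simp
  qed
  have "independent (ys ` {..<n})"
  proof (rule independent_if_scalars_zero)
    fix c x assume "(\<Sum>x\<in>ys ` {..<n}. scale (c x) x) = 0" "x \<in> ys ` {..<n}"
    then show "c x = 0" using zero[of "\<lambda>j. c (ys j)"] by (auto simp: sum.reindex[OF inj])
  qed auto
  with independent_card_le[OF S, of "ys ` {..<n}"] ys card_image[OF inj] show ?thesis by auto
qed

text \<open>
  A family of linear maps \<open>f\<^sub>0 + t f\<^sub>1 + \<dots>\<close> whose rank is maximal at \<open>t = 0\<close>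
  maps the kernel of \<open>f\<^sub>0\<close> under \<open>f\<^sub>1\<close> into the image of \<open>f\<^sub>0\<close>: otherwise a basis
  of the image of \<open>f\<^sub>0\<close> and a vector \<open>f\<^sub>1 x\<close> would stay independent for small \<open>t\<close>
  and give a rank that is too large.
\<close>

lemma kernel_lifts_at_max_rank:
  fixes f :: "'b \<Rightarrow> 'i \<Rightarrow> 'a poly"
  assumes inf: "infinite (UNIV :: 'a set)" and S: "subspace S"
    and f: "\<And>x y i. f (x + y) i = f x i + f y i" "\<And>c x i. f (scale c x) i = smult c (f x i)"
    and ys: "\<And>j. ys j \<in> S" "indep r (\<lambda>j i. poly (f (ys j) i) 0)"
    and max: "\<And>t zs. (\<And>j. zs j \<in> S) \<Longrightarrow> \<not> indep (Suc r) (\<lambda>j i. poly (f (zs j) i) t)"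
    and x: "x \<in> S" "\<And>i. poly (f x i) 0 = 0"
  shows "\<exists>y\<in>S. \<forall>i. coeff (f x i) 1 + poly (f y i) 0 = 0"
proof -
  \<comment> \<open>The quotient of \<open>f x\<close> by \<open>t\<close>, whose value at \<open>0\<close> is the derivative of \<open>f x\<close>.\<close>
  define g where "g i = poly_shift 1 (f x i)" for i
  have fg: "f x i = pCons 0 (g i)" for i
    using x(2)[of i] by (intro poly_eqI) (auto simp: g_def coeff_poly_shift coeff_pCons poly_0_coeff_0 split: nat.splits)
  have g1: "coeff (f x i) 1 = poly (g i) 0" for i by (simp add: fg poly_0_coeff_0)
  define F where "F j = (if j = r then g else f (ys j))" for j
  have "\<not> indep (Suc r) (\<lambda>j i. poly (F j i) 0)"
  proof
    assume "indep (Suc r) (\<lambda>j i. poly (F j i) 0)"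
    then have "finite ({t. \<not> indep (Suc r) (\<lambda>j i. poly (F j i) t)} \<union> {0})" by (auto intro: indep_open)
    then obtain t where "t \<notin> {t. \<not> indep (Suc r) (\<lambda>j i. poly (F j i) t)} \<union> {0}"
      using ex_new_if_finite[OF inf] by blast
    then have t: "indep (Suc r) (\<lambda>j i. poly (F j i) t)" "t \<noteq> 0" by auto
    have "indep (Suc r) (\<lambda>j i. poly (f (if j = r then x else ys j) i) t)"
      unfolding indep_def
    proof (intro allI impI)
      fix c j assume c: "\<forall>i. (\<Sum>j<Suc r. c j * poly (f (if j = r then x else ys j) i) t) = 0" and j: "j < Suc r"
      define d where "d j = (if j = r then t * c j else c j)" for j
      have "(\<Sum>j<Suc r. d j * poly (F j i) t) = 0" for i
        using c[rule_format, of i] by (simp add: d_def F_def fg mult_ac cong: sum.cong_simp)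
      then have "d j = 0" using t(1) j unfolding indep_def by blast
      then show "c j = 0" using t(2) by (simp add: d_def split: if_splits)
    qed
    moreover have "(if j = r then x else ys j) \<in> S" for j using x(1) ys(1) by simp
    ultimately show False using max[of "\<lambda>j. if j = r then x else ys j" t] by blast
  qed
  then obtain c j where c: "\<And>i. (\<Sum>j<Suc r. c j * poly (F j i) 0) = 0" and j: "j < Suc r" "c j \<noteq> 0"
    unfolding indep_def by blast
  have eq: "(\<Sum>j<r. c j * poly (f (ys j) i) 0) + c r * poly (g i) 0 = 0" for i
    using c[of i] by (simp add: F_def cong: sum.cong_simp)
  have cross: "c r \<noteq> 0"
  proof
    assume "c r = 0"
    with eq have "c j = 0" if "j < r" for j using ys(2) that unfolding indep_def by simp
    with j \<open>c r = 0\<close> show False by (metis less_SucE)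
  qed
  have f0: "f 0 i = 0" for i using f(2)[of 0 0] by simp
  have fsum: "f (\<Sum>j\<in>A. scale (d j) (ys j)) i = (\<Sum>j\<in>A. smult (d j) (f (ys j) i))" for A d i
    by (induction A rule: infinite_finite_induct) (auto simp: f f0)
  define y where "y = (\<Sum>j<r. scale (c j / c r) (ys j))"
  have "y \<in> S" unfolding y_def by (intro subspace_sum S subspace_scale ys)
  moreover have "coeff (f x i) 1 + poly (f y i) 0 = 0" for i
  proof -
    have "poly (f y i) 0 = (\<Sum>j<r. c j * poly (f (ys j) i) 0) / c r"
      unfolding y_def fsum by (simp add: poly_sum sum_divide_distrib)
    with eq[of i] cross show ?thesis unfolding g1 by (simp add: field_simps add_eq_0_iff)
  qed
  ultimately show ?thesis by blast
qed

text \<open>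
  A workable notion of a nonempty Zariski-open subset of a subspace: it may
  miss only finitely many points of any line that meets it.
\<close>

definition generic :: "'b set \<Rightarrow> 'b set \<Rightarrow> bool" where
  "generic L G \<longleftrightarrow> (\<exists>u\<in>L. u \<in> G) \<and>
     (\<forall>u\<in>L. \<forall>v\<in>L. u \<in> G \<longrightarrow> finite {t. u + scale t v \<notin> G})"

lemma generic_Int:
  assumes inf: "infinite (UNIV :: 'a set)" and L: "subspace L" and "generic L G" "generic L H"
  shows "generic L (G \<inter> H)"
proof -
  obtain u w where u: "u \<in> L" "u \<in> G" and w: "w \<in> L" "w \<in> H"
    using assms(3,4) unfolding generic_def by blast
  have "finite {t. u + scale t (w - u) \<notin> G}"
    using assms(3) u w L unfolding generic_def by (meson subspace_diff)
  moreover have "finite {t. w + scale t (u - w) \<notin> H}"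
    using assms(4) u w L unfolding generic_def by (meson subspace_diff)
  then have "finite ((\<lambda>t. 1 - t) ` {t. w + scale t (u - w) \<notin> H})" by blast
  ultimately obtain t where t: "t \<notin> {t. u + scale t (w - u) \<notin> G} \<union> (\<lambda>t. 1 - t) ` {t. w + scale t (u - w) \<notin> H}"
    using ex_new_if_finite[OF inf] by (metis finite_UnI)
  \<comment> \<open>The line through \<open>u\<close> and \<open>w\<close> meets both sets, with opposite parametrizations.\<close>
  have eq: "w + scale (1 - t) (u - w) = u + scale t (w - u)"
    by (simp add: scale_left_diff_distrib scale_right_diff_distrib)
  have "u + scale t (w - u) \<in> G \<inter> H"
  proof
    show "u + scale t (w - u) \<in> H"
    proof (rule ccontr)
      assume "u + scale t (w - u) \<notin> H"
      then have "1 - (1 - t) \<in> (\<lambda>t. 1 - t) ` {t. w + scale t (u - w) \<notin> H}"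
        by (intro imageI) (simp add: eq)
      with t show False by simp
    qed
  qed (use t in blast)
  moreover have "u + scale t (w - u) \<in> L" using u w L by (simp add: subspace_add subspace_diff subspace_scale)
  moreover have "finite {t. u + scale t v \<notin> G \<inter> H}" if "u \<in> L" "v \<in> L" "u \<in> G \<inter> H" for u v
  proof -
    have "{t. u + scale t v \<notin> G \<inter> H} = {t. u + scale t v \<notin> G} \<union> {t. u + scale t v \<notin> H}" by blast
    then show ?thesis using that assms(3,4) unfolding generic_def by simp
  qed
  ultimately show ?thesis unfolding generic_def by blast
qed

lemma generic_INT:
  assumes inf: "infinite (UNIV :: 'a set)" and L: "subspace L" "L \<noteq> {}"
    and "finite J" "\<And>j. j \<in> J \<Longrightarrow> generic L (G j)"
  shows "generic L (\<Inter>j\<in>J. G j)"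
  using assms(4,5)
proof (induction J)
  case empty
  then show ?case using L unfolding generic_def by auto
next
  case (insert j J)
  then show ?case using generic_Int[OF inf L(1), of "G j" "\<Inter>j\<in>J. G j"] by simp
qed

text \<open>Nonvanishing of a function that is polynomial along lines.\<close>

lemma generic_nonvanishing:
  assumes "\<And>u v. u \<in> L \<Longrightarrow> v \<in> L \<Longrightarrow> \<exists>p. \<forall>t. h (u + scale t v) = poly p t"
    and "u \<in> L" "h u \<noteq> (0::'a)"
  shows "generic L {u. h u \<noteq> 0}"
  unfolding generic_def
proof (intro conjI ballI impI)
  show "\<exists>u\<in>L. u \<in> {u. h u \<noteq> 0}" using assms(2,3) by blast
  fix u v assume uv: "u \<in> L" "v \<in> L" "u \<in> {u. h u \<noteq> 0}"
  obtain p where p: "\<And>t. h (u + scale t v) = poly p t" using assms(1)[OF uv(1,2)] by blast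
  from p[of 0] uv(3) have "p \<noteq> 0" by auto
  then show "finite {t. u + scale t v \<notin> {u. h u \<noteq> 0}}" using poly_roots_finite by (simp add: p)
qed

end

text \<open>
  The parameters of maximal rank form a generic set, as independence is an open condition.
\<close>

lemma generic_kernel_lifts:
  fixes su :: "'k::field \<Rightarrow> 'u::ab_group_add \<Rightarrow> 'u" and sx :: "'k \<Rightarrow> 'x::ab_group_add \<Rightarrow> 'x"
    and \<Phi> :: "'u \<Rightarrow> 'x \<Rightarrow> 'i \<Rightarrow> 'k" and pol :: "'u \<Rightarrow> 'u \<Rightarrow> 'x \<Rightarrow> 'i \<Rightarrow> 'k poly"
  assumes spaces: "fd_space su" "fd_space sx"
    and inf: "infinite (UNIV :: 'k set)"
    and L: "module.subspace su L" and S: "module.subspace sx S" "fd_space.fin_dim sx S"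
    and pol: "\<And>u v x i t. u \<in> L \<Longrightarrow> v \<in> L \<Longrightarrow> poly (pol u v x i) t = \<Phi> (u + su t v) x i"
    and lin: "\<And>u v x y i. pol u v (x + y) i = pol u v x i + pol u v y i"
      "\<And>u v c x i. pol u v (sx c x) i = smult c (pol u v x i)"
  shows "\<exists>G. fd_space.generic su L G \<and>
    (\<forall>u\<in>L. \<forall>v\<in>L. \<forall>x\<in>S. u \<in> G \<longrightarrow> (\<forall>i. \<Phi> u x i = 0) \<longrightarrow>
       (\<exists>y\<in>S. \<forall>i. coeff (pol u v x i) 1 + \<Phi> u y i = 0))"
proof -
  interpret U: fd_space su by fact
  interpret V: fd_space sx by fact
  have Phi: "\<Phi> u x i = poly (pol u 0 x i) 0" if "u \<in> L" for u x i
    using pol[OF that U.subspace_0[OF L], of x i 0] by simp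
  have Phi0: "\<Phi> u x i = poly (pol u v x i) 0" if "u \<in> L" "v \<in> L" for u v x i
    using pol[OF that, of x i 0] by simp
  define A where "A r u ys \<longleftrightarrow> (\<forall>j. ys j \<in> S) \<and> indep r (\<lambda>j. \<Phi> u (ys j))" for r u ys
  have bound: "r \<le> V.dim S" if "u \<in> L" "A r u ys" for r u ys
    by (rule V.indep_image_le_dim[OF S(2), of "\<lambda>x i. poly (pol u 0 x i) 0" ys])
       (use that in \<open>auto simp: A_def lin Phi cong: indep_def\<close>)
  have "A 0 0 (\<lambda>_. 0)" "0 \<in> L" using V.subspace_0[OF S(1)] U.subspace_0[OF L] by (auto simp: A_def)
  \<comment> \<open>The maximal rank in the family.\<close>
  define r where "r = (GREATEST r. \<exists>u\<in>L. \<exists>ys. A r u ys)"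
  have r: "\<exists>u\<in>L. \<exists>ys. A r u ys" unfolding r_def
    by (rule GreatestI_nat[of _ 0 "V.dim S"]) (use bound \<open>A 0 0 (\<lambda>_. 0)\<close> \<open>0 \<in> L\<close> in blast)+
  have rmax: "\<not> A (Suc r) u zs" if "u \<in> L" for u zs
  proof
    assume "A (Suc r) u zs"
    then have "Suc r \<le> r" unfolding r_def
      by (intro Greatest_le_nat[of _ _ "V.dim S"]) (use bound that r_def in blast)+
    then show False by simp
  qed
  define G where "G = {u. \<exists>ys. A r u ys}"
  have "U.generic L G"
    unfolding U.generic_def
  proof (intro conjI ballI impI)
    show "\<exists>u\<in>L. u \<in> G" using r by (auto simp: G_def)
    fix u v assume uv: "u \<in> L" "v \<in> L" "u \<in> G"
    then obtain ys where ys: "A r u ys" by (auto simp: G_def)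
    then have "indep r (\<lambda>j i. poly (pol u v (ys j) i) 0)"
      by (simp add: A_def Phi0[OF uv(1,2), symmetric])
    then have "finite {t. \<not> indep r (\<lambda>j i. poly (pol u v (ys j) i) t)}" by (rule indep_open)
    moreover have "{t. u + su t v \<notin> G} \<subseteq> {t. \<not> indep r (\<lambda>j i. poly (pol u v (ys j) i) t)}"
      using ys by (auto simp: G_def A_def pol[OF uv(1,2)])
    ultimately show "finite {t. u + su t v \<notin> G}" by (rule finite_subset[rotated])
  qed
  moreover have "\<exists>y\<in>S. \<forall>i. coeff (pol u v x i) 1 + \<Phi> u y i = 0"
    if uv: "u \<in> L" "v \<in> L" "x \<in> S" "u \<in> G" "\<forall>i. \<Phi> u x i = 0" for u v x
  proof -
    obtain ys where ys: "A r u ys" using uv by (auto simp: G_def)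
    have "\<exists>y\<in>S. \<forall>i. coeff (pol u v x i) 1 + poly (pol u v y i) 0 = 0"
    proof (rule V.kernel_lifts_at_max_rank[OF inf S(1), where ys = ys and r = r])
      show "\<And>j. ys j \<in> S" using ys by (simp add: A_def)
      show "indep r (\<lambda>j i. poly (pol u v (ys j) i) 0)"
        using ys by (simp add: A_def Phi0[OF uv(1,2), symmetric])
      show "\<not> indep (Suc r) (\<lambda>j i. poly (pol u v (zs j) i) t)" if "\<And>j. zs j \<in> S" for t zs
        using rmax[of "u + su t v" zs] that uv L
        by (simp add: A_def pol U.subspace_add U.subspace_scale)
      show "poly (pol u v x i) 0 = 0" for i using uv(5) Phi0[OF uv(1,2)] by simp
    qed (use lin uv in auto)
    then show ?thesis by (simp add: Phi0[OF uv(1,2), symmetric])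
  qed
  ultimately show ?thesis by blast
qed

section \<open>Ternary forms\<close>

lemma UNIV3: "(UNIV :: 3 set) = {0, 1, 2}"
  by (rule card_subset_eq[symmetric]) auto

lemma exhaust3: "i = 0 \<or> i = 1 \<or> i = (2 :: 3)"
  using UNIV3 by blast

lemma sum3: "(\<Sum>i\<in>UNIV. f i) = f (0 :: 3) + f 1 + f 2"
  unfolding UNIV3 by (simp add: add.assoc)

lemma all3: "(\<forall>i :: 3. P i) \<longleftrightarrow> P 0 \<and> P 1 \<and> P 2"
  using exhaust3 by metis

lemma mconst_0 [simp]: "mconst 0 = 0" and mconst_1 [simp]: "mconst 1 = 1"
  by (simp_all add: mconst_def)

lemma mconst_add: "mconst (a + b) = mconst a + mconst b"
  by (simp add: mconst_def single_add)

lemma mconst_mult: "mconst (a * b) = mconst a * mconst b"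
  by (simp add: mconst_def mult_single)

lemma mconst_uminus: "mconst (- a) = - mconst a"
  using mconst_add[of a "- a"] by (simp add: add_eq_0_iff)

lemma mconst_diff: "mconst (a - b) = mconst a - mconst b"
  using mconst_add[of a "- b"] by (simp add: mconst_uminus)

lemma mconst_of_nat: "mconst (of_nat n) = of_nat n"
  by (induction n) (auto simp: mconst_add)

lemma mconst_eq_0_iff [simp]: "mconst c = 0 \<longleftrightarrow> c = 0"
  by (metis lookup_single_eq lookup_zero mconst_0 mconst_def)

definition mscale :: "'k::field \<Rightarrow> ('v, 'k) mpoly \<Rightarrow> ('v, 'k) mpoly" where
  "mscale c p = mconst c * p"

interpretation MP: fd_space "mscale :: 'k::field \<Rightarrow> ('v, 'k) mpoly \<Rightarrow> _"
  by unfold_locales (auto simp: mscale_def algebra_simps mconst_add mconst_mult)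

interpretation PS: fd_space "smult :: 'k::field \<Rightarrow> 'k poly \<Rightarrow> 'k poly"
  by unfold_locales (auto simp: smult_add_right smult_add_left)

subsection \<open>Homogeneous components\<close>

lemma mdeg_add: "mdeg (s + t) = mdeg s + mdeg t"
  by (simp add: mdeg_def lookup_add sum.distrib)

lemma mdeg_0 [simp]: "mdeg 0 = 0" by (simp add: mdeg_def)

lemma mdeg_single [simp]: "mdeg (Poly_Mapping.single v n) = n"
  by (simp add: mdeg_def lookup_single when_def)

lemma mdeg_eq_0_iff: "mdeg t = 0 \<longleftrightarrow> t = 0"
  by (auto simp: mdeg_def poly_mapping_eq_iff fun_eq_iff)

lemma poly_comp_iff: "p \<in> poly_comp n \<longleftrightarrow> (\<forall>t. Poly_Mapping.lookup p t \<noteq> 0 \<longrightarrow> mdeg t = n)"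
  by (auto simp: poly_comp_def in_keys_iff)

lemma poly_comp_0 [simp]: "0 \<in> poly_comp n"
  by (simp add: poly_comp_iff)

lemma poly_comp_add [intro]: "p \<in> poly_comp n \<Longrightarrow> q \<in> poly_comp n \<Longrightarrow> p + q \<in> poly_comp n"
  by (auto simp: poly_comp_iff lookup_add) (metis add_cancel_left_right)

lemma poly_comp_uminus [intro]: "p \<in> poly_comp n \<Longrightarrow> - p \<in> poly_comp n"
  by (auto simp: poly_comp_iff)

lemma poly_comp_diff [intro]: "p \<in> poly_comp n \<Longrightarrow> q \<in> poly_comp n \<Longrightarrow> p - q \<in> poly_comp n"
  using poly_comp_add[of p n "- q"] by auto

lemma poly_comp_sum [intro]: "(\<And>x. x \<in> A \<Longrightarrow> f x \<in> poly_comp n) \<Longrightarrow> sum f A \<in> poly_comp n"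
  by (induction A rule: infinite_finite_induct) auto

lemma poly_comp_mult: "p \<in> poly_comp n \<Longrightarrow> q \<in> poly_comp k \<Longrightarrow> p * q \<in> poly_comp (n + k)"
  unfolding poly_comp_def using keys_mult[of p q] by (force simp: mdeg_add)

lemma mconst_in_poly_comp [simp, intro]: "mconst c \<in> poly_comp 0"
  by (auto simp: poly_comp_def mconst_def)

lemma mvar_in_poly_comp [simp, intro]: "mvar v \<in> poly_comp 1"
  by (auto simp: poly_comp_def mvar_def)

lemma poly_comp_scale [intro]: "p \<in> poly_comp n \<Longrightarrow> mconst c * p \<in> poly_comp n"
  using poly_comp_mult[of "mconst c" 0 p n] by simp

lemma poly_comp_power: "p \<in> poly_comp n \<Longrightarrow> p ^ k \<in> poly_comp (k * n)"
  by (induction k) (auto intro: poly_comp_mult simp: mconst_in_poly_comp[of 1, simplified])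

lemma poly_comp_power1: "p \<in> poly_comp 1 \<Longrightarrow> p ^ k \<in> poly_comp k"
  using poly_comp_power[of p 1 k] by simp

lemma subspace_poly_comp: "MP.subspace (poly_comp n)"
  by (auto simp: MP.subspace_def mscale_def)

definition hcomp :: "nat \<Rightarrow> ('v::finite, 'k::field) mpoly \<Rightarrow> ('v, 'k) mpoly" where
  "hcomp n p = (\<Sum>t\<in>{t \<in> Poly_Mapping.keys p. mdeg t = n}. Poly_Mapping.single t (Poly_Mapping.lookup p t))"

lemma lookup_hcomp: "Poly_Mapping.lookup (hcomp n p) t = (if mdeg t = n then Poly_Mapping.lookup p t else 0)"
proof -
  have "Poly_Mapping.lookup (hcomp n p) t =
      (\<Sum>s\<in>{t \<in> Poly_Mapping.keys p. mdeg t = n}. if s = t then Poly_Mapping.lookup p t else 0)"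
    unfolding hcomp_def lookup_sum by (intro sum.cong) (auto simp: lookup_single)
  also have "\<dots> = (if mdeg t = n then Poly_Mapping.lookup p t else 0)"
    by (auto simp: in_keys_iff)
  finally show ?thesis .
qed

lemma hcomp_in_poly_comp [simp, intro]: "hcomp n p \<in> poly_comp n"
  by (auto simp: poly_comp_iff lookup_hcomp)

lemma hcomp_add: "hcomp n (p + q) = hcomp n p + hcomp n q"
  by (intro poly_mapping_eqI) (simp add: lookup_hcomp lookup_add)

lemma hcomp_0 [simp]: "hcomp n 0 = 0"
  by (intro poly_mapping_eqI) (simp add: lookup_hcomp)

lemma hcomp_sum: "hcomp n (sum f A) = (\<Sum>x\<in>A. hcomp n (f x))"
  by (induction A rule: infinite_finite_induct) (auto simp: hcomp_add)

lemma hcomp_same: "p \<in> poly_comp n \<Longrightarrow> hcomp n p = p"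
  by (intro poly_mapping_eqI) (auto simp: lookup_hcomp poly_comp_iff)

lemma hcomp_other: "p \<in> poly_comp k \<Longrightarrow> k \<noteq> n \<Longrightarrow> hcomp n p = 0"
  by (intro poly_mapping_eqI) (auto simp: lookup_hcomp poly_comp_iff)

lemma hcomp_decompose: "\<exists>N. p = (\<Sum>n<N. hcomp n p) \<and> (\<forall>n\<ge>N. hcomp n p = 0)"
proof -
  define N where "N = Suc (Max (insert 0 (mdeg ` Poly_Mapping.keys p)))"
  have N: "mdeg t < N" if "Poly_Mapping.lookup p t \<noteq> 0" for t
    unfolding N_def using that by (auto simp: less_Suc_eq_le in_keys_iff intro!: Max_ge)
  have "p = (\<Sum>n<N. hcomp n p)"
    by (intro poly_mapping_eqI) (use N in \<open>auto simp: lookup_sum lookup_hcomp\<close>)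
  moreover have "hcomp n p = 0" if "n \<ge> N" for n
    by (intro poly_mapping_eqI) (use N that in \<open>force simp: lookup_hcomp\<close>)
  ultimately show ?thesis by blast
qed

lemma hcomp_mult: "q \<in> poly_comp k \<Longrightarrow> hcomp (k + n) (q * p) = q * hcomp n p"
proof -
  assume q: "q \<in> poly_comp k"
  obtain N where N: "p = (\<Sum>i<N. hcomp i p)" "\<And>i. i \<ge> N \<Longrightarrow> hcomp i p = 0"
    using hcomp_decompose by blast
  have "hcomp (k + n) (q * p) = (\<Sum>i<N. hcomp (k + n) (q * hcomp i p))"
    by (subst N(1)) (simp add: sum_distrib_left hcomp_sum)
  also have "\<dots> = (\<Sum>i<N. if i = n then q * hcomp n p else 0)"
    by (intro sum.cong refl)
       (auto simp: hcomp_same poly_comp_mult[OF q] hcomp_other[OF poly_comp_mult[OF q hcomp_in_poly_comp]])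
  also have "\<dots> = q * hcomp n p" using N(2)[of n] by auto
  finally show ?thesis .
qed

lemma homogeneous_cofactor:
  assumes "p \<in> poly_comp (Suc n)" "l \<in> poly_comp 1" "p = l * r"
  shows "p = l * hcomp n r"
  using hcomp_mult[OF assms(2), of n r] hcomp_same[OF assms(1)] assms(3) by simp

lemma sum_monomials: "(\<Sum>t\<in>Poly_Mapping.keys p. Poly_Mapping.single t (Poly_Mapping.lookup p t)) = p"
proof (intro poly_mapping_eqI)
  fix s
  have "(\<Sum>t\<in>Poly_Mapping.keys p. Poly_Mapping.lookup (Poly_Mapping.single t (Poly_Mapping.lookup p t)) s) =
      (\<Sum>t\<in>Poly_Mapping.keys p. if t = s then Poly_Mapping.lookup p s else 0)"
    by (intro sum.cong) (auto simp: lookup_single)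
  then show "Poly_Mapping.lookup (\<Sum>t\<in>Poly_Mapping.keys p. Poly_Mapping.single t (Poly_Mapping.lookup p t)) s = Poly_Mapping.lookup p s"
    by (auto simp: lookup_sum in_keys_iff)
qed

text \<open>
  Forms are generated from the constants by sums and by multiplication with variables. The degree
  varies in the induction, so that a statement about one degree is proved as an implication from
  an equation for the degree.
\<close>

lemma form_induct [consumes 1, case_names const add mult]:
  fixes p :: "('v::finite, 'k::field) mpoly"
  assumes p: "p \<in> poly_comp n"
    and const: "\<And>c. P 0 (mconst c)"
    and add: "\<And>n p q. p \<in> poly_comp n \<Longrightarrow> q \<in> poly_comp n \<Longrightarrow> P n p \<Longrightarrow> P n q \<Longrightarrow> P n (p + q)"
    and mult: "\<And>n p v. p \<in> poly_comp n \<Longrightarrow> P n p \<Longrightarrow> P (Suc n) (mvar v * p)"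
  shows "P n p"
proof -
  have zero: "P n 0" for n
  proof (induction n)
    case (Suc n)
    then show ?case using mult[of 0 n undefined] by simp
  qed (use const[of 0] in simp)
  have mono: "P n (Poly_Mapping.single t c)" if "mdeg t = n" for t :: "'v \<Rightarrow>\<^sub>0 nat" and c n
    using that
  proof (induction n arbitrary: t)
    case 0
    then show ?case using const[of c] by (simp add: mdeg_eq_0_iff mconst_def)
  next
    case (Suc n)
    then obtain v where v: "Poly_Mapping.lookup t v \<noteq> 0"
      unfolding mdeg_def by (metis nat.distinct(1) sum.neutral)
    define s where "s = t - Poly_Mapping.single v 1"
    have t: "t = Poly_Mapping.single v 1 + s"
      by (intro poly_mapping_eqI) (use v in \<open>auto simp: s_def lookup_add lookup_minus lookup_single when_def\<close>)
    then have "mdeg s = n" using Suc.prems by (simp add: mdeg_add)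
    then have "P (Suc n) (mvar v * Poly_Mapping.single s c)"
      using Suc.IH by (intro mult) (auto simp: poly_comp_def)
    then show ?case by (simp add: mvar_def mult_single t)
  qed
  have "P n (\<Sum>t\<in>A. Poly_Mapping.single t (Poly_Mapping.lookup p t))"
    if "finite A" "A \<subseteq> Poly_Mapping.keys p" for A
    using that
  proof (induction A)
    case (insert t A)
    have deg: "mdeg s = n" if "s \<in> Poly_Mapping.keys p" for s using p that by (simp add: poly_comp_def)
    then have "Poly_Mapping.single s (Poly_Mapping.lookup p s) \<in> poly_comp n" if "s \<in> Poly_Mapping.keys p" for s
      using that by (auto simp: poly_comp_def)
    then show ?case using insert deg by (auto intro!: add mono poly_comp_sum)
  qed (simp add: zero)
  from this[of "Poly_Mapping.keys p"] show ?thesis by (simp add: sum_monomials)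
qed

lemma poly_comp_0_const: "p \<in> poly_comp 0 \<Longrightarrow> \<exists>c. p = mconst (c :: 'k::field)"
proof -
  have "n = 0 \<longrightarrow> (\<exists>c. p = mconst c)" if "p \<in> poly_comp n" for n
    using that
  proof (induction rule: form_induct)
    case (add n p q)
    show ?case
    proof
      assume "n = 0"
      then obtain a b where "p = mconst a" "q = mconst b" using add by blast
      then show "\<exists>c. p + q = mconst c" by (intro exI[of _ "a + b"]) (simp add: mconst_add)
    qed
  qed auto
  moreover assume "p \<in> poly_comp 0"
  ultimately show ?thesis by blast
qed
subsection \<open>Substitution\<close>

definition subst :: "('k \<Rightarrow> 's) \<Rightarrow> ('v::finite \<Rightarrow> 's) \<Rightarrow> ('v, 'k::comm_ring_1) mpoly \<Rightarrow> 's::comm_ring_1" where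
  "subst h f p = (\<Sum>t\<in>Poly_Mapping.keys p. h (Poly_Mapping.lookup p t) * (\<Prod>v\<in>UNIV. f v ^ Poly_Mapping.lookup t v))"

locale coefficient_hom =
  fixes h :: "'k::comm_ring_1 \<Rightarrow> 's::comm_ring_1"
  assumes h_add: "h (a + b) = h a + h b" and h_mult: "h (a * b) = h a * h b" and h_1: "h 1 = 1"
begin

lemma h_0: "h 0 = 0" using h_add[of 0 0] by simp

lemma subst_superset:
  assumes "finite A" "Poly_Mapping.keys p \<subseteq> A"
  shows "subst h f p = (\<Sum>t\<in>A. h (Poly_Mapping.lookup p t) * (\<Prod>v\<in>UNIV. f v ^ Poly_Mapping.lookup t v))"
  unfolding subst_def by (rule sum.mono_neutral_left) (use assms in \<open>auto simp: in_keys_iff h_0\<close>)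

lemma subst_single: "subst h f (Poly_Mapping.single t c) = h c * (\<Prod>v\<in>UNIV. f v ^ Poly_Mapping.lookup t v)"
  by (subst subst_superset[of "{t}"]) auto

lemma subst_add: "subst h f (p + q) = subst h f p + subst h f q"
proof -
  let ?A = "Poly_Mapping.keys p \<union> Poly_Mapping.keys q"
  have "subst h f (p + q) = (\<Sum>t\<in>?A. h (Poly_Mapping.lookup (p + q) t) * (\<Prod>v\<in>UNIV. f v ^ Poly_Mapping.lookup t v))"
    by (rule subst_superset) (use keys_add[of p q] in auto)
  also have "\<dots> = subst h f p + subst h f q"
    unfolding subst_superset[of ?A p, simplified] subst_superset[of ?A q, simplified]
    by (simp add: lookup_add h_add algebra_simps sum.distrib)
  finally show ?thesis .
qed

lemma subst_0: "subst h f 0 = 0"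
  by (simp add: subst_def)

lemma subst_sum: "subst h f (sum g A) = (\<Sum>x\<in>A. subst h f (g x))"
  by (induction A rule: infinite_finite_induct) (auto simp: subst_add subst_0)

lemma subst_mult: "subst h f (p * q) = subst h f p * subst h f q"
proof -
  have single: "subst h f (Poly_Mapping.single s a * Poly_Mapping.single t b) =
      subst h f (Poly_Mapping.single s a) * subst h f (Poly_Mapping.single t b)" for s t a b
    by (simp add: mult_single subst_single h_mult lookup_add power_add prod.distrib algebra_simps)
  let ?m = "\<lambda>p t. Poly_Mapping.single t (Poly_Mapping.lookup p t)"
  have "subst h f ((\<Sum>s\<in>Poly_Mapping.keys p. ?m p s) * (\<Sum>t\<in>Poly_Mapping.keys q. ?m q t)) =
      subst h f (\<Sum>s\<in>Poly_Mapping.keys p. ?m p s) * subst h f (\<Sum>t\<in>Poly_Mapping.keys q. ?m q t)"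
    by (simp add: sum_product subst_sum single)
  then show ?thesis by (simp add: sum_monomials)
qed

lemma subst_mconst: "subst h f (mconst c) = h c"
  by (simp add: mconst_def subst_single)

lemma subst_mvar: "subst h f (mvar v) = f v"
proof -
  have "(\<Prod>w\<in>UNIV. f w ^ Poly_Mapping.lookup (Poly_Mapping.single v 1) w) = (\<Prod>w\<in>UNIV. if w = v then f v else 1)"
    by (intro prod.cong) (auto simp: lookup_single when_def)
  then show ?thesis by (simp add: mvar_def subst_single h_1)
qed

end

section \<open>Points and lines of the projective plane\<close>

definition dot :: "(3 \<Rightarrow> 'k::comm_ring_1) \<Rightarrow> (3 \<Rightarrow> 'k) \<Rightarrow> 'k" where
  "dot u v = (\<Sum>i\<in>UNIV. u i * v i)"

definition cross :: "(3 \<Rightarrow> 'k::comm_ring_1) \<Rightarrow> (3 \<Rightarrow> 'k) \<Rightarrow> 3 \<Rightarrow> 'k" where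
  "cross a b = (\<lambda>i. if i = 0 then a 1 * b 2 - a 2 * b 1 else
     if i = 1 then a 2 * b 0 - a 0 * b 2 else a 0 * b 1 - a 1 * b 0)"

definition det3 :: "(3 \<Rightarrow> 'k::comm_ring_1) \<Rightarrow> (3 \<Rightarrow> 'k) \<Rightarrow> (3 \<Rightarrow> 'k) \<Rightarrow> 'k" where
  "det3 a b c = dot a (cross b c)"

lemma dot3: "dot u v = u 0 * v 0 + u 1 * v 1 + u 2 * v 2"
  by (simp add: dot_def sum3)

lemma cross_3 [simp]: "cross a b 0 = a 1 * b 2 - a 2 * b 1" "cross a b 1 = a 2 * b 0 - a 0 * b 2"
  "cross a b 2 = a 0 * b 1 - a 1 * b 0"
  by (simp_all add: cross_def)

lemma det3_expand: "det3 a b c = a 0 * (b 1 * c 2 - b 2 * c 1) + a 1 * (b 2 * c 0 - b 0 * c 2) + a 2 * (b 0 * c 1 - b 1 * c 0)"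
  by (simp add: det3_def dot3)

lemma dot_commute: "dot u v = dot v u" by (simp add: dot3 mult.commute)

lemma dot_cross [simp]: "dot a (cross a b) = 0" "dot b (cross a b) = 0" "dot (cross a b) a = 0" "dot (cross a b) b = 0"
  by (simp_all add: dot3 algebra_simps)

lemma cross_zero: "cross (\<lambda>_. 0) b = (\<lambda>_. 0)" by (simp add: cross_def fun_eq_iff)

lemma cramer: "det3 a b c * v i = det3 v b c * a i + det3 a v c * b i + det3 a b v * c i"
  using exhaust3[of i] by (elim disjE) (simp_all add: det3_expand algebra_simps)

lemma dot_witness:
  fixes u :: "3 \<Rightarrow> 'k::field"
  assumes "u \<noteq> (\<lambda>_. 0)"
  shows "\<exists>w. dot w u = 1"
proof -
  obtain i where "u i \<noteq> 0" using assms by auto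
  then have "dot (\<lambda>j. if j = i then 1 / u i else 0) u = 1"
    using exhaust3[of i] by (auto simp: dot3)
  then show ?thesis by blast
qed

lemma proportional_if_cross_0:
  fixes a b :: "3 \<Rightarrow> 'k::field"
  assumes "cross a b = (\<lambda>_. 0)" "a \<noteq> (\<lambda>_. 0)"
  shows "\<exists>c. b = (\<lambda>i. c * a i)"
proof -
  obtain i where i: "a i \<noteq> 0" using assms(2) by auto
  have z: "cross a b 0 = 0" "cross a b 1 = 0" "cross a b 2 = 0" using assms(1) by (metis)+
  have "b j = (b i / a i) * a j" for j
    using z i exhaust3[of i] exhaust3[of j] by (elim disjE) (simp_all add: field_simps)
  then show ?thesis by blast
qed

text \<open>Every point is the intersection of two lines, and every line contains two points.\<close>

lemma ex_cross_product:
  fixes y :: "3 \<Rightarrow> 'k::field"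
  assumes "y \<noteq> (\<lambda>_. 0)"
  shows "\<exists>a b. cross a b = y"
proof -
  obtain i where "y i \<noteq> 0" using assms by auto
  consider "y 0 \<noteq> 0" | "y 1 \<noteq> 0" | "y 2 \<noteq> 0" using \<open>y i \<noteq> 0\<close> exhaust3[of i] by auto
  then show ?thesis
    proof cases
      case 1
      let ?a = "\<lambda>i. if i = 0 then - y 1 else if i = 1 then y 0 else 0"
      let ?b = "\<lambda>i. if i = 0 then - y 2 / y 0 else if i = 1 then 0 else 1"
      have "\<forall>i. cross ?a ?b i = y i" unfolding all3 using 1 by simp
      then show ?thesis by blast
    next
      case 2
      let ?a = "\<lambda>i. if i = 1 then - y 2 else if i = 2 then y 1 else 0"
      let ?b = "\<lambda>i. if i = 1 then - y 0 / y 1 else if i = 2 then 0 else 1"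
      have "\<forall>i. cross ?a ?b i = y i" unfolding all3 using 2 by simp
      then show ?thesis by blast
    next
      case 3
      let ?a = "\<lambda>i. if i = 2 then - y 0 else if i = 0 then y 2 else 0"
      let ?b = "\<lambda>i. if i = 2 then - y 1 / y 2 else if i = 0 then 0 else 1"
      have "\<forall>i. cross ?a ?b i = y i" unfolding all3 using 3 by simp
      then show ?thesis by blast
    qed
qed

lemma ex_common_point:
  fixes a b :: "3 \<Rightarrow> 'k::field"
  shows "\<exists>y. y \<noteq> (\<lambda>_. 0) \<and> dot a y = 0 \<and> dot b y = 0"
proof (cases "cross a b = (\<lambda>_. 0)")
  case False
  then show ?thesis by (intro exI[of _ "cross a b"]) simp
next
  case True
  show ?thesis
  proof (cases "a = (\<lambda>_. 0)")
    case a: False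
    obtain c where c: "b = (\<lambda>i. c * a i)" using proportional_if_cross_0[OF True a] by blast
    obtain p q where "cross p q = a" using ex_cross_product[OF a] by blast
    then have "p \<noteq> (\<lambda>_. 0)" "dot a p = 0" using a dot_cross(3)[of p q] by (auto simp: cross_zero)
    then show ?thesis by (intro exI[of _ p]) (simp add: c dot3 mult.assoc flip: distrib_left)
  next
    case a: True
    show ?thesis
    proof (cases "b = (\<lambda>_. 0)")
      case True
      have "(\<lambda>_ :: 3. 1 :: 'k) \<noteq> (\<lambda>_. 0)" by (rule notI, drule fun_cong[where x = 0]) simp
      then show ?thesis using a True by (intro exI[of _ "\<lambda>_. 1"]) (simp add: dot3)
    next
      case False
      obtain p q where "cross p q = b" using ex_cross_product[OF False] by blast
      then have "p \<noteq> (\<lambda>_. 0)" "dot b p = 0" using False dot_cross(3)[of p q] by (auto simp: cross_zero)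
      then show ?thesis using a by (intro exI[of _ p]) (simp add: dot3)
    qed
  qed
qed

text \<open>
  Points of the projective plane are nonzero vectors up to scaling; the condition says that the
  vectors in \<open>S\<close> represent finitely many points.
\<close>

definition projectively_finite :: "(3 \<Rightarrow> 'k::field) set \<Rightarrow> bool" where
  "projectively_finite S \<longleftrightarrow> (\<exists>F. finite F \<and> (\<lambda>_. 0) \<notin> F \<and> (\<forall>y\<in>S. \<exists>z\<in>F. \<exists>c. y = (\<lambda>i. c * z i)))"

lemma projectively_finite_subset: "projectively_finite T \<Longrightarrow> S \<subseteq> T \<Longrightarrow> projectively_finite S"
  unfolding projectively_finite_def by blast

text \<open>Points no three of which lie on a line.\<close>

definition general_position :: "(3 \<Rightarrow> 'k::field) set \<Rightarrow> bool" where
  "general_position S \<longleftrightarrow> (\<forall>a\<in>S. \<forall>b\<in>S. a \<noteq> b \<longrightarrow> cross a b \<noteq> (\<lambda>_. 0)) \<and>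
     (\<forall>a\<in>S. \<forall>b\<in>S. \<forall>c\<in>S. a \<noteq> b \<longrightarrow> b \<noteq> c \<longrightarrow> a \<noteq> c \<longrightarrow> det3 a b c \<noteq> 0)"

lemma general_position_subset: "general_position T \<Longrightarrow> S \<subseteq> T \<Longrightarrow> general_position S"
  unfolding general_position_def by blast

text \<open>
  A set of points that meets every line in finitely many points is either
  finite or contains arbitrarily large sets in general position: the lines
  through pairs of points of a maximal such set would cover everything.
\<close>

lemma finite_or_general_position:
  fixes S :: "(3 \<Rightarrow> 'k::field) set"
  assumes nz: "(\<lambda>_. 0) \<notin> S"
    and lines: "\<And>u. u \<noteq> (\<lambda>_. 0) \<Longrightarrow> projectively_finite {y \<in> S. dot u y = 0}"
    and not: "\<not> projectively_finite S"
  shows "\<exists>T. T \<subseteq> S \<and> general_position T \<and> finite T \<and> card T = N"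
proof (rule ccontr)
  assume none: "\<nexists>T. T \<subseteq> S \<and> general_position T \<and> finite T \<and> card T = N"
  let ?P = "\<lambda>k. \<exists>T. T \<subseteq> S \<and> general_position T \<and> finite T \<and> card T = k"
  have bound: "k \<le> N" if "?P k" for k
  proof (rule ccontr)
    assume "\<not> k \<le> N"
    from that obtain T where T: "T \<subseteq> S" "general_position T" "finite T" "card T = k" by blast
    with \<open>\<not> k \<le> N\<close> obtain T' where T': "T' \<subseteq> T" "card T' = N" "finite T'"
      by (metis linorder_le_cases obtain_subset_with_card_n)
    show False using none general_position_subset[OF T(2) T'(1)] T' T(1) by blast
  qed
  have "?P 0" by (intro exI[of _ "{}"]) (auto simp: general_position_def)
  then have "?P (GREATEST k. ?P k)" by (rule GreatestI_nat[where b = N]) (rule bound)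
  then obtain T where T: "T \<subseteq> S" "general_position T" "finite T" "card T = (GREATEST k. ?P k)" by blast
  have max: "k \<le> card T" if "?P k" for k
    unfolding T(4) using that by (rule Greatest_le_nat[where b = N]) (rule bound)
  let ?Q = "\<lambda>a b F. finite F \<and> (\<lambda>_. 0) \<notin> F \<and>
      (\<forall>y\<in>{y \<in> S. dot (cross a b) y = 0}. \<exists>z\<in>F. \<exists>c. y = (\<lambda>i. c * z i))"
  define F where "F a b = (SOME F. ?Q a b F)" for a b
  have F: "?Q a b (F a b)" if "a \<in> T" "b \<in> T" "a \<noteq> b" for a b
  proof -
    have "projectively_finite {y \<in> S. dot (cross a b) y = 0}" using that T(2) by (intro lines) (auto simp: general_position_def)
    then show ?thesis unfolding F_def projectively_finite_def by (rule someI_ex)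
  qed
  \<comment> \<open>By maximality of \<open>T\<close>, each point of \<open>S\<close> is in \<open>T\<close> or on a line through two points of \<open>T\<close>.\<close>
  define E where "E = T \<union> (\<Union>a\<in>T. \<Union>b\<in>T - {a}. F a b)"
  have "finite E" "(\<lambda>_. 0) \<notin> E" unfolding E_def using T F nz by auto
  moreover have "\<exists>z\<in>E. \<exists>c. y = (\<lambda>i. c * z i)" if y: "y \<in> S" for y
  proof (cases "y \<in> T")
    case True
    then show ?thesis unfolding E_def by (intro bexI[of _ y] exI[of _ 1]) auto
  next
    case False
    have "\<not> general_position (insert y T)"
      using max[of "Suc (card T)"] False T y by (metis Suc_n_not_le_n card_insert_disjoint finite_insert insert_subset)
    have sym: "cross a b = (\<lambda>_. 0) \<Longrightarrow> cross b a = (\<lambda>_. 0)" for a b :: "3 \<Rightarrow> 'k"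
      unfolding fun_eq_iff all3 by (simp add: algebra_simps)
    have d: "det3 a b y = dot (cross a b) y" "det3 a y b = - dot (cross a b) y" "det3 y a b = dot (cross a b) y" for a b
      by (simp_all add: det3_expand dot3 algebra_simps)
    from \<open>\<not> general_position (insert y T)\<close> consider (1) a where "a \<in> T" "cross a y = (\<lambda>_. 0)"
      | (2) a b where "a \<in> T" "b \<in> T" "a \<noteq> b" "dot (cross a b) y = 0"
    proof -
      assume *: "\<And>a. a \<in> T \<Longrightarrow> cross a y = (\<lambda>_. 0) \<Longrightarrow> thesis"
        and **: "\<And>a b. a \<in> T \<Longrightarrow> b \<in> T \<Longrightarrow> a \<noteq> b \<Longrightarrow> dot (cross a b) y = 0 \<Longrightarrow> thesis"
      show thesis
      proof (rule ccontr)
        assume nt: "\<not> thesis"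
        have "cross a b \<noteq> (\<lambda>_. 0)" if "a \<in> insert y T" "b \<in> insert y T" "a \<noteq> b" for a b
          using that T(2) nt * sym unfolding general_position_def by blast
        moreover have "det3 a b c \<noteq> 0"
          if "a \<in> insert y T" "b \<in> insert y T" "c \<in> insert y T" "a \<noteq> b" "b \<noteq> c" "a \<noteq> c" for a b c
        proof -
          have "det3 a b c \<noteq> 0" if "a \<in> T" "b \<in> T" "c \<in> T" "a \<noteq> b" "b \<noteq> c" "a \<noteq> c" for a b c
            using T(2) that unfolding general_position_def by blast
          moreover have "dot (cross a b) y \<noteq> 0" if "a \<in> T" "b \<in> T" "a \<noteq> b" for a b
            using nt ** that by blast
          ultimately show ?thesis using that by (elim insertE) (simp_all add: d)
        qed
        ultimately show False using \<open>\<not> general_position (insert y T)\<close> unfolding general_position_def by blast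
      qed
    qed
    then show ?thesis
    proof cases
      case 1
      then obtain c where "y = (\<lambda>i. c * a i)" using proportional_if_cross_0[of a y] nz T(1) by blast
      then show ?thesis using 1 by (auto simp: E_def)
    next
      case 2
      then obtain z c where "z \<in> F a b" "y = (\<lambda>i. c * z i)" using F[of a b] y by blast
      then show ?thesis using 2 by (auto simp: E_def)
    qed
  qed
  ultimately show False using not unfolding projectively_finite_def by blast
qed

section \<open>Linear forms, evaluation and restriction to lines\<close>

definition lin :: "(3 \<Rightarrow> 'k::field) \<Rightarrow> (3, 'k) mpoly" where
  "lin u = (\<Sum>i\<in>UNIV. mconst (u i) * mvar i)"

lemma lin_add: "lin (\<lambda>i. u i + v i) = lin u + lin v"
  by (simp add: lin_def mconst_add algebra_simps sum.distrib)

lemma lin_scale: "lin (\<lambda>i. c * u i) = mconst c * lin u"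
  by (simp add: lin_def mconst_mult sum_distrib_left mult.assoc)

lemma lin_in_poly_comp [simp, intro]: "lin u \<in> poly_comp 1"
  unfolding lin_def by (intro poly_comp_sum poly_comp_scale mvar_in_poly_comp)

lemma lin_in_poly_comp' [simp]: "lin u \<in> poly_comp (Suc 0)"
  using lin_in_poly_comp[of u] by simp

lemma mvar_in_poly_comp' [simp]: "mvar v \<in> poly_comp (Suc 0)"
  using mvar_in_poly_comp[of v] by simp

lemma mvar_eq_lin: "mvar j = lin (\<lambda>i. if i = j then 1 else 0)"
proof -
  have "lin (\<lambda>i. if i = j then 1 else 0) = (\<Sum>i\<in>UNIV. if i = j then mvar j else 0)"
    unfolding lin_def by (intro sum.cong) auto
  also have "\<dots> = mvar j" by simp
  finally show ?thesis by (rule sym)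
qed

lemma poly_comp_1_lin:
  fixes p :: "(3, 'k::field) mpoly"
  assumes "p \<in> poly_comp 1" shows "\<exists>u. p = lin u"
proof -
  have "n = 1 \<longrightarrow> (\<exists>u. p = lin u)" if "p \<in> poly_comp n" for n
    using that
  proof (induction rule: form_induct)
    case (add n p q)
    show ?case
    proof
      assume "n = 1"
      then obtain a b where "p = lin a" "q = lin b" using add by blast
      then show "\<exists>u. p + q = lin u" by (intro exI[of _ "\<lambda>i. a i + b i"]) (simp add: lin_add)
    qed
  next
    case (mult n p v)
    have "\<exists>u. mvar v * p = lin u" if n: "n = 0"
    proof -
      obtain c where "p = mconst c" using mult.hyps n poly_comp_0_const by blast
      then have "mvar v * p = lin (\<lambda>i. c * (if i = v then 1 else 0))"
        unfolding lin_scale mvar_eq_lin by (simp add: mult.commute)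
      then show ?thesis by blast
    qed
    then show ?case by simp
  qed simp
  with assms show ?thesis by simp
qed

definition ev :: "(3 \<Rightarrow> 'k::field) \<Rightarrow> (3, 'k) mpoly \<Rightarrow> 'k" where
  "ev y = subst (\<lambda>c. c) y"

text \<open>
  The restriction of a form to the line through the points \<open>y\<close> and \<open>z\<close>, as a polynomial in the
  coordinate \<open>t\<close> of \<open>y + t z\<close>. The point \<open>z\<close> itself sits at infinity: there a form of degree \<open>n\<close>
  takes the coefficient of \<open>t\<^sup>n\<close> as its value.
\<close>

definition on_line :: "(3 \<Rightarrow> 'k::field) \<Rightarrow> (3 \<Rightarrow> 'k) \<Rightarrow> (3, 'k) mpoly \<Rightarrow> 'k poly" where
  "on_line y z = subst (\<lambda>c. [:c:]) (\<lambda>i. [:y i, z i:])"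

interpretation id_hom: coefficient_hom "\<lambda>c :: 'k::field. c"
  by unfold_locales auto

interpretation const_hom: coefficient_hom "\<lambda>c :: 'k::field. [:c:]"
  by unfold_locales (auto simp: one_pCons)

lemma ev_simps [simp]: "ev y (p + q) = ev y p + ev y q" "ev y (p * q) = ev y p * ev y q"
  "ev y (mconst c) = c" "ev y (mvar v) = y v" "ev y 0 = 0"
  by (simp_all add: ev_def id_hom.subst_add id_hom.subst_mult id_hom.subst_mconst id_hom.subst_mvar id_hom.subst_0)

lemma ev_1 [simp]: "ev y 1 = 1" using ev_simps(3)[of y 1] by simp

lemma ev_power [simp]: "ev y (p ^ n) = ev y p ^ n" by (induction n) auto

lemma ev_sum: "ev y (sum f A) = (\<Sum>x\<in>A. ev y (f x))"
  by (induction A rule: infinite_finite_induct) auto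

lemma ev_lin [simp]: "ev y (lin u) = dot u y"
  by (simp add: lin_def ev_sum dot_def)

lemma on_line_simps [simp]: "on_line y z (p + q) = on_line y z p + on_line y z q" "on_line y z (p * q) = on_line y z p * on_line y z q"
  "on_line y z (mconst c) = [:c:]" "on_line y z (mvar v) = [:y v, z v:]" "on_line y z 0 = 0"
  by (simp_all add: on_line_def const_hom.subst_add const_hom.subst_mult const_hom.subst_mconst const_hom.subst_mvar const_hom.subst_0)

lemma on_line_uminus [simp]: "on_line y z (- p) = - on_line y z p"
  using on_line_simps(1)[of y z p "- p"] by (simp add: add_eq_0_iff)

lemma on_line_diff [simp]: "on_line y z (p - q) = on_line y z p - on_line y z q"
  using on_line_simps(1)[of y z p "- q"] by simp

lemma on_line_1 [simp]: "on_line y z 1 = 1" using on_line_simps(3)[of y z 1] by (simp add: one_pCons)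

lemma on_line_power [simp]: "on_line y z (p ^ n) = on_line y z p ^ n" by (induction n) auto

lemma on_line_sum: "on_line y z (sum f A) = (\<Sum>x\<in>A. on_line y z (f x))"
  by (induction A rule: infinite_finite_induct) auto

lemma on_line_lin: "on_line y z (lin u) = [:dot u y, dot u z:]"
  by (simp add: lin_def on_line_sum dot_def sum3)

lemma lin_eq_0_iff [simp]: "lin u = 0 \<longleftrightarrow> u = (\<lambda>_. 0)"
proof
  assume "lin u = 0"
  then have "dot u y = 0" for y by (metis ev_lin ev_simps(5))
  then show "u = (\<lambda>_. 0)" using dot_witness[of u] by (metis dot_commute zero_neq_one)
qed (simp add: lin_def)

lemma ev_scale: "p \<in> poly_comp n \<Longrightarrow> ev (\<lambda>i. c * y i) p = c ^ n * ev y p"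
  by (induction rule: form_induct) (simp_all add: algebra_simps)

lemma form_on_line:
  assumes "p \<in> poly_comp n"
  shows "degree (on_line y z p) \<le> n" "coeff (on_line y z p) n = ev z p" "poly (on_line y z p) t = ev (\<lambda>i. y i + t * z i) p"
  using assms
proof (induction rule: form_induct)
  case (add n p q)
  { case 1 show ?case using add by (simp add: degree_add_le) }
  { case 2 show ?case using add by simp }
  { case 3 show ?case using add by simp }
next
  case (mult n p v)
  { case 1
    have "degree ([:y v, z v:] * on_line y z p) \<le> degree [:y v, z v:] + degree (on_line y z p)" by (rule degree_mult_le)
    also have "\<dots> \<le> 1 + n" using mult by (intro add_mono) auto
    finally show ?case by simp }
  { case 2
    have "coeff (on_line y z p) (Suc n) = 0" using mult by (intro coeff_eq_0) auto
    then show ?case using mult by simp }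
  { case 3 show ?case using mult by (simp add: algebra_simps) }
qed simp_all

lemma on_line_eq_0_iff:
  assumes inf: "infinite (UNIV :: 'k::field set)" and "p \<in> poly_comp n" "finite A"
    and "\<And>t :: 'k. t \<notin> A \<Longrightarrow> ev (\<lambda>i. y i + t * z i) p = 0"
  shows "on_line y z p = 0"
proof (rule ccontr)
  assume "on_line y z p \<noteq> 0"
  then have "finite ({t. poly (on_line y z p) t = 0} \<union> A)" using poly_roots_finite assms(3) by blast
  moreover have "{t. poly (on_line y z p) t = 0} \<union> A = UNIV"
    using assms(4) form_on_line(3)[OF assms(2)] by auto
  ultimately show False using inf by simp
qed

text \<open>The third linear form is a coordinate on the quotient by the other two.\<close>

lemma form_mod_two_linear_forms:
  assumes "det3 a b c \<noteq> 0" "p \<in> poly_comp n"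
  shows "\<exists>r s k. p = lin a * r + lin b * s + mconst k * lin c ^ n"
  using assms(2)
proof (induction rule: form_induct)
  case (const k)
  then show ?case by (metis add_0 mult_1_right mult_zero_right power_0)
next
  case (add n p q)
  then obtain r s k r' s' k' where "p = lin a * r + lin b * s + mconst k * lin c ^ n"
    "q = lin a * r' + lin b * s' + mconst k' * lin c ^ n" by blast
  then have "p + q = lin a * (r + r') + lin b * (s + s') + mconst (k + k') * lin c ^ n"
    by (simp add: mconst_add algebra_simps)
  then show ?case by blast
next
  case (mult n p v)
  then obtain r s k where p: "p = lin a * r + lin b * s + mconst k * lin c ^ n" by blast
  let ?e = "\<lambda>i. if i = v then 1 else 0" and ?d = "det3 a b c"
  have "?e = (\<lambda>i. (det3 ?e b c / ?d) * a i + (det3 a ?e c / ?d) * b i + (det3 a b ?e / ?d) * c i)"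
  proof
    fix i
    show "?e i = (det3 ?e b c / ?d) * a i + (det3 a ?e c / ?d) * b i + (det3 a b ?e / ?d) * c i"
      using cramer[of a b c ?e i] assms(1) by (simp add: field_simps)
  qed
  then obtain \<alpha> \<beta> \<gamma> where "?e = (\<lambda>i. \<alpha> * a i + \<beta> * b i + \<gamma> * c i)" by blast
  then have v: "mvar v = mconst \<alpha> * lin a + mconst \<beta> * lin b + mconst \<gamma> * lin c"
    by (simp add: mvar_eq_lin lin_add lin_scale)
  have "mvar v * p = lin a * (mconst \<alpha> * p + mconst \<gamma> * lin c * r) + lin b * (mconst \<beta> * p + mconst \<gamma> * lin c * s)
      + mconst (\<gamma> * k) * lin c ^ Suc n"
    unfolding v by (simp add: p mconst_mult algebra_simps)
  then show ?case by blast
qed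

text \<open>
  The inverse of the restriction to a line on which \<open>s\<close> becomes \<open>1\<close> and \<open>t\<close> becomes the coordinate.
\<close>

definition homogenize :: "(3, 'k::field) mpoly \<Rightarrow> (3, 'k) mpoly \<Rightarrow> nat \<Rightarrow> 'k poly \<Rightarrow> (3, 'k) mpoly" where
  "homogenize s t n c = (\<Sum>k\<le>n. mconst (coeff c k) * (s ^ (n - k) * t ^ k))"

lemma homogenize_add: "homogenize s t n (c + d) = homogenize s t n c + homogenize s t n d"
  by (simp add: homogenize_def mconst_add algebra_simps sum.distrib)

lemma homogenize_step:
  assumes "degree c \<le> n"
  shows "homogenize s t (Suc n) ([:\<alpha>, \<beta>:] * c) = (mconst \<alpha> * s + mconst \<beta> * t) * homogenize s t n c"
proof -
  have "coeff c (Suc n) = 0" using assms by (intro coeff_eq_0) auto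
  then have 1: "homogenize s t (Suc n) (smult \<alpha> c) = mconst \<alpha> * s * homogenize s t n c"
    unfolding homogenize_def
    by (simp add: mconst_mult sum_distrib_left Suc_diff_le mult_ac cong: sum.cong_simp)
  have 2: "homogenize s t (Suc n) (pCons 0 (smult \<beta> c)) = mconst \<beta> * t * homogenize s t n c"
    unfolding homogenize_def sum.atMost_Suc_shift
    by (simp add: mconst_mult sum_distrib_left mult_ac)
  show ?thesis using 1 2 by (simp add: homogenize_add algebra_simps)
qed

lemma homogenize_in_poly_comp:
  "s \<in> poly_comp 1 \<Longrightarrow> t \<in> poly_comp 1 \<Longrightarrow> homogenize s t n c \<in> poly_comp n"
  unfolding homogenize_def
  by (intro poly_comp_sum poly_comp_scale)
     (metis atMost_iff le_add_diff_inverse2 poly_comp_mult poly_comp_power1)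

text \<open>
  Restricting forms to the line \<open>u = 0\<close>, parametrized by two of its points,
  identifies the forms of degree \<open>n\<close> modulo \<open>u\<close> with the polynomials of degree
  at most \<open>n\<close> in one variable.
\<close>

definition chart :: "(3 \<Rightarrow> 'k::field) \<Rightarrow> (3 \<Rightarrow> 'k) \<Rightarrow> (3 \<Rightarrow> 'k) \<Rightarrow> bool" where
  "chart u y z \<longleftrightarrow> dot u y = 0 \<and> dot u z = 0 \<and> z \<noteq> (\<lambda>_. 0) \<and> (\<forall>t. (\<lambda>i. y i + t * z i) \<noteq> (\<lambda>_. 0)) \<and>
     (\<forall>w. dot u w = 0 \<longrightarrow> (\<exists>\<alpha> \<beta>. w = (\<lambda>i. \<alpha> * y i + \<beta> * z i))) \<and>
     (\<forall>n. \<forall>p\<in>poly_comp n. on_line y z p = 0 \<longrightarrow> (\<exists>r. p = lin u * r)) \<and>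
     (\<forall>n c. degree c \<le> n \<longrightarrow> (\<exists>p\<in>poly_comp n. on_line y z p = c)) \<and>
     on_line y z (lin u) = 0"

lemma
  assumes "chart u y z"
  shows chart_dot: "dot u y = 0" "dot u z = 0"
    and chart_nonzero: "z \<noteq> (\<lambda>_. 0)" "(\<lambda>i. y i + t * z i) \<noteq> (\<lambda>_. 0)"
    and chart_point: "dot u w = 0 \<Longrightarrow> \<exists>\<alpha> \<beta>. w = (\<lambda>i. \<alpha> * y i + \<beta> * z i)"
    and chart_kernel: "p \<in> poly_comp n \<Longrightarrow> on_line y z p = 0 \<Longrightarrow> \<exists>r. p = lin u * r"
    and chart_lift: "degree c \<le> n \<Longrightarrow> \<exists>p\<in>poly_comp n. on_line y z p = c"
    and chart_lin: "on_line y z (lin u) = 0"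
  using assms unfolding chart_def by blast+

text \<open>
  A coordinate \<open>i\<close> with \<open>u i \<noteq> 0\<close> is eliminated by \<open>u\<close>; the other two variables become the
  homogeneous coordinates on the line.
\<close>

lemma ex_chart:
  fixes u :: "3 \<Rightarrow> 'k::field"
  assumes u: "u \<noteq> (\<lambda>_. 0)"
  shows "\<exists>y z. chart u y z"
proof -
  obtain i where i: "u i \<noteq> 0" using u by auto
  obtain j k where jk: "i \<noteq> j" "j \<noteq> k" "i \<noteq> k" "UNIV = {i, j, k}"
  proof -
    consider "i = 0" | "i = 1" | "i = 2" using exhaust3 by blast
    then show thesis
    proof cases
      case 1 then show thesis using that[of 1 2] UNIV3 by simp
    next
      case 2 then show thesis using that[of 0 2] UNIV3 by (simp add: insert_commute)
    next
      case 3 then show thesis using that[of 0 1] UNIV3 by (simp add: insert_commute)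
    qed
  qed
  have dot: "dot a b = a i * b i + a j * b j + a k * b k" for a b :: "3 \<Rightarrow> 'k"
    unfolding dot_def jk(4) using jk(1-3) by (simp add: add.assoc)
  have cases: "x = i \<or> x = j \<or> x = k" for x using jk(4) by blast
  define y where "y = (\<lambda>x. if x = i then - u j / u i else if x = j then 1 else 0)"
  define z where "z = (\<lambda>x. if x = i then - u k / u i else if x = k then 1 else 0)"
  define s t where "s = (mvar j :: (3, 'k) mpoly)" and "t = (mvar k :: (3, 'k) mpoly)"
  have st: "s \<in> poly_comp 1" "t \<in> poly_comp 1" "on_line y z s = 1" "on_line y z t = [:0, 1:]"
    using jk by (auto simp: s_def t_def y_def z_def one_pCons)
  have lin_u: "lin u = mconst (u i) * mvar i + mconst (u j) * s + mconst (u k) * t"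
    unfolding lin_def jk(4) s_def t_def using jk(1-3) by (simp add: add.assoc)
  have var: "mvar x = mconst (y x) * s + mconst (z x) * t + mconst (if x = i then 1 / u i else 0) * lin u" for x
  proof -
    have "mconst (- u j / u i) * s + mconst (- u k / u i) * t + mconst (1 / u i) * lin u = mvar i"
      unfolding lin_u using i by (simp add: algebra_simps mconst_uminus flip: mconst_mult mult.assoc)
    then show ?thesis using cases[of x] jk by (auto simp: y_def z_def s_def t_def)
  qed
  have main: "\<exists>r. p = homogenize s t n (on_line y z p) + lin u * r" if "p \<in> poly_comp n" for n p
    using that
  proof (induction rule: form_induct)
    case (const c)
    then show ?case by (intro exI[of _ 0]) (simp add: homogenize_def)
  next
    case (add n p q)
    then obtain r r' where r: "p = homogenize s t n (on_line y z p) + lin u * r" and r': "q = homogenize s t n (on_line y z q) + lin u * r'"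
      by blast
    have "p + q = (homogenize s t n (on_line y z p) + lin u * r) + (homogenize s t n (on_line y z q) + lin u * r')"
      using arg_cong2[where f = "(+)", OF r r'] .
    also have "\<dots> = homogenize s t n (on_line y z (p + q)) + lin u * (r + r')"
      by (simp add: homogenize_add algebra_simps)
    finally show ?case by blast
  next
    case (mult n p v)
    then obtain r where r: "p = homogenize s t n (on_line y z p) + lin u * r" by blast
    define c d where "c = mconst (y v) * s + mconst (z v) * t" and "d = (mconst (if v = i then 1 / u i else 0) :: (3, 'k) mpoly)"
    have e1: "homogenize s t (Suc n) (on_line y z (mvar v * p)) = c * homogenize s t n (on_line y z p)"
      using homogenize_step[OF form_on_line(1)[OF mult.hyps(1)]] by (simp add: c_def)
    have e2: "mvar v * p = c * p + lin u * (d * p)"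
      unfolding var[of v] by (simp add: c_def d_def algebra_simps)
    have e3: "c * p = c * (homogenize s t n (on_line y z p) + lin u * r)" by (rule arg_cong[OF r])
    have "mvar v * p = c * (homogenize s t n (on_line y z p) + lin u * r) + lin u * (d * p)"
      using e2 e3 by (rule trans[OF _ arg_cong[where f = "\<lambda>x. x + _"]])
    also have "\<dots> = c * homogenize s t n (on_line y z p) + lin u * (c * r + d * p)" by (simp add: algebra_simps)
    finally have "mvar v * p = homogenize s t (Suc n) (on_line y z (mvar v * p)) + lin u * (c * r + d * p)"
      unfolding e1 .
    then show ?case by blast
  qed
  have surj: "on_line y z (homogenize s t n c) = c" if "degree c \<le> n" for n and c :: "'k poly"
  proof -
    have "on_line y z (homogenize s t n c) = (\<Sum>k\<le>n. monom (coeff c k) k)"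
      unfolding homogenize_def by (simp add: on_line_sum st monom_altdef)
    also have "\<dots> = c" using that by (simp add: poly_as_sum_of_monoms')
    finally show ?thesis .
  qed
  have "chart u y z"
    unfolding chart_def
  proof (intro conjI allI impI ballI)
    show "dot u y = 0" "dot u z = 0" unfolding dot using i jk by (simp_all add: y_def z_def)
    then show "on_line y z (lin u) = 0" by (simp add: on_line_lin)
    show "z \<noteq> (\<lambda>_. 0)" using jk by (auto simp: z_def fun_eq_iff)
    show "(\<lambda>i. y i + t * z i) \<noteq> (\<lambda>_. 0)" for t using jk by (auto simp: y_def z_def fun_eq_iff intro!: exI[of _ j])
    show "\<exists>\<alpha> \<beta>. w = (\<lambda>i. \<alpha> * y i + \<beta> * z i)" if "dot u w = 0" for w
    proof (intro exI ext)
      fix x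
      have "u i * w i = - (u j * w j + u k * w k)" using that unfolding dot by (simp add: add_eq_0_iff2 add.assoc)
      then show "w x = w j * y x + w k * z x"
        using cases[of x] jk i by (auto simp: y_def z_def field_simps)
    qed
    show "\<exists>r. p = lin u * r" if "p \<in> poly_comp n" "on_line y z p = 0" for n p
      using main[OF that(1)] that(2) by (simp add: homogenize_def)
    show "\<exists>p\<in>poly_comp n. on_line y z p = c" if "degree c \<le> n" for n c
      using surj[OF that] homogenize_in_poly_comp[OF st(1,2)] by blast
  qed
  then show ?thesis by blast
qed

text \<open>
  Divide by the first coordinate \<open>u\<close>: the form vanishes on the line \<open>u = 0\<close>, so it is a multiple
  of \<open>u\<close>, and the cofactor vanishes off that line, hence everywhere by continuation along lines.
\<close>

lemma form_eq_0:
  fixes p :: "(3, 'k::field) mpoly"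
  assumes inf: "infinite (UNIV :: 'k set)" and "p \<in> poly_comp n" "\<And>y. ev y p = 0"
  shows "p = 0"
  using assms(2,3)
proof (induction n arbitrary: p)
  case 0
  then show ?case by (metis poly_comp_0_const ev_simps(3) mconst_0)
next
  case (Suc n)
  define u :: "3 \<Rightarrow> 'k" where "u = (\<lambda>i. if i = 0 then 1 else 0)"
  have u0: "u \<noteq> (\<lambda>_. 0)" by (auto simp: u_def fun_eq_iff)
  obtain y z where yz: "chart u y z" using ex_chart[OF u0] by blast
  have "on_line y z p = 0" by (rule on_line_eq_0_iff[OF inf Suc.prems(1), of "{}"]) (use Suc.prems in auto)
  with chart_kernel[OF yz Suc.prems(1)] obtain r where "p = lin u * r" by blast
  then have r: "p = lin u * hcomp n r" by (rule homogeneous_cofactor[OF Suc.prems(1) lin_in_poly_comp])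
  have "hcomp n r = 0"
  proof (rule Suc.IH)
    fix y
    have dotu: "dot u v = v 0" for v by (simp add: dot3 u_def)
    have "on_line y u (hcomp n r) = 0"
    proof (rule on_line_eq_0_iff[OF inf hcomp_in_poly_comp, of "{- y 0}"])
      fix t assume "t \<notin> {- y 0}"
      then have "y 0 + t \<noteq> 0" by (auto simp: add_eq_0_iff)
      then have "dot u (\<lambda>i. y i + t * u i) \<noteq> 0" unfolding dotu by (simp add: u_def)
      then show "ev (\<lambda>i. y i + t * u i) (hcomp n r) = 0"
        using Suc.prems(2)[of "\<lambda>i. y i + t * u i"] by (subst (asm) r) simp
    qed auto
    then show "ev y (hcomp n r) = 0" using form_on_line(3)[OF hcomp_in_poly_comp, of y u n r 0] by simp
  qed simp
  with r show ?case by simp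
qed

text \<open>A restriction to the line with infinitely many zeros is zero.\<close>

lemma line_divides:
  fixes p :: "(3, 'k::field) mpoly"
  assumes u: "u \<noteq> (\<lambda>_. 0)" and p: "p \<in> poly_comp n"
    and inf: "\<not> projectively_finite {y. y \<noteq> (\<lambda>_. 0) \<and> dot u y = 0 \<and> ev y p = 0}"
  shows "\<exists>r. p = lin u * r"
proof -
  obtain y z where yz: "chart u y z" using ex_chart[OF u] by blast
  show ?thesis
  proof (cases "on_line y z p = 0")
    case False
    define F where "F = insert z ((\<lambda>t i. y i + t * z i) ` {t. poly (on_line y z p) t = 0})"
    have "finite F" unfolding F_def using poly_roots_finite[OF False] by simp
    moreover have "(\<lambda>_. 0) \<notin> F"
    proof
      assume "(\<lambda>_. 0) \<in> F"
      then have "z = (\<lambda>_. 0) \<or> (\<exists>t. (\<lambda>i. y i + t * z i) = (\<lambda>_. 0))" unfolding F_def by (elim insertE imageE) (simp_all, metis)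
      with chart_nonzero[OF yz] show False by blast
    qed
    moreover have "\<exists>x\<in>F. \<exists>c. w = (\<lambda>i. c * x i)" if w: "dot u w = 0" "ev w p = 0" for w
    proof -
      obtain \<alpha> \<beta> where ab: "w = (\<lambda>i. \<alpha> * y i + \<beta> * z i)" using chart_point[OF yz w(1)] by blast
      show ?thesis
      proof (cases "\<alpha> = 0")
        case True
        then show ?thesis using ab by (auto simp: F_def)
      next
        case False
        then have eq: "w = (\<lambda>i. \<alpha> * (y i + (\<beta> / \<alpha>) * z i))" using ab by (simp add: distrib_left)
        then have "ev w p = \<alpha> ^ n * ev (\<lambda>i. y i + (\<beta> / \<alpha>) * z i) p" using ev_scale[OF p, of \<alpha> "\<lambda>i. y i + (\<beta> / \<alpha>) * z i"] by simp
        with w(2) False have "ev (\<lambda>i. y i + (\<beta> / \<alpha>) * z i) p = 0" by simp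
        then have "poly (on_line y z p) (\<beta> / \<alpha>) = 0" by (simp add: form_on_line(3)[OF p])
        then have "(\<lambda>i. y i + (\<beta> / \<alpha>) * z i) \<in> F" unfolding F_def by blast
        with eq show ?thesis by (intro bexI exI[of _ \<alpha>])
      qed
    qed
    ultimately have "projectively_finite {y. y \<noteq> (\<lambda>_. 0) \<and> dot u y = 0 \<and> ev y p = 0}" unfolding projectively_finite_def by blast
    with inf show ?thesis by blast
  qed (rule chart_kernel[OF yz p])
qed

text \<open>
  All points of \<open>T\<close> lie on \<open>n\<close> lines, at most two on each, that avoid \<open>y\<close>; the product of the lines
  separates \<open>y\<close> from \<open>T\<close>.
\<close>

lemma separating_form:
  fixes y :: "3 \<Rightarrow> 'k::field"
  assumes "finite T" "card T \<le> 2 * n" "y \<noteq> (\<lambda>_. 0)"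
    and "\<And>a. a \<in> T \<Longrightarrow> cross y a \<noteq> (\<lambda>_. 0)" "\<And>a b. a \<in> T \<Longrightarrow> b \<in> T \<Longrightarrow> a \<noteq> b \<Longrightarrow> det3 y a b \<noteq> 0"
  shows "\<exists>p\<in>poly_comp n. ev y p \<noteq> 0 \<and> (\<forall>a\<in>T. ev a p = 0)"
  using assms(1,2,4,5)
proof (induction n arbitrary: T)
  case 0
  then have "T = {}" by simp
  then show ?case using mconst_in_poly_comp[of 1] by (intro bexI[of _ 1]) auto
next
  case (Suc n)
  have "\<exists>w T'. T' \<subseteq> T \<and> card T' \<le> 2 * n \<and> dot w y \<noteq> 0 \<and> (\<forall>a\<in>T - T'. dot w a = 0)"
  proof (cases "T = {}")
    case True
    obtain w where "dot w y = 1" using dot_witness[OF assms(3)] by blast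
    then show ?thesis using True by (intro exI[of _ w] exI[of _ "{}"]) simp
  next
    case False
    then obtain a where a: "a \<in> T" by blast
    show ?thesis
    proof (cases "T = {a}")
      case True
      obtain w where "dot w (cross y a) = 1" using dot_witness[OF Suc.prems(3)[OF a]] by blast
      moreover have "dot (cross a w) y = dot w (cross y a)" by (simp add: dot3 algebra_simps)
      ultimately show ?thesis using True by (intro exI[of _ "cross a w"] exI[of _ "{}"]) auto
    next
      case False
      then obtain b where b: "b \<in> T" "a \<noteq> b" using a by blast
      have "dot (cross a b) y \<noteq> 0" using Suc.prems(4)[OF a b(1,2)] by (simp add: det3_expand dot3 algebra_simps)
      moreover have "card (T - {a, b}) \<le> 2 * n" using Suc.prems a b by (simp add: card_Diff_subset)
      ultimately show ?thesis by (intro exI[of _ "cross a b"] exI[of _ "T - {a, b}"]) auto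
    qed
  qed
  then obtain w T' where w: "T' \<subseteq> T" "card T' \<le> 2 * n" "dot w y \<noteq> 0" "\<forall>a\<in>T - T'. dot w a = 0" by blast
  have "\<exists>p\<in>poly_comp n. ev y p \<noteq> 0 \<and> (\<forall>a\<in>T'. ev a p = 0)"
    using w(1,2) Suc.prems finite_subset[OF w(1)] by (intro Suc.IH) blast+
  then obtain p where p: "p \<in> poly_comp n" "ev y p \<noteq> 0" "\<forall>a\<in>T'. ev a p = 0" by blast
  show ?case
  proof (intro bexI conjI ballI)
    show "lin w * p \<in> poly_comp (Suc n)" using poly_comp_mult[OF lin_in_poly_comp p(1)] by simp
    show "ev y (lin w * p) \<noteq> 0" using w p by simp
    show "ev a (lin w * p) = 0" if "a \<in> T" for a using w p that by (cases "a \<in> T'") auto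
  qed
qed

section \<open>Dimension counts for forms\<close>

definition mono3 :: "nat \<Rightarrow> nat \<Rightarrow> nat \<Rightarrow> 3 \<Rightarrow>\<^sub>0 nat" where
  "mono3 a b c = Poly_Mapping.single 0 a + Poly_Mapping.single 1 b + Poly_Mapping.single 2 c"

lemma lookup_mono3: "Poly_Mapping.lookup (mono3 a b c) 0 = a" "Poly_Mapping.lookup (mono3 a b c) 1 = b"
  "Poly_Mapping.lookup (mono3 a b c) 2 = c"
  by (simp_all add: mono3_def lookup_add lookup_single when_def)

lemma mono3_lookup: "mono3 (Poly_Mapping.lookup t 0) (Poly_Mapping.lookup t 1) (Poly_Mapping.lookup t 2) = t"
proof (rule poly_mapping_eqI)
  fix i
  show "Poly_Mapping.lookup (mono3 (Poly_Mapping.lookup t 0) (Poly_Mapping.lookup t 1) (Poly_Mapping.lookup t 2)) i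
      = Poly_Mapping.lookup t i"
    using exhaust3[of i] by (elim disjE) (simp_all only: lookup_mono3)
qed

lemma mdeg3: "mdeg t = Poly_Mapping.lookup t 0 + Poly_Mapping.lookup t 1 + Poly_Mapping.lookup t (2 :: 3)"
  by (simp only: mdeg_def sum3)

lemma mdeg_mono3: "mdeg (mono3 a b c) = a + b + c"
  by (simp only: mdeg3 lookup_mono3)

definition pairs_upto :: "nat \<Rightarrow> (nat \<times> nat) set" where
  "pairs_upto n = {(a, b). a + b \<le> n}"

lemma finite_pairs_upto: "finite (pairs_upto n)"
  by (rule finite_subset[of _ "{..n} \<times> {..n}"]) (auto simp: pairs_upto_def)

lemma card_pairs_upto: "card (pairs_upto (Suc n)) = card (pairs_upto n) + (n + 2)"
proof -
  let ?D = "(\<lambda>a. (a, Suc n - a)) ` {..Suc n}"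
  have "pairs_upto (Suc n) = pairs_upto n \<union> ?D"
    by (auto simp: pairs_upto_def image_iff)
  moreover have "pairs_upto n \<inter> ?D = {}" by (auto simp: pairs_upto_def)
  moreover have "card ?D = n + 2" by (subst card_image) (auto simp: inj_on_def)
  ultimately show ?thesis using finite_pairs_upto by (simp add: card_Un_disjoint)
qed

lemma monomials_of_degree:
  "bij_betw (\<lambda>(a, b). mono3 a b (n - a - b)) (pairs_upto n) {t :: 3 \<Rightarrow>\<^sub>0 nat. mdeg t = n}"
proof (rule bij_betw_byWitness[where f' = "\<lambda>t :: 3 \<Rightarrow>\<^sub>0 nat. (Poly_Mapping.lookup t 0, Poly_Mapping.lookup t 1)"])
  show "\<forall>x\<in>pairs_upto n. (\<lambda>t :: 3 \<Rightarrow>\<^sub>0 nat. (Poly_Mapping.lookup t 0, Poly_Mapping.lookup t 1)) ((\<lambda>(a, b). mono3 a b (n - a - b)) x) = x"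
    by (auto simp: lookup_mono3)
  show "\<forall>t\<in>{t :: 3 \<Rightarrow>\<^sub>0 nat. mdeg t = n}. (\<lambda>(a, b). mono3 a b (n - a - b)) (Poly_Mapping.lookup t 0, Poly_Mapping.lookup t 1) = t"
  proof
    fix t :: "3 \<Rightarrow>\<^sub>0 nat" assume "t \<in> {t :: 3 \<Rightarrow>\<^sub>0 nat. mdeg t = n}"
    then have "n - Poly_Mapping.lookup t 0 - Poly_Mapping.lookup t 1 = Poly_Mapping.lookup t 2"
      by (auto simp: mdeg3)
    then show "(\<lambda>(a, b). mono3 a b (n - a - b)) (Poly_Mapping.lookup t 0, Poly_Mapping.lookup t 1) = t"
      by (simp add: mono3_lookup)
  qed
  show "(\<lambda>(a, b). mono3 a b (n - a - b)) ` pairs_upto n \<subseteq> {t :: 3 \<Rightarrow>\<^sub>0 nat. mdeg t = n}"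
    by (auto simp: pairs_upto_def mdeg_mono3)
  show "(\<lambda>t :: 3 \<Rightarrow>\<^sub>0 nat. (Poly_Mapping.lookup t 0, Poly_Mapping.lookup t 1)) ` {t :: 3 \<Rightarrow>\<^sub>0 nat. mdeg t = n} \<subseteq> pairs_upto n"
    by (auto simp: pairs_upto_def mdeg3)
qed

lemma mscale_single: "mscale c (Poly_Mapping.single t 1) = Poly_Mapping.single t c"
  by (simp add: mscale_def mconst_def mult_single)

lemma poly_comp_basis:
  fixes n :: nat
  defines "B \<equiv> (\<lambda>t. Poly_Mapping.single t (1 :: 'k::field)) ` {t :: 3 \<Rightarrow>\<^sub>0 nat. mdeg t = n}"
  shows "finite B" "MP.independent B" "B \<subseteq> poly_comp n" "poly_comp n \<subseteq> MP.span B" "card B = card (pairs_upto n)"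
proof -
  let ?s = "\<lambda>t :: 3 \<Rightarrow>\<^sub>0 nat. Poly_Mapping.single t (1 :: 'k)" and ?M = "{t :: 3 \<Rightarrow>\<^sub>0 nat. mdeg t = n}"
  have inj: "inj ?s"
  proof (rule injI)
    fix a b assume "?s a = ?s b"
    then have "Poly_Mapping.lookup (?s a) a = Poly_Mapping.lookup (?s b) a" by simp
    then show "a = b" by (simp add: lookup_single when_def split: if_splits)
  qed
  have finM: "finite ?M" and cardM: "card ?M = card (pairs_upto n)"
    using bij_betw_finite[OF monomials_of_degree[of n]] bij_betw_same_card[OF monomials_of_degree[of n]] finite_pairs_upto by auto
  show "finite B" unfolding B_def using finM by simp
  show "card B = card (pairs_upto n)" unfolding B_def using card_image[OF inj_on_subset[OF inj subset_UNIV]] cardM by simp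
  show "B \<subseteq> poly_comp n" unfolding B_def by (auto simp: poly_comp_def)
  show "MP.independent B"
  proof (rule MP.independent_if_scalars_zero)
    fix f x assume z: "(\<Sum>x\<in>B. mscale (f x) x) = 0" and "x \<in> B"
    then obtain t where t: "x = ?s t" "t \<in> ?M" by (auto simp: B_def)
    have "0 = Poly_Mapping.lookup (\<Sum>s\<in>?M. mscale (f (?s s)) (?s s)) t"
      using z unfolding B_def by (simp add: sum.reindex[OF inj_on_subset[OF inj subset_UNIV]])
    also have "\<dots> = (\<Sum>s\<in>?M. if s = t then f (?s t) else 0)"
      unfolding lookup_sum mscale_single by (intro sum.cong) (auto simp: lookup_single)
    also have "\<dots> = f x" using t finM by simp
    finally show "f x = 0" by simp
  qed (rule \<open>finite B\<close>)
  show "poly_comp n \<subseteq> MP.span B"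
  proof
    fix p :: "(3, 'k) mpoly" assume p: "p \<in> poly_comp n"
    have "(\<Sum>t\<in>Poly_Mapping.keys p. mscale (Poly_Mapping.lookup p t) (?s t)) \<in> MP.span B"
    proof (intro MP.span_sum MP.span_scale MP.span_base)
      fix t assume "t \<in> Poly_Mapping.keys p"
      then show "?s t \<in> B" using p unfolding B_def poly_comp_def by blast
    qed
    then show "p \<in> MP.span B" by (simp add: mscale_single sum_monomials)
  qed
qed

lemma fin_dim_poly_comp [simp]: "MP.fin_dim (poly_comp n :: (3, 'k::field) mpoly set)"
  unfolding MP.fin_dim_def using poly_comp_basis(1,4) by blast

lemma dim_poly_comp: "MP.dim (poly_comp n :: (3, 'k::field) mpoly set) = card (pairs_upto n)"
  by (rule MP.dim_unique[OF poly_comp_basis(3,4,2,5)])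

lemma dim_poly_comp_Suc:
  "MP.dim (poly_comp (Suc n) :: (3, 'k::field) mpoly set) = MP.dim (poly_comp n :: (3, 'k) mpoly set) + (n + 2)"
  by (simp add: dim_poly_comp card_pairs_upto)

lemma dim_poly_comp_0: "MP.dim (poly_comp 0 :: (3, 'k::field) mpoly set) = 1"
proof -
  have "pairs_upto 0 = {(0, 0)}" by (auto simp: pairs_upto_def)
  then show ?thesis by (simp add: dim_poly_comp)
qed

lemma dim_poly_comp_small:
  "MP.dim (poly_comp 1 :: (3, 'k::field) mpoly set) = 3" "MP.dim (poly_comp 2 :: (3, 'k) mpoly set) = 6"
  "MP.dim (poly_comp 3 :: (3, 'k) mpoly set) = 10" "MP.dim (poly_comp 4 :: (3, 'k) mpoly set) = 15"
  using dim_poly_comp_0[where 'k = 'k] dim_poly_comp_Suc[of 0, where 'k = 'k] dim_poly_comp_Suc[of 1, where 'k = 'k]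
    dim_poly_comp_Suc[of 2, where 'k = 'k] dim_poly_comp_Suc[of 3, where 'k = 'k]
  by (simp_all add: numeral_eq_Suc)

lemma general_position_pair: "general_position S \<Longrightarrow> a \<in> S \<Longrightarrow> b \<in> S \<Longrightarrow> a \<noteq> b \<Longrightarrow> cross a b \<noteq> (\<lambda>_. 0)"
  unfolding general_position_def by blast

lemma general_position_triple:
  "general_position S \<Longrightarrow> a \<in> S \<Longrightarrow> b \<in> S \<Longrightarrow> c \<in> S \<Longrightarrow> a \<noteq> b \<Longrightarrow> b \<noteq> c \<Longrightarrow> a \<noteq> c \<Longrightarrow> det3 a b c \<noteq> 0"
  unfolding general_position_def by blast

text \<open>
  Points in general position impose independent conditions on forms of degree \<open>n\<close> as long as there
  are at most \<open>2n + 1\<close> of them.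
\<close>

lemma general_position_conditions:
  fixes S :: "(3 \<Rightarrow> 'k::field) set"
  assumes "finite S" "general_position S" "(\<lambda>_. 0) \<notin> S" "card S \<le> 2 * n + 1"
  shows "MP.dim {p \<in> poly_comp n. \<forall>y\<in>S. ev y p = 0} + card S \<le> MP.dim (poly_comp n :: (3, 'k) mpoly set)"
proof -
  let ?W = "\<lambda>T. {p \<in> poly_comp n. \<forall>y\<in>T. ev y p = 0}"
  have "MP.dim (?W T) + card T \<le> MP.dim (poly_comp n :: (3, 'k) mpoly set)" if "T \<subseteq> S" for T
    using finite_subset[OF that assms(1)] that
  proof (induction T)
    case (insert y T)
    have y: "y \<in> S" "T \<subseteq> S" "y \<notin> T" using insert.prems insert.hyps by auto
    have "\<exists>p\<in>poly_comp n. ev y p \<noteq> 0 \<and> (\<forall>a\<in>T. ev a p = 0)"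
    proof (rule separating_form)
      show "card T \<le> 2 * n" using insert assms(1,4) card_mono[OF assms(1) insert.prems] by simp
      show "y \<noteq> (\<lambda>_. 0)" using y assms(3) by metis
      show "cross y a \<noteq> (\<lambda>_. 0)" if "a \<in> T" for a using general_position_pair[OF assms(2), of y a] y that by blast
      show "det3 y a b \<noteq> 0" if "a \<in> T" "b \<in> T" "a \<noteq> b" for a b
        using general_position_triple[OF assms(2), of y a b] y that by blast
      show "finite T" by fact
    qed
    then obtain p where p: "p \<in> ?W T" "ev y p \<noteq> 0" by blast
    have sub: "MP.subspace (?W (insert y T))" by (auto simp: MP.subspace_def mscale_def)
    have "MP.dim (?W (insert y T)) < MP.dim (?W T)"
    proof (rule ccontr)
      assume "\<not> ?thesis"
      then have "?W (insert y T) = ?W T"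
        by (intro MP.subspace_eq_if_dim_le[OF _ _ sub] MP.fin_dim_subset[OF fin_dim_poly_comp]) auto
      with p show False by blast
    qed
    with insert show ?case by simp
  qed simp
  then show ?thesis by blast
qed

section \<open>Subspaces of polynomials in one variable\<close>

lemma polys_basis:
  fixes n :: nat
  defines "B \<equiv> (\<lambda>k. monom (1 :: 'k::field) k) ` {..n}"
  shows "finite B" "PS.independent B" "B \<subseteq> {p. degree p \<le> n}" "{p. degree p \<le> n} \<subseteq> PS.span B" "card B = Suc n"
proof -
  have inj: "inj_on (\<lambda>k. monom (1 :: 'k) k) {..n}" by (auto simp: inj_on_def monom_eq_iff')
  show "finite B" "card B = Suc n" unfolding B_def by (simp_all add: card_image[OF inj])
  show "B \<subseteq> {p. degree p \<le> n}" unfolding B_def by (auto intro: order_trans[OF degree_monom_le])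
  show "PS.independent B"
  proof (rule PS.independent_if_scalars_zero)
    fix f x assume z: "(\<Sum>x\<in>B. smult (f x) x) = 0" and "x \<in> B"
    then obtain k where k: "x = monom 1 k" "k \<le> n" by (auto simp: B_def)
    have "0 = coeff (\<Sum>j\<le>n. smult (f (monom 1 j)) (monom 1 j)) k"
      using z unfolding B_def by (simp add: sum.reindex[OF inj])
    also have "\<dots> = (\<Sum>j\<le>n. if j = k then f x else 0)"
      unfolding coeff_sum by (intro sum.cong) (auto simp: k)
    also have "\<dots> = f x" using k by simp
    finally show "f x = 0" by simp
  qed (rule \<open>finite B\<close>)
  show "{p. degree p \<le> n} \<subseteq> PS.span B"
  proof
    fix p :: "'k poly" assume "p \<in> {p. degree p \<le> n}"
    then have "p = (\<Sum>k\<le>n. smult (coeff p k) (monom 1 k))"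
      by (simp add: smult_monom poly_as_sum_of_monoms')
    moreover have "(\<Sum>k\<le>n. smult (coeff p k) (monom 1 k)) \<in> PS.span B"
      by (intro PS.span_sum PS.span_scale PS.span_base) (auto simp: B_def)
    ultimately show "p \<in> PS.span B" by simp
  qed
qed

lemma fin_dim_polys: "PS.fin_dim {p :: 'k::field poly. degree p \<le> n}"
  unfolding PS.fin_dim_def using polys_basis(1,4) by blast

lemma dim_polys: "PS.dim {p :: 'k::field poly. degree p \<le> n} = Suc n"
  by (rule PS.dim_unique[OF polys_basis(3,4,2,5)])

lemma dim_polys_multiple:
  fixes q :: "'k::field poly"
  assumes "q \<noteq> 0"
  shows "PS.dim ((*) q ` {p. degree p \<le> n}) = Suc n"
proof -
  have "PS.subspace {p :: 'k poly. degree p \<le> n}"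
    by (auto simp: PS.subspace_def degree_add_le intro: order_trans[OF degree_smult_le])
  then have "PS.dim ((*) q ` {p. degree p \<le> n}) = PS.dim {p :: 'k poly. degree p \<le> n}"
    using assms by (intro PS.dim_image_inj fin_dim_polys) (auto simp: algebra_simps)
  then show ?thesis by (simp add: dim_polys)
qed

text \<open>
  A finite-dimensional space of polynomials that is not zero cannot be closed under multiplication
  by the variable. So passing from \<open>T\<close> to a space that contains \<open>T\<close> and its multiple adds at least
  one dimension.
\<close>

lemma dim_growth_step:
  fixes T :: "'k::field poly set"
  assumes T: "T \<subseteq> {p. degree p \<le> n}" "PS.subspace T" "T \<noteq> {0}" and U: "U \<subseteq> {p. degree p \<le> Suc n}" "PS.subspace U"
    and sub: "T \<subseteq> U" "\<And>p. p \<in> T \<Longrightarrow> pCons 0 p \<in> U"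
  shows "PS.dim T < PS.dim U"
proof (rule ccontr)
  assume "\<not> ?thesis"
  moreover have fU: "PS.fin_dim U" using PS.fin_dim_subset[OF fin_dim_polys U(1)] .
  ultimately have TU: "T = U" by (intro PS.subspace_eq_if_dim_le[OF _ sub(1) T(2)]) auto
  obtain p where p: "p \<in> T" "p \<noteq> 0" using T(3) PS.subspace_0[OF T(2)] by blast
  have "(pCons 0 ^^ k) p \<in> T" for k
    by (induction k) (use p sub(2) TU in auto)
  moreover have "degree ((pCons 0 ^^ k) p) = degree p + k \<and> (pCons 0 ^^ k) p \<noteq> 0" for k
    by (induction k) (use p in auto)
  ultimately have "degree p + Suc n \<le> n" using T(1) by (metis (mono_tags) mem_Collect_eq subsetD)
  then show False by simp
qed

lemma dim_growth:
  fixes T :: "nat \<Rightarrow> 'k::field poly set"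
  assumes T: "\<And>i. T i \<subseteq> {p. degree p \<le> i}" "\<And>i. PS.subspace (T i)"
    and sub: "\<And>i p. p \<in> T i \<Longrightarrow> p \<in> T (Suc i) \<and> pCons 0 p \<in> T (Suc i)"
    and "T j \<noteq> {0}"
  shows "PS.dim (T j) + k \<le> PS.dim (T (j + k))" "T (j + k) \<noteq> {0}"
proof (induction k)
  case (Suc k)
  { case 1
    have "PS.dim (T (j + k)) < PS.dim (T (Suc (j + k)))"
      using Suc(2) sub by (intro dim_growth_step[of _ "j + k"] T) auto
    with Suc(1) show ?case by simp }
  { case 2
    obtain p where "p \<in> T (j + k)" "p \<noteq> 0" using Suc(2) PS.subspace_0[OF T(2)] by blast
    with sub show ?case by auto }
qed (use assms(4) in auto)

section \<open>Linear functionals on forms\<close>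

definition linfun :: "((3, 'k::field) mpoly \<Rightarrow> 'k) \<Rightarrow> bool" where
  "linfun \<psi> \<longleftrightarrow> (\<forall>p q. \<psi> (p + q) = \<psi> p + \<psi> q) \<and> (\<forall>c p. \<psi> (mconst c * p) = c * \<psi> p)"

lemma linfunD:
  assumes "linfun \<psi>"
  shows "\<psi> (p + q) = \<psi> p + \<psi> q" "\<psi> (mconst c * p) = c * \<psi> p" "\<psi> 0 = 0" "\<psi> (- p) = - \<psi> p" "\<psi> (p - q) = \<psi> p - \<psi> q"
proof -
  show 1: "\<psi> (p + q) = \<psi> p + \<psi> q" "\<psi> (mconst c * p) = c * \<psi> p" for p q c using assms by (simp_all add: linfun_def)
  show 2: "\<psi> 0 = 0" using 1(2)[of 0 0] by simp
  show 3: "\<psi> (- p) = - \<psi> p" for p using 1(1)[of p "- p"] 2 by (simp add: add_eq_0_iff)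
  show "\<psi> (p - q) = \<psi> p - \<psi> q" using 1(1)[of p "- q"] 3 by simp
qed

lemma linfun_sum: "linfun \<psi> \<Longrightarrow> \<psi> (sum f A) = (\<Sum>x\<in>A. \<psi> (f x))"
  by (induction A rule: infinite_finite_induct) (auto simp: linfunD)

lemma linfun_mult: "linfun \<psi> \<Longrightarrow> linfun (\<lambda>p. \<psi> (p * r))"
  by (simp add: linfun_def distrib_right mult.assoc)

lemma poly_map_poly_linfun:
  assumes "linfun \<psi>"
  shows "poly (map_poly \<psi> Q) t = \<psi> (poly Q (mconst t))"
proof (induction Q)
  case (pCons a Q)
  then show ?case by (simp add: map_poly_pCons linfunD[OF assms])
qed (simp add: linfunD[OF assms])

lemma coeff_linear_power_1:
  fixes u v :: "'a::idom"
  shows "coeff ([:u, v:] ^ n) 1 = of_nat n * u ^ (n - 1) * v"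
proof -
  have "coeff ([:u, v:] ^ n) 1 = poly (pderiv ([:u, v:] ^ n)) 0"
    by (simp add: poly_0_coeff_0 coeff_pderiv)
  then show ?thesis by (simp add: pderiv_power pderiv_pCons)
qed

text \<open>
  By polarization: comparing the coefficients of \<open>t\<close> in \<open>\<psi> ((u + t x)\<^sup>n\<^sup>-\<^sup>j p) = 0\<close> exchanges one factor
  \<open>u\<close> for an arbitrary variable \<open>x\<close>, at the price of the factor \<open>n - j\<close>, which is invertible in
  characteristic zero.
\<close>

lemma powers_span:
  fixes \<psi> :: "(3, 'k::field_char_0) mpoly \<Rightarrow> 'k"
  assumes \<psi>: "linfun \<psi>" and z: "\<And>u. u \<in> poly_comp 1 \<Longrightarrow> \<psi> (u ^ n) = 0" and p: "p \<in> poly_comp n"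
  shows "\<psi> p = 0"
proof -
  have "j \<le> n \<longrightarrow> (\<forall>u\<in>poly_comp 1. \<psi> (u ^ (n - j) * p) = 0)" if "p \<in> poly_comp j" for j p
    using that
  proof (induction rule: form_induct)
    case (const c)
    then show ?case using z linfunD(2)[OF \<psi>] by (simp add: mult.commute[of _ "mconst c"])
  next
    case (add j p q)
    then show ?case by (simp add: distrib_left linfunD(1)[OF \<psi>])
  next
    case (mult j p v)
    show ?case
    proof (intro impI ballI)
      fix u :: "(3, 'k) mpoly" assume j: "Suc j \<le> n" and u: "u \<in> poly_comp 1"
      have "poly (map_poly \<psi> (smult p ([:u, mvar v:] ^ (n - j)))) t = 0" for t
      proof -
        have "u + mconst t * mvar v \<in> poly_comp 1" using u by (intro poly_comp_add poly_comp_scale) auto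
        then show ?thesis using mult j
          by (simp add: poly_map_poly_linfun[OF \<psi>] poly_power mult.commute)
      qed
      then have "map_poly \<psi> (smult p ([:u, mvar v:] ^ (n - j))) = 0"
        using poly_all_0_iff_0 by blast
      then have "0 = coeff (map_poly \<psi> (smult p ([:u, mvar v:] ^ (n - j)))) 1" by simp
      also have "\<dots> = \<psi> (p * (of_nat (n - j) * u ^ (n - j - 1) * mvar v))"
        by (simp only: coeff_map_poly linfunD(3)[OF \<psi>] coeff_smult coeff_linear_power_1)
      also have "\<dots> = \<psi> (mconst (of_nat (n - j)) * (u ^ (n - Suc j) * (mvar v * p)))"
        by (simp add: mconst_of_nat mult_ac)
      also have "\<dots> = of_nat (n - j) * \<psi> (u ^ (n - Suc j) * (mvar v * p))" by (rule linfunD(2)[OF \<psi>])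
      finally show "\<psi> (u ^ (n - Suc j) * (mvar v * p)) = 0" using j by simp
    qed
  qed
  from this[OF p] show ?thesis using lin_in_poly_comp by auto
qed

abbreviation generic_linear :: "(3, 'k::field) mpoly set \<Rightarrow> bool" where
  "generic_linear \<equiv> MP.generic (poly_comp 1)"

lemma generic_linear_power:
  fixes \<psi> :: "(3, 'k::field_char_0) mpoly \<Rightarrow> 'k"
  assumes \<psi>: "linfun \<psi>" and p: "p \<in> poly_comp n" "\<psi> p \<noteq> 0"
  shows "generic_linear {u. \<psi> (u ^ n) \<noteq> 0}"
proof -
  obtain u where "u \<in> poly_comp 1" "\<psi> (u ^ n) \<noteq> 0" using powers_span[OF \<psi> _ p(1)] p(2) by blast
  moreover have "\<exists>P. \<forall>t. \<psi> ((u + mscale t v) ^ n) = poly P t" for u v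
    by (rule exI[of _ "map_poly \<psi> ([:u, v:] ^ n)"])
       (simp add: poly_map_poly_linfun[OF \<psi>] poly_power mscale_def mult.commute)
  ultimately show ?thesis by (intro MP.generic_nonvanishing)
qed

lemma generic_linear_avoid_points:
  fixes S :: "(3 \<Rightarrow> 'k::field_char_0) set"
  assumes "projectively_finite S"
  shows "\<exists>G. generic_linear G \<and> (\<forall>u. lin u \<in> G \<longrightarrow> (\<forall>y\<in>S. y \<noteq> (\<lambda>_. 0) \<longrightarrow> dot u y \<noteq> 0))"
proof -
  obtain F where F: "finite F" "(\<lambda>_. 0) \<notin> F" "\<forall>y\<in>S. \<exists>z\<in>F. \<exists>c. y = (\<lambda>i. c * z i)"
    using assms unfolding projectively_finite_def by blast
  have one: "generic_linear {p. ev z p \<noteq> 0}" if "z \<in> F" for z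
  proof -
    have "z \<noteq> (\<lambda>_. 0)" using that F(2) by metis
    then obtain w where "dot w z = 1" using dot_witness[of z] by blast
    then have "lin w \<in> poly_comp 1" "ev z (lin w) \<noteq> 0" by auto
    moreover have "\<exists>P. \<forall>t. ev z (u + mscale t v) = poly P t" for u v
      by (rule exI[of _ "[:ev z u, ev z v:]"]) (simp add: mscale_def)
    ultimately show ?thesis by (intro MP.generic_nonvanishing)
  qed
  have "generic_linear (\<Inter>z\<in>F. {p. ev z p \<noteq> 0})"
    by (rule MP.generic_INT[OF infinite_UNIV_char_0 subspace_poly_comp _ F(1) one]) (use poly_comp_0 in blast)
  moreover have "dot u y \<noteq> 0" if u: "lin u \<in> (\<Inter>z\<in>F. {p. ev z p \<noteq> 0})" "y \<in> S" "y \<noteq> (\<lambda>_. 0)" for u y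
  proof -
    obtain z c where z: "z \<in> F" "y = (\<lambda>i. c * z i)" using F(3) u(2) by blast
    then have "c \<noteq> 0" using u(3) by auto
    moreover have "dot u y = c * dot u z" by (simp add: z(2) dot3 algebra_simps)
    ultimately show ?thesis using u(1) z(1) by simp
  qed
  ultimately show ?thesis by blast
qed

lemma generic_linear_Int:
  fixes G H :: "(3, 'k::field_char_0) mpoly set"
  shows "generic_linear G \<Longrightarrow> generic_linear H \<Longrightarrow> generic_linear (G \<inter> H)"
  by (rule MP.generic_Int[OF infinite_UNIV_char_0 subspace_poly_comp])

lemma generic_linear_INT:
  fixes G :: "'j \<Rightarrow> (3, 'k::field_char_0) mpoly set"
  shows "finite J \<Longrightarrow> (\<And>j. j \<in> J \<Longrightarrow> generic_linear (G j)) \<Longrightarrow> generic_linear (\<Inter>j\<in>J. G j)"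
  by (rule MP.generic_INT[OF infinite_UNIV_char_0 subspace_poly_comp]) (use poly_comp_0 in blast)+

lemma generic_linear_witness:
  assumes "generic_linear G"
  obtains u where "lin u \<in> G"
  using assms poly_comp_1_lin unfolding MP.generic_def by blast

section \<open>The Gorenstein ideal of a functional\<close>

text \<open>
  Multipliers \<open>A u\<close> that depend polynomially on the linear form \<open>u\<close> along every line, together with
  their derivative \<open>dA u v\<close> at \<open>u\<close> in the direction \<open>v\<close>.
\<close>

definition polymap :: "((3, 'k::field) mpoly \<Rightarrow> (3, 'k) mpoly) \<Rightarrow> ((3, 'k) mpoly \<Rightarrow> (3, 'k) mpoly \<Rightarrow> (3, 'k) mpoly) \<Rightarrow> bool" where
  "polymap A dA \<longleftrightarrow> (\<exists>P. \<forall>u v. (\<forall>t. A (u + mscale t v) = poly (P u v) (mconst t)) \<and> coeff (P u v) 1 = dA u v)"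

lemma polymap_const: "polymap (\<lambda>_. c) (\<lambda>_ _. 0)"
  unfolding polymap_def by (rule exI[of _ "\<lambda>_ _. [:c:]"]) simp

lemma polymap_mult_power: "polymap (\<lambda>u. c * u ^ n) (\<lambda>u v. c * (of_nat n * u ^ (n - 1) * v))"
  unfolding polymap_def
  by (rule exI[of _ "\<lambda>u v. smult c ([:u, v:] ^ n)"])
     (simp only: coeff_smult coeff_linear_power_1 poly_smult poly_power poly_pCons poly_0 mscale_def mult_zero_right add_0_right simp_thms)

lemma polymap_power: "polymap (\<lambda>u. u ^ n) (\<lambda>u v. of_nat n * u ^ (n - 1) * v)"
  using polymap_mult_power[of 1 n] by simp

lemma polymap_id: "polymap (\<lambda>u. u) (\<lambda>u v. v)"
  using polymap_power[of 1] by simp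

interpretation PP: fd_space "\<lambda>c (x, y). (mscale c x, mscale c y) :: (3, 'k::field) mpoly \<times> (3, 'k) mpoly"
  by unfold_locales (auto simp: mscale_def algebra_simps mconst_add mconst_mult)

lemma PP_subspace: "PP.subspace (poly_comp i \<times> poly_comp j :: ((3, 'k::field) mpoly \<times> (3, 'k) mpoly) set)"
  unfolding PP.subspace_def by (auto simp: mscale_def zero_prod_def)

lemma PP_fin_dim: "PP.fin_dim (poly_comp i \<times> poly_comp j :: ((3, 'k::field) mpoly \<times> (3, 'k) mpoly) set)"
proof -
  obtain B C :: "(3, 'k) mpoly set" where B: "finite B" "poly_comp i \<subseteq> MP.span B" and C: "finite C" "poly_comp j \<subseteq> MP.span C"
    using poly_comp_basis(1,4) by metis
  let ?E = "(\<lambda>x. (x, 0)) ` B \<union> (\<lambda>y. (0, y)) ` C"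
  have 1: "(x, 0) \<in> PP.span ?E" if "x \<in> MP.span B" for x
    using that
  proof (induction rule: MP.span_induct_alt)
    case base
    then show ?case using PP.span_zero[of ?E] by (simp add: zero_prod_def)
  next
    case (step c x y)
    have "(mscale c x, 0) \<in> PP.span ?E"
      using PP.span_scale[OF PP.span_base[of "(x, 0)" ?E], of c] step by (auto simp: mscale_def)
    from PP.span_add[OF this step(2)] show ?case by simp
  qed
  have 2: "(0, x) \<in> PP.span ?E" if "x \<in> MP.span C" for x
    using that
  proof (induction rule: MP.span_induct_alt)
    case base
    then show ?case using PP.span_zero[of ?E] by (simp add: zero_prod_def)
  next
    case (step c x y)
    have "(0, mscale c x) \<in> PP.span ?E"
      using PP.span_scale[OF PP.span_base[of "(0, x)" ?E], of c] step by (auto simp: mscale_def)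
    from PP.span_add[OF this step(2)] show ?case by simp
  qed
  have "poly_comp i \<times> poly_comp j \<subseteq> PP.span ?E"
  proof
    fix z :: "(3, 'k) mpoly \<times> (3, 'k) mpoly" assume "z \<in> poly_comp i \<times> poly_comp j"
    then obtain x y where "z = (x, 0) + (0, y)" "x \<in> poly_comp i" "y \<in> poly_comp j" by auto
    then show "z \<in> PP.span ?E" using PP.span_add[OF 1 2] B C by blast
  qed
  moreover have "finite ?E" using B C by simp
  ultimately show ?thesis unfolding PP.fin_dim_def by blast
qed

lemma lin_basis:
  assumes "det3 a b c \<noteq> 0"
  shows "\<exists>\<alpha> \<beta> \<gamma>. lin v = mconst \<alpha> * lin a + mconst \<beta> * lin b + mconst \<gamma> * lin c"
proof -
  let ?d = "det3 a b c"
  have "v = (\<lambda>i. ((det3 v b c / ?d) * a i + (det3 a v c / ?d) * b i) + (det3 a b v / ?d) * c i)"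
  proof
    fix i
    show "v i = ((det3 v b c / ?d) * a i + (det3 a v c / ?d) * b i) + (det3 a b v / ?d) * c i"
      using cramer[of a b c v i] assms by (simp add: field_simps)
  qed
  then have "lin v = lin (\<lambda>i. ((det3 v b c / ?d) * a i + (det3 a v c / ?d) * b i) + (det3 a b v / ?d) * c i)" by simp
  then show ?thesis unfolding lin_add lin_scale by blast
qed

text \<open>
  Macaulay duality: a Gorenstein quotient of socle degree \<open>d\<close> is determined by a linear functional
  on the forms of degree \<open>d\<close>. Its ideal consists of the polynomials all of whose multiples are
  mapped to zero.
\<close>

locale gorenstein_functional =
  fixes \<phi> :: "(3, 'k::field_char_0) mpoly \<Rightarrow> 'k" and d :: nat
  assumes linfun: "linfun \<phi>" and other_degree: "p \<in> poly_comp n \<Longrightarrow> n \<noteq> d \<Longrightarrow> \<phi> p = 0"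
begin

definition ann :: "(3, 'k) mpoly set" where
  "ann = {p. \<forall>r. \<phi> (p * r) = 0}"

lemmas phi = linfunD[OF linfun]

lemma ann_0 [simp]: "0 \<in> ann" by (simp add: ann_def phi)

lemma ann_add: "p \<in> ann \<Longrightarrow> q \<in> ann \<Longrightarrow> p + q \<in> ann"
  by (simp add: ann_def phi distrib_right)

lemma ann_uminus: "p \<in> ann \<Longrightarrow> - p \<in> ann"
  by (simp add: ann_def phi)

lemma ann_diff: "p \<in> ann \<Longrightarrow> q \<in> ann \<Longrightarrow> p - q \<in> ann"
  using ann_add[of p "- q"] ann_uminus by simp

lemma ann_mult: "p \<in> ann \<Longrightarrow> p * r \<in> ann"
  by (simp add: ann_def mult.assoc)

lemma ann_mult': "p \<in> ann \<Longrightarrow> r * p \<in> ann"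
  using ann_mult by (simp add: mult.commute)

lemma ann_cancel: "mconst c * p \<in> ann \<Longrightarrow> c \<noteq> 0 \<Longrightarrow> p \<in> ann"
  using ann_mult'[of "mconst c * p" "mconst (1 / c)"] by (simp flip: mult.assoc mconst_mult)

lemma phi_ann: "p \<in> ann \<Longrightarrow> \<phi> p = 0"
  unfolding ann_def by (metis (mono_tags) mem_Collect_eq mult_1_right)

lemma in_annI:
  assumes "p \<in> poly_comp n" "\<And>r k. r \<in> poly_comp k \<Longrightarrow> n + k = d \<Longrightarrow> \<phi> (p * r) = 0"
  shows "p \<in> ann"
  unfolding ann_def
proof (intro CollectI allI)
  fix r :: "(3, 'k) mpoly"
  obtain N where N: "r = (\<Sum>k<N. hcomp k r)" using hcomp_decompose by blast
  have "\<phi> (p * hcomp k r) = 0" for k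
    using assms(2)[OF hcomp_in_poly_comp, of k] other_degree[OF poly_comp_mult[OF assms(1) hcomp_in_poly_comp], of k] by blast
  then have "\<phi> (p * (\<Sum>k<N. hcomp k r)) = 0" by (simp add: sum_distrib_left linfun_sum[OF linfun])
  with N show "\<phi> (p * r) = 0" by simp
qed

lemma ann_lin:
  assumes "det3 a b c \<noteq> 0" "lin a * p \<in> ann" "lin b * p \<in> ann" "lin c * p \<in> ann"
  shows "lin v * p \<in> ann"
proof -
  obtain \<alpha> \<beta> \<gamma> where "lin v = mconst \<alpha> * lin a + mconst \<beta> * lin b + mconst \<gamma> * lin c"
    using lin_basis[OF assms(1)] by blast
  then have "lin v * p = mconst \<alpha> * (lin a * p) + mconst \<beta> * (lin b * p) + mconst \<gamma> * (lin c * p)"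
    by (simp add: algebra_simps)
  then show ?thesis using assms by (auto intro!: ann_add ann_mult')
qed

text \<open>The quotient by \<open>ann\<close> has no socle below degree \<open>d\<close>.\<close>

lemma ann_if_all_lin:
  assumes p: "p \<in> poly_comp n" "n < d" and lin: "\<And>v. lin v * p \<in> ann"
  shows "p \<in> ann"
proof (rule in_annI[OF p(1)])
  fix r :: "(3, 'k) mpoly" and k assume r: "r \<in> poly_comp k" "n + k = d"
  have "k = 0 \<or> \<phi> (p * r) = 0" using r(1)
  proof (induction rule: form_induct)
    case (add k r s)
    then show ?case by (auto simp: distrib_left phi)
  next
    case (mult k r v)
    have "(mvar v * p) * r \<in> ann" using lin ann_mult by (simp add: mvar_eq_lin)
    then show ?case using phi_ann by (simp add: mult_ac)
  qed simp
  with r p(2) show "\<phi> (p * r) = 0" by auto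
qed

lemma ann_if_basis:
  assumes "p \<in> poly_comp n" "n < d" "det3 a b c \<noteq> 0" "lin a * p \<in> ann" "lin b * p \<in> ann" "lin c * p \<in> ann"
  shows "p \<in> ann"
  using ann_if_all_lin[OF assms(1,2)] ann_lin[OF assms(3-6)] by blast

text \<open>
  Pairing with \<open>\<phi>\<close> turns relations modulo \<open>ann\<close> into linear equations, so their solutions at generic
  \<open>u\<close> lift to first order. Two simultaneous relations are admitted in order to differentiate a relation
  together with one of its derivatives.
\<close>

theorem generic_syzygies_lift:
  assumes pm: "polymap A dA" "polymap B dB" "polymap C dC" "polymap D dD"
  shows "\<exists>G. generic_linear G \<and> (\<forall>u\<in>poly_comp 1. \<forall>v\<in>poly_comp 1. \<forall>x\<in>poly_comp \<alpha>. \<forall>y\<in>poly_comp \<beta>. u \<in> G \<longrightarrow>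
     A u * x + B u * y \<in> ann \<longrightarrow> C u * x + D u * y \<in> ann \<longrightarrow>
     (\<exists>x'\<in>poly_comp \<alpha>. \<exists>y'\<in>poly_comp \<beta>. dA u v * x + dB u v * y + A u * x' + B u * y' \<in> ann \<and>
        dC u v * x + dD u v * y + C u * x' + D u * y' \<in> ann))"
proof -
  obtain PA where PA: "\<And>u v t. A (u + mscale t v) = poly (PA u v) (mconst t)" "\<And>u v. coeff (PA u v) 1 = dA u v"
    using pm(1) unfolding polymap_def by blast
  obtain PB where PB: "\<And>u v t. B (u + mscale t v) = poly (PB u v) (mconst t)" "\<And>u v. coeff (PB u v) 1 = dB u v"
    using pm(2) unfolding polymap_def by blast
  obtain PC where PC: "\<And>u v t. C (u + mscale t v) = poly (PC u v) (mconst t)" "\<And>u v. coeff (PC u v) 1 = dC u v"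
    using pm(3) unfolding polymap_def by blast
  obtain PD where PD: "\<And>u v t. D (u + mscale t v) = poly (PD u v) (mconst t)" "\<And>u v. coeff (PD u v) 1 = dD u v"
    using pm(4) unfolding polymap_def by blast
  define \<Phi> where "\<Phi> u x r = \<phi> ((A u * fst x + B u * snd x) * fst r + (C u * fst x + D u * snd x) * snd r)" for u x r
  define Q where "Q u v x r = smult (fst x * fst r) (PA u v) + smult (snd x * fst r) (PB u v)
      + smult (fst x * snd r) (PC u v) + smult (snd x * snd r) (PD u v)" for u v x r
  define pol where "pol u v x r = map_poly \<phi> (Q u v x r)" for u v x r
  have coeff_pol: "coeff (pol u v x r) i = \<phi> (coeff (Q u v x r) i)" for u v x r i
    by (simp add: pol_def coeff_map_poly phi)
  have "\<exists>G. generic_linear G \<and> (\<forall>u\<in>poly_comp 1. \<forall>v\<in>poly_comp 1. \<forall>x\<in>poly_comp \<alpha> \<times> poly_comp \<beta>. u \<in> G \<longrightarrow>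
      (\<forall>r. \<Phi> u x r = 0) \<longrightarrow> (\<exists>y\<in>poly_comp \<alpha> \<times> poly_comp \<beta>. \<forall>r. coeff (pol u v x r) 1 + \<Phi> u y r = 0))"
  proof (rule generic_kernel_lifts[OF MP.fd_space_axioms PP.fd_space_axioms infinite_UNIV_char_0
        subspace_poly_comp PP_subspace PP_fin_dim])
    show "poly (pol u v x r) t = \<Phi> (u + mscale t v) x r" for u v x r t
      unfolding pol_def Q_def \<Phi>_def poly_map_poly_linfun[OF linfun] PA(1) PB(1) PC(1) PD(1)
      by (intro arg_cong[of _ _ \<phi>]) (simp add: algebra_simps)
    show "pol u v (x + y) r = pol u v x r + pol u v y r" for u v x y r
      by (intro poly_eqI) (simp add: coeff_pol Q_def phi algebra_simps)
    show "pol u v (case x of (x, y) \<Rightarrow> (mscale c x, mscale c y)) r = smult c (pol u v x r)" for u v c x r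
    proof (intro poly_eqI)
      fix i
      have "coeff (Q u v (case x of (x, y) \<Rightarrow> (mscale c x, mscale c y)) r) i = mconst c * coeff (Q u v x r) i"
        by (cases x) (simp add: Q_def mscale_def algebra_simps)
      then show "coeff (pol u v (case x of (x, y) \<Rightarrow> (mscale c x, mscale c y)) r) i = coeff (smult c (pol u v x r)) i"
        by (simp add: coeff_pol phi)
    qed
  qed
  then obtain G where G: "generic_linear G" and lift: "\<And>u v x. u \<in> poly_comp 1 \<Longrightarrow> v \<in> poly_comp 1 \<Longrightarrow>
      x \<in> poly_comp \<alpha> \<times> poly_comp \<beta> \<Longrightarrow> u \<in> G \<Longrightarrow> (\<And>r. \<Phi> u x r = 0) \<Longrightarrow>
      \<exists>y\<in>poly_comp \<alpha> \<times> poly_comp \<beta>. \<forall>r. coeff (pol u v x r) 1 + \<Phi> u y r = 0" by blast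
  show ?thesis
  proof (intro exI conjI ballI impI)
    show "generic_linear G" by fact
    fix u v x y :: "(3, 'k) mpoly"
    assume h: "u \<in> poly_comp 1" "v \<in> poly_comp 1" "x \<in> poly_comp \<alpha>" "y \<in> poly_comp \<beta>" "u \<in> G"
      "A u * x + B u * y \<in> ann" "C u * x + D u * y \<in> ann"
    have "\<Phi> u (x, y) r = 0" for r
      using phi_ann[OF ann_mult[OF h(6), of "fst r"]] phi_ann[OF ann_mult[OF h(7), of "snd r"]] by (simp add: \<Phi>_def phi)
    then obtain x' y' where xy: "x' \<in> poly_comp \<alpha>" "y' \<in> poly_comp \<beta>"
      and eq: "\<And>r. coeff (pol u v (x, y) r) 1 + \<Phi> u (x', y') r = 0"
      using lift[OF h(1,2), of "(x, y)"] h by blast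
    have cQ: "coeff (Q u v (x, y) r) 1 = (dA u v * x + dB u v * y) * fst r + (dC u v * x + dD u v * y) * snd r" for r
      unfolding Q_def coeff_add coeff_smult PA(2) PB(2) PC(2) PD(2) by (simp add: algebra_simps)
    have "\<phi> ((dA u v * x + dB u v * y + A u * x' + B u * y') * fst r + (dC u v * x + dD u v * y + C u * x' + D u * y') * snd r) = 0" for r
    proof -
      have "\<phi> ((dA u v * x + dB u v * y + A u * x' + B u * y') * fst r + (dC u v * x + dD u v * y + C u * x' + D u * y') * snd r) =
        coeff (pol u v (x, y) r) 1 + \<Phi> u (x', y') r"
        unfolding coeff_pol cQ \<Phi>_def phi(1)[symmetric] by (intro arg_cong[of _ _ \<phi>]) (simp add: algebra_simps)
      then show ?thesis using eq by simp
    qed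
    from this[of "(_, 0)"] this[of "(0, _)"]
    have "dA u v * x + dB u v * y + A u * x' + B u * y' \<in> ann" "dC u v * x + dD u v * y + C u * x' + D u * y' \<in> ann"
      by (simp_all add: ann_def)
    with xy show "\<exists>x'\<in>poly_comp \<alpha>. \<exists>y'\<in>poly_comp \<beta>. dA u v * x + dB u v * y + A u * x' + B u * y' \<in> ann \<and>
        dC u v * x + dD u v * y + C u * x' + D u * y' \<in> ann" by blast
  qed
qed

lemma lift_single:
  assumes "polymap A dA"
  shows "\<exists>G. generic_linear G \<and> (\<forall>u\<in>poly_comp 1. \<forall>v\<in>poly_comp 1. \<forall>x\<in>poly_comp n. u \<in> G \<longrightarrow> A u * x \<in> ann \<longrightarrow>
     (\<exists>x'\<in>poly_comp n. dA u v * x + A u * x' \<in> ann))"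
proof -
  obtain G where G: "generic_linear G" "\<forall>u\<in>poly_comp 1. \<forall>v\<in>poly_comp 1. \<forall>x\<in>poly_comp n. \<forall>y\<in>poly_comp 0. u \<in> G \<longrightarrow>
     A u * x + 0 * y \<in> ann \<longrightarrow> 0 * x + 0 * y \<in> ann \<longrightarrow>
     (\<exists>x'\<in>poly_comp n. \<exists>y'\<in>poly_comp 0. dA u v * x + 0 * y + A u * x' + 0 * y' \<in> ann \<and>
        0 * x + 0 * y + 0 * x' + 0 * y' \<in> ann)"
    using generic_syzygies_lift[OF assms polymap_const[of 0] polymap_const[of 0] polymap_const[of 0], of n 0] by blast
  show ?thesis
  proof (intro exI conjI ballI impI)
    fix u v x :: "(3, 'k) mpoly"
    assume "u \<in> poly_comp 1" "v \<in> poly_comp 1" "x \<in> poly_comp n" "u \<in> G" "A u * x \<in> ann"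
    with G(2)[rule_format, of u v x 0] show "\<exists>x'\<in>poly_comp n. dA u v * x + A u * x' \<in> ann" by auto
  qed (rule G(1))
qed
lemma lift_sum:
  assumes "polymap A dA" "polymap B dB"
  shows "\<exists>G. generic_linear G \<and> (\<forall>u\<in>poly_comp 1. \<forall>v\<in>poly_comp 1. \<forall>x\<in>poly_comp n. \<forall>y\<in>poly_comp k. u \<in> G \<longrightarrow>
     A u * x + B u * y \<in> ann \<longrightarrow> (\<exists>x'\<in>poly_comp n. \<exists>y'\<in>poly_comp k. dA u v * x + dB u v * y + A u * x' + B u * y' \<in> ann))"
proof -
  obtain G where G: "generic_linear G" "\<forall>u\<in>poly_comp 1. \<forall>v\<in>poly_comp 1. \<forall>x\<in>poly_comp n. \<forall>y\<in>poly_comp k. u \<in> G \<longrightarrow>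
     A u * x + B u * y \<in> ann \<longrightarrow> 0 * x + 0 * y \<in> ann \<longrightarrow>
     (\<exists>x'\<in>poly_comp n. \<exists>y'\<in>poly_comp k. dA u v * x + dB u v * y + A u * x' + B u * y' \<in> ann \<and>
        0 * x + 0 * y + 0 * x' + 0 * y' \<in> ann)"
    using generic_syzygies_lift[OF assms polymap_const[of 0] polymap_const[of 0], of n k] by blast
  show ?thesis
  proof (intro exI conjI ballI impI)
    fix u v x y :: "(3, 'k) mpoly"
    assume "u \<in> poly_comp 1" "v \<in> poly_comp 1" "x \<in> poly_comp n" "y \<in> poly_comp k" "u \<in> G" "A u * x + B u * y \<in> ann"
    with G(2)[rule_format, of u v x y]
    show "\<exists>x'\<in>poly_comp n. \<exists>y'\<in>poly_comp k. dA u v * x + dB u v * y + A u * x' + B u * y' \<in> ann" by auto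
  qed (rule G(1))
qed
text \<open>
  The relation \<open>u x = 0\<close> together with the lift \<open>v x + B(u) y = 0\<close> of its derivative in
  the direction \<open>v\<close>: differentiating both again gives derivatives of second order.
\<close>

lemma lift_derived:
  assumes "polymap B dB"
  shows "\<exists>G. generic_linear G \<and> (\<forall>u\<in>poly_comp 1. \<forall>w\<in>poly_comp 1. \<forall>x\<in>poly_comp n. \<forall>y\<in>poly_comp k. u \<in> G \<longrightarrow>
     u * x \<in> ann \<longrightarrow> v * x + B u * y \<in> ann \<longrightarrow>
     (\<exists>x'\<in>poly_comp n. \<exists>y'\<in>poly_comp k. w * x + u * x' \<in> ann \<and> dB u w * y + v * x' + B u * y' \<in> ann))"
proof -
  obtain G where G: "generic_linear G" "\<forall>u\<in>poly_comp 1. \<forall>w\<in>poly_comp 1. \<forall>x\<in>poly_comp n. \<forall>y\<in>poly_comp k. u \<in> G \<longrightarrow>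
     u * x + 0 * y \<in> ann \<longrightarrow> v * x + B u * y \<in> ann \<longrightarrow>
     (\<exists>x'\<in>poly_comp n. \<exists>y'\<in>poly_comp k. w * x + 0 * y + u * x' + 0 * y' \<in> ann \<and>
        0 * x + dB u w * y + v * x' + B u * y' \<in> ann)"
    using generic_syzygies_lift[OF polymap_id polymap_const[of 0] polymap_const[of v] assms, of n k] by blast
  show ?thesis
  proof (intro exI conjI ballI impI)
    fix u w x y :: "(3, 'k) mpoly"
    assume "u \<in> poly_comp 1" "w \<in> poly_comp 1" "x \<in> poly_comp n" "y \<in> poly_comp k" "u \<in> G" "u * x \<in> ann"
      "v * x + B u * y \<in> ann"
    with G(2)[rule_format, of u w x y]
    show "\<exists>x'\<in>poly_comp n. \<exists>y'\<in>poly_comp k. w * x + u * x' \<in> ann \<and> dB u w * y + v * x' + B u * y' \<in> ann" by auto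
  qed (rule G(1))
qed
end

section \<open>The base locus in the critical degree\<close>

text \<open>
  The situation to be refuted: multiplication by any linear form has a kernel in the critical
  degree \<open>m\<close>, although injectivity there would imply injectivity in all smaller degrees.
\<close>

locale lefschetz_failure = gorenstein_functional \<phi> "2 * m + 1"
  for \<phi> :: "(3, 'k::field_char_0) mpoly \<Rightarrow> 'k" and m :: nat +
  assumes m_ge_2: "m \<ge> 2"
    and dim_m: "MP.dim (poly_comp m :: (3, 'k) mpoly set) = MP.dim (ann \<inter> poly_comp m) + (2 * m + 2)"
    and dim_m1: "MP.dim (poly_comp (m + 1) :: (3, 'k) mpoly set) = MP.dim (ann \<inter> poly_comp (m + 1)) + (2 * m + 2)"
    and ann_2: "ann \<inter> poly_comp 2 = {0}"
    and no_lefschetz: "\<And>u. u \<in> poly_comp 1 \<Longrightarrow> \<exists>a\<in>poly_comp m. a \<notin> ann \<and> u * a \<in> ann"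
begin

lemma ann_1: "p \<in> ann \<Longrightarrow> p \<in> poly_comp 1 \<Longrightarrow> p = 0"
proof (rule ccontr)
  assume p: "p \<in> ann" "p \<in> poly_comp 1" "p \<noteq> 0"
  then have "p * p \<in> ann \<inter> poly_comp 2" using ann_mult poly_comp_mult[of p 1 p 1] by (auto simp: numeral_2_eq_2)
  with ann_2 p(3) show False by auto
qed

lemma subspace_colon: "MP.subspace {p \<in> poly_comp n. e * p \<in> ann}"
  by (auto simp: MP.subspace_def mscale_def distrib_left ann_add mult.left_commute[of e "mconst _"] intro: ann_mult')

lemma fin_dim_sub: "S \<subseteq> poly_comp n \<Longrightarrow> MP.fin_dim (S :: (3, 'k) mpoly set)"
  by (rule MP.fin_dim_subset[OF fin_dim_poly_comp])

text \<open>
  A class killed by two independent linear forms is dual to evaluation at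
  their common zero, so that all of \<open>ann\<close> in degree \<open>m + 1\<close> vanishes there.
\<close>

lemma vanishing_at_common_zero:
  assumes a: "a \<in> poly_comp m" "a \<notin> ann" and k: "lin u * a \<in> ann" "lin w * a \<in> ann" and uw: "cross u w \<noteq> (\<lambda>_. 0)"
    and p: "p \<in> ann" "p \<in> poly_comp (m + 1)"
  shows "ev (cross u w) p = 0"
proof -
  obtain c where c: "dot c (cross u w) = 1" using dot_witness[OF uw] by blast
  have "det3 u w c = dot c (cross u w)" by (simp add: det3_expand dot3 algebra_simps)
  then have det: "det3 u w c \<noteq> 0" using c by simp
  have rep: "\<exists>k. \<phi> (a * q) = k * \<phi> (a * lin c ^ (m + 1)) \<and> ev (cross u w) q = k" if q': "q \<in> poly_comp (m + 1)" for q
  proof -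
    obtain r s k where q: "q = lin u * r + lin w * s + mconst k * lin c ^ (m + 1)"
      using form_mod_two_linear_forms[OF det q'] by blast
    have "\<phi> (a * q) = \<phi> (lin u * a * r) + \<phi> (lin w * a * s) + \<phi> (mconst k * (a * lin c ^ (m + 1)))"
      unfolding q by (simp add: algebra_simps phi)
    also have "\<dots> = k * \<phi> (a * lin c ^ (m + 1))"
      using k phi_ann[OF ann_mult] by (simp only: phi add_0_left)
    finally show ?thesis using c unfolding q by (intro exI[of _ k]) simp
  qed
  have "\<phi> (a * lin c ^ (m + 1)) \<noteq> 0"
  proof
    assume z: "\<phi> (a * lin c ^ (m + 1)) = 0"
    have "a \<in> ann"
    proof (rule in_annI[OF a(1)])
      fix r :: "(3, 'k) mpoly" and k assume "r \<in> poly_comp k" "m + k = 2 * m + 1"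
      then show "\<phi> (a * r) = 0" using rep[of r] z by auto
    qed
    with a(2) show False by blast
  qed
  moreover have "\<phi> (a * p) = 0" using p(1) phi_ann ann_mult' by blast
  ultimately show ?thesis using rep[OF p(2)] by auto
qed

text \<open>
  If \<open>u\<close> divides \<open>ann\<close> in degree \<open>m + 1\<close>, then also in degree \<open>m\<close>, so that the multiples of \<open>u\<close> in
  the quotient have dimension \<open>m + 1\<close> in degree \<open>m\<close> and \<open>m\<close> in degree \<open>m + 1\<close>. Let \<open>a\<close>, \<open>b\<close> be linear forms.
  The multiplications by \<open>u a\<close> on degrees \<open>m - 1\<close> and \<open>m\<close> are dual to each other and have the same rank;
  hence the kernel of \<open>a\<close> on the multiples of \<open>u\<close> is larger by one dimension in degree \<open>m\<close> than in degree
  \<open>m + 1\<close>. As \<open>b\<close> maps the first kernel to the second, it kills a nonzero multiple of \<open>u\<close> that \<open>a\<close>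
  kills as well. So every point is the common zero of two linear forms that kill a class of degree \<open>m\<close>,
  and thus a zero of \<open>ann\<close> in degree \<open>m + 1\<close>; but \<open>ann\<close> is not zero there.
\<close>

lemma no_common_line:
  assumes u: "u \<noteq> (\<lambda>_. 0)" and div: "\<And>p. p \<in> ann \<Longrightarrow> p \<in> poly_comp (m + 1) \<Longrightarrow> \<exists>r. p = lin u * r"
  shows False
proof -
  define l where "l = lin u"
  have l: "l \<in> poly_comp 1" "l \<noteq> 0" using u by (simp_all add: l_def)
  define J where "J e n = {p \<in> poly_comp n. e * p \<in> ann}" for e n
  define D where "D n = MP.dim (poly_comp n :: (3, 'k) mpoly set)" for n
  have J_sub: "J e n \<subseteq> poly_comp n" "MP.subspace (J e n)" "MP.fin_dim (J e n)" for e n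
    using subspace_colon fin_dim_sub[of "J e n" n] by (auto simp: J_def)
  obtain k where k: "m = Suc k" using m_ge_2 by (cases m) auto
  have img: "(\<lambda>p. l * p) ` J l n = ann \<inter> poly_comp (Suc n)"
    if div': "\<And>p. p \<in> ann \<Longrightarrow> p \<in> poly_comp (Suc n) \<Longrightarrow> \<exists>r. p = l * r" for n
  proof safe
    fix p :: "(3, 'k) mpoly" assume "p \<in> J l n"
    then show "l * p \<in> ann" "l * p \<in> poly_comp (Suc n)" using poly_comp_mult[OF l(1), of p n] by (auto simp: J_def)
  next
    fix p :: "(3, 'k) mpoly" assume p: "p \<in> ann" "p \<in> poly_comp (Suc n)"
    then obtain r where "p = l * r" using div' by blast
    then have "p = l * hcomp n r" by (rule homogeneous_cofactor[OF p(2) l(1)])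
    then show "p \<in> (\<lambda>p. l * p) ` J l n" using p(1) by (auto simp: J_def)
  qed
  have dimJ: "MP.dim (J l n) = MP.dim (ann \<inter> poly_comp (Suc n))"
    if "\<And>p. p \<in> ann \<Longrightarrow> p \<in> poly_comp (Suc n) \<Longrightarrow> \<exists>r. p = l * r" for n
  proof -
    have "MP.dim ((\<lambda>p. l * p) ` J l n) = MP.dim (J l n)"
      by (rule MP.dim_image_inj[OF J_sub(3,2)]) (use l in \<open>auto simp: mscale_def algebra_simps\<close>)
    with img[OF that] show ?thesis by simp
  qed
  have dm: "MP.dim (J l m) + m = D m"
    using dimJ[of m] div dim_m1 dim_poly_comp_Suc[of m, where 'k = 'k] by (simp add: D_def l_def)
  have "\<exists>r. p = l * r" if p: "p \<in> ann" "p \<in> poly_comp m" for p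
  proof -
    obtain y z where yz: "chart u y z" using ex_chart[OF u] by blast
    then obtain v where v: "z v \<noteq> 0" using chart_nonzero(1)[OF yz] by auto
    have "mvar v * p \<in> ann" "mvar v * p \<in> poly_comp (m + 1)"
      using ann_mult'[OF p(1)] poly_comp_mult[OF mvar_in_poly_comp p(2), of v] by simp_all
    then obtain r where "mvar v * p = lin u * r" using div by blast
    then have "on_line y z (mvar v * p) = on_line y z (lin u * r)" by simp
    then have "[:y v, z v:] * on_line y z p = 0"
      using chart_lin[OF yz] by (simp only: on_line_simps mult_zero_left)
    then have "on_line y z p = 0" using v by (metis mult_eq_0_iff pCons_eq_0_iff)
    then show ?thesis unfolding l_def by (rule chart_kernel[OF yz p(2)])
  qed
  then have dk: "MP.dim (J l k) + (m + 1) = D k"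
    using dimJ[of k] dim_m dim_poly_comp_Suc[of k, where 'k = 'k] by (simp add: D_def k)
  have key: "\<exists>x\<in>poly_comp m. x \<notin> ann \<and> lin a * x \<in> ann \<and> lin b * x \<in> ann" for a b
  proof -
    let ?K = "J (l * lin a)"
    have rad: "?K i = {x \<in> poly_comp i. \<forall>y\<in>poly_comp j. \<phi> (l * lin a * x * y) = 0}" if "i + j + 2 = 2 * m + 1" for i j
    proof (intro Set.equalityI subsetI)
      fix x :: "(3, 'k) mpoly" assume "x \<in> ?K i"
      then show "x \<in> {x \<in> poly_comp i. \<forall>y\<in>poly_comp j. \<phi> (l * lin a * x * y) = 0}"
        using phi_ann[OF ann_mult] by (auto simp: J_def)
    next
      fix x :: "(3, 'k) mpoly" assume x: "x \<in> {x \<in> poly_comp i. \<forall>y\<in>poly_comp j. \<phi> (l * lin a * x * y) = 0}"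
      then have c: "l * lin a * x \<in> poly_comp (1 + 1 + i)"
        by (intro poly_comp_mult l lin_in_poly_comp) auto
      have "l * lin a * x \<in> ann"
      proof (rule in_annI[OF c])
        fix r :: "(3, 'k) mpoly" and n assume "r \<in> poly_comp n" "1 + 1 + i + n = 2 * m + 1"
        with that have "r \<in> poly_comp j" by (metis (no_types, lifting) add.commute add_left_cancel add.assoc one_add_one)
        with x show "\<phi> (l * lin a * x * r) = 0" by simp
      qed
      with x show "x \<in> ?K i" by (simp add: J_def)
    qed
    have "D m + MP.dim {y \<in> poly_comp k. \<forall>x\<in>poly_comp m. \<phi> (l * lin a * x * y) = 0}
        \<le> D k + MP.dim {x \<in> poly_comp m. \<forall>y\<in>poly_comp k. \<phi> (l * lin a * x * y) = 0}"
      unfolding D_def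
      by (rule MP.dim_radical_le[where b = "\<lambda>x y. \<phi> (l * lin a * x * y)"])
         (auto simp: subspace_poly_comp mscale_def distrib_left distrib_right phi mult.left_commute[of _ "mconst _"] mult.assoc)
    moreover have "{y \<in> poly_comp k. \<forall>x\<in>poly_comp m. \<phi> (l * lin a * x * y) = 0} = ?K k"
      using rad[of k m] by (simp add: k mult_ac)
    moreover have "{x \<in> poly_comp m. \<forall>y\<in>poly_comp k. \<phi> (l * lin a * x * y) = 0} = ?K m"
      using rad[of m k] by (simp add: k mult_ac)
    ultimately have pairing1: "D m + MP.dim (?K k) \<le> D k + MP.dim (?K m)" by simp
    have "D k + MP.dim {y \<in> poly_comp m. \<forall>x\<in>poly_comp k. \<phi> (l * lin a * x * y) = 0}
        \<le> D m + MP.dim {x \<in> poly_comp k. \<forall>y\<in>poly_comp m. \<phi> (l * lin a * x * y) = 0}"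
      unfolding D_def
      by (rule MP.dim_radical_le[where b = "\<lambda>x y. \<phi> (l * lin a * x * y)"])
         (auto simp: subspace_poly_comp mscale_def distrib_left distrib_right phi mult.left_commute[of _ "mconst _"] mult.assoc)
    moreover have "{y \<in> poly_comp m. \<forall>x\<in>poly_comp k. \<phi> (l * lin a * x * y) = 0} = ?K m"
      using rad[of m k] by (simp add: k mult_ac)
    moreover have "{x \<in> poly_comp k. \<forall>y\<in>poly_comp m. \<phi> (l * lin a * x * y) = 0} = ?K k"
      using rad[of k m] by (simp add: k mult_ac)
    ultimately have pairing2: "D k + MP.dim (?K m) \<le> D m + MP.dim (?K k)" by simp
    have "MP.dim (?K k) + MP.dim (J l m) \<le> MP.dim (?K m) + MP.dim {x \<in> ?K k. lin b * x \<in> J l m}"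
    proof (rule MP.dim_preimage_ge[OF J_sub(3,2) J_sub(3,2)])
      show "J l m \<subseteq> ?K m" using ann_mult'[of "l * _" "lin a"] by (auto simp: J_def mult_ac)
      show "lin b * x \<in> ?K m" if "x \<in> ?K k" for x
        using that ann_mult'[of "l * lin a * x" "lin b"] poly_comp_mult[OF lin_in_poly_comp, of x k b]
        by (auto simp: J_def k mult_ac)
    qed (auto simp: mscale_def algebra_simps)
    then have "MP.dim (J l k) < MP.dim {x \<in> ?K k. lin b * x \<in> J l m}"
      using dm dk pairing1 pairing2 by linarith
    then have "\<not> {x \<in> ?K k. lin b * x \<in> J l m} \<subseteq> J l k"
      using MP.dim_subset_le[OF J_sub(3), of _ l k] by (meson not_le)
    then obtain x where x: "x \<in> poly_comp k" "l * lin a * x \<in> ann" "l * (lin b * x) \<in> ann" "l * x \<notin> ann"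
      by (auto simp: J_def)
    have "l * x \<in> poly_comp m" using poly_comp_mult[OF l(1) x(1)] by (simp add: k)
    then show ?thesis using x by (intro bexI[of _ "l * x"]) (auto simp: mult_ac)
  qed
  have zero: "p = 0" if p: "p \<in> ann" "p \<in> poly_comp (m + 1)" for p
  proof (rule form_eq_0[OF infinite_UNIV_char_0 p(2)])
    fix y :: "3 \<Rightarrow> 'k"
    show "ev y p = 0"
    proof (cases "y = (\<lambda>_. 0)")
      case True
      then show ?thesis using ev_scale[OF p(2), of 0 y] by simp
    next
      case False
      obtain a b where ab: "cross a b = y" using ex_cross_product[OF False] by blast
      obtain x where "x \<in> poly_comp m" "x \<notin> ann" "lin a * x \<in> ann" "lin b * x \<in> ann" using key[of a b] by blast
      from vanishing_at_common_zero[OF this _ p] show ?thesis using ab False by simp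
    qed
  qed
  then have "ann \<inter> poly_comp (m + 1) \<subseteq> {0}" by blast
  then have "MP.dim (ann \<inter> poly_comp (m + 1)) = 0"
    using MP.dim_le_card[of "ann \<inter> poly_comp (m + 1)" "{}"] by simp
  then have "D (m + 1) = 2 * m + 2" using dim_m1 by (simp add: D_def)
  moreover have "D (m + 1) = D m + (m + 2)" using dim_poly_comp_Suc[of m, where 'k = 'k] by (simp add: D_def)
  moreover have "D m \<ge> 2 * m + 2" using dim_m by (simp add: D_def)
  ultimately show False by simp
qed

definition base_locus :: "(3 \<Rightarrow> 'k) set" where
  "base_locus = {y. y \<noteq> (\<lambda>_. 0) \<and> (\<forall>p\<in>ann \<inter> poly_comp (m + 1). ev y p = 0)}"

text \<open>
  No line meets the base locus in infinitely many points, for \<open>ann\<close> would be divisible by it in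
  degree \<open>m + 1\<close>. An infinite base locus would hence contain \<open>2m + 3\<close> points in general position,
  which impose one condition more than the codimension of \<open>ann\<close> permits.
\<close>

lemma finite_base_locus: "projectively_finite base_locus"
proof (rule ccontr)
  assume not: "\<not> projectively_finite base_locus"
  have "\<exists>T. T \<subseteq> base_locus \<and> general_position T \<and> finite T \<and> card T = 2 * m + 3"
  proof (rule finite_or_general_position[OF _ _ not])
    show "(\<lambda>_. 0) \<notin> base_locus" by (simp add: base_locus_def)
    fix u :: "3 \<Rightarrow> 'k" assume u: "u \<noteq> (\<lambda>_. 0)"
    show "projectively_finite {y \<in> base_locus. dot u y = 0}"
    proof (rule ccontr)
      assume inf: "\<not> projectively_finite {y \<in> base_locus. dot u y = 0}"
      show False
      proof (rule no_common_line[OF u])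
        fix p :: "(3, 'k) mpoly" assume p: "p \<in> ann" "p \<in> poly_comp (m + 1)"
        have "{y \<in> base_locus. dot u y = 0} \<subseteq> {y. y \<noteq> (\<lambda>_. 0) \<and> dot u y = 0 \<and> ev y p = 0}"
          using p by (auto simp: base_locus_def)
        then show "\<exists>r. p = lin u * r" using line_divides[OF u p(2)] inf projectively_finite_subset by blast
      qed
    qed
  qed
  then obtain T where T: "T \<subseteq> base_locus" "general_position T" "finite T" "card T = 2 * m + 3" by blast
  let ?W = "{p \<in> poly_comp (m + 1). \<forall>y\<in>T. ev y p = 0}"
  have "MP.dim ?W + card T \<le> MP.dim (poly_comp (m + 1) :: (3, 'k) mpoly set)"
    by (rule general_position_conditions[OF T(3,2)]) (use T in \<open>auto simp: base_locus_def\<close>)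
  moreover have "MP.dim (ann \<inter> poly_comp (m + 1)) \<le> MP.dim ?W"
    by (rule MP.dim_subset_le[OF fin_dim_sub]) (use T(1) in \<open>auto simp: base_locus_def\<close>)
  ultimately show False using dim_m1 T(4) by linarith
qed

lemma phi_nonzero: "\<exists>p\<in>poly_comp (2 * m + 1). \<phi> p \<noteq> 0"
proof -
  obtain a where a: "a \<in> poly_comp m" "a \<notin> ann" using no_lefschetz[of 0] by auto
  from in_annI[OF a(1)] a(2) obtain r k where "r \<in> poly_comp k" "m + k = 2 * m + 1" "\<phi> (a * r) \<noteq> 0" by blast
  moreover from this have "a * r \<in> poly_comp (2 * m + 1)" using poly_comp_mult[OF a(1), of r k] by metis
  ultimately show ?thesis by blast
qed

text \<open>
  The line \<open>u = 0\<close> avoids the base locus. The condition on the power makes \<open>u\<close> nonzero also when the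
  base locus is empty.
\<close>

definition good :: "(3 \<Rightarrow> 'k) \<Rightarrow> bool" where
  "good u \<longleftrightarrow> \<phi> (lin u ^ (2 * m + 1)) \<noteq> 0 \<and> (\<forall>y\<in>base_locus. dot u y \<noteq> 0)"

lemma generic_good: "\<exists>G. generic_linear G \<and> (\<forall>u. lin u \<in> G \<longrightarrow> good u)"
proof -
  obtain G where G: "generic_linear G" "\<And>u y. lin u \<in> G \<Longrightarrow> y \<in> base_locus \<Longrightarrow> y \<noteq> (\<lambda>_. 0) \<Longrightarrow> dot u y \<noteq> 0"
    using generic_linear_avoid_points[OF finite_base_locus] by blast
  obtain p where "p \<in> poly_comp (2 * m + 1)" "\<phi> p \<noteq> 0" using phi_nonzero by blast
  then have "generic_linear {u. \<phi> (u ^ (2 * m + 1)) \<noteq> 0}" by (rule generic_linear_power[OF linfun])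
  then have "generic_linear ({u. \<phi> (u ^ (2 * m + 1)) \<noteq> 0} \<inter> G)" using G(1) by (rule generic_linear_Int)
  moreover have "\<forall>u. lin u \<in> {u. \<phi> (u ^ (2 * m + 1)) \<noteq> 0} \<inter> G \<longrightarrow> good u"
    using G(2) unfolding good_def base_locus_def by blast
  ultimately show ?thesis by blast
qed

lemma good_nonzero: "good u \<Longrightarrow> u \<noteq> (\<lambda>_. 0)"
  using phi(3) lin_eq_0_iff[of u] unfolding good_def by (metis power_0_left add_is_0 one_neq_zero)

text \<open>
  Two independent linear forms that kill \<open>a\<close> would meet in a point of the base locus, which lies
  off the line \<open>u = 0\<close>.
\<close>

lemma good_killers:
  assumes "good u" "a \<in> poly_comp m" "a \<notin> ann" "lin u * a \<in> ann" "lin w * a \<in> ann"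
  shows "cross u w = (\<lambda>_. 0)"
proof (rule ccontr)
  assume uw: "cross u w \<noteq> (\<lambda>_. 0)"
  have "cross u w \<in> base_locus" using vanishing_at_common_zero[OF assms(2-5) uw] uw by (auto simp: base_locus_def)
  then have "dot u (cross u w) \<noteq> 0" using assms(1) unfolding good_def by blast
  then show False by simp
qed

end

section \<open>Annihilators restricted to a generic line\<close>

lemma dot_zero: "dot c (\<lambda>_. 0) = 0" by (simp add: dot_def)

text \<open>
  A functional on linear forms has a kernel of dimension at least two, so it also vanishes at a
  form that is not proportional to \<open>u\<close>.
\<close>

lemma ex_second_zero:
  fixes g :: "(3 \<Rightarrow> 'k::field) \<Rightarrow> 'k"
  assumes u: "u \<noteq> (\<lambda>_. 0)"
    and g: "\<And>a b. g (\<lambda>i. a i + b i) = g a + g b" "\<And>c a. g (\<lambda>i. c * a i) = c * g a"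
  shows "\<exists>v. cross u v \<noteq> (\<lambda>_. 0) \<and> g v = 0"
proof -
  obtain y where y: "dot y u = 1" using dot_witness[OF u] by blast
  then have "y \<noteq> (\<lambda>_. 0)" by (auto simp: dot3)
  then obtain b c where bc: "cross b c = y" using ex_cross_product by blast
  have d: "dot c (cross u b) = 1" using y unfolding bc[symmetric] by (simp add: dot3 algebra_simps)
  show ?thesis
  proof (cases "g b = 0")
    case True
    have "cross u b \<noteq> (\<lambda>_. 0)" using d by (metis dot_zero zero_neq_one)
    with True show ?thesis by blast
  next
    case False
    define v where "v = (\<lambda>i. g c * b i + (- g b) * c i)"
    have "g v = g (\<lambda>i. g c * b i) + g (\<lambda>i. (- g b) * c i)" unfolding v_def by (rule g(1))
    also have "\<dots> = 0" unfolding g(2) by simp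
    finally have "g v = 0" .
    moreover have "dot b (cross u v) = g b * dot c (cross u b)" by (simp add: v_def dot3 algebra_simps)
    then have "cross u v \<noteq> (\<lambda>_. 0)" using d False by (metis dot_zero mult_1_right)
    ultimately show ?thesis by blast
  qed
qed

lemma (in fd_space) dim_le_1_multiple:
  assumes "fin_dim T" "dim T \<le> 1" "x \<in> T" "y \<in> T" "x \<noteq> 0"
  shows "\<exists>k. y = scale k x"
proof (rule ccontr)
  assume not: "\<not> ?thesis"
  have "y \<notin> span {x}" using not by (auto simp: span_singleton)
  then have "independent (insert y {x})" using assms(5) by (intro independent_insertI) (auto simp: independent_empty)
  then have "card (insert y {x}) \<le> dim T"
    using independent_card_le[OF assms(1), of "insert y {x}"] assms(3,4) by simp
  moreover have "y \<noteq> x" using \<open>y \<notin> span {x}\<close> span_base[of x "{x}"] by auto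
  ultimately show False using assms(2) by simp
qed

context lefschetz_failure
begin

definition line_ann :: "(3 \<Rightarrow> 'k) \<Rightarrow> (3 \<Rightarrow> 'k) \<Rightarrow> (3, 'k) mpoly \<Rightarrow> nat \<Rightarrow> 'k poly set" where
  "line_ann y z a j = on_line y z ` {p \<in> poly_comp j. p * a \<in> ann}"

lemma line_ann_bounds: "line_ann y z a j \<subseteq> {p. degree p \<le> j}" "PS.subspace (line_ann y z a j)"
proof -
  show "line_ann y z a j \<subseteq> {p. degree p \<le> j}" using form_on_line(1) by (auto simp: line_ann_def)
  have scale: "smult c (on_line y z p) = on_line y z (mconst c * p)" for c p by simp
  have 1: "on_line y z p + on_line y z q \<in> line_ann y z a j"
    if "p \<in> poly_comp j" "q \<in> poly_comp j" "p * a \<in> ann" "q * a \<in> ann" for p q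
    unfolding on_line_simps(1)[symmetric] line_ann_def using that by (intro imageI) (auto simp: distrib_right ann_add)
  have 2: "smult c (on_line y z p) \<in> line_ann y z a j" if "p \<in> poly_comp j" "p * a \<in> ann" for p c
    unfolding scale line_ann_def using that by (intro imageI) (auto simp: mult.assoc ann_mult')
  have "0 \<in> line_ann y z a j" unfolding line_ann_def by (rule image_eqI[of _ _ 0]) auto
  then show "PS.subspace (line_ann y z a j)"
    unfolding PS.subspace_def using 1 2 by (auto simp: line_ann_def)
qed

context
  fixes u y z a
  assumes good: "good u" and chart: "chart u y z" and a: "a \<in> poly_comp m" "a \<notin> ann" "lin u * a \<in> ann"
begin

text \<open>
  Since \<open>u\<close> kills \<open>a\<close>, restricting its annihilator to the line \<open>u = 0\<close> loses no information.
\<close>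

lemma in_line_ann_iff:
  assumes "p \<in> poly_comp j"
  shows "on_line y z p \<in> line_ann y z a j \<longleftrightarrow> p * a \<in> ann"
proof
  assume "on_line y z p \<in> line_ann y z a j"
  then obtain p' where p': "p' \<in> poly_comp j" "p' * a \<in> ann" "on_line y z p = on_line y z p'" by (auto simp: line_ann_def)
  then have "on_line y z (p - p') = 0" by simp
  then obtain r where r: "p - p' = lin u * r" using chart_kernel[OF chart] assms p'(1) poly_comp_diff by blast
  have "p * a = p' * a + (p - p') * a" by (simp add: algebra_simps)
  also have "\<dots> = p' * a + r * (lin u * a)" unfolding r by (simp add: algebra_simps)
  finally show "p * a \<in> ann" using p'(2) a(3) by (simp add: ann_add ann_mult')
qed (use assms in \<open>auto simp: line_ann_def\<close>)

lemma line_ann_Suc: "p \<in> line_ann y z a j \<Longrightarrow> p \<in> line_ann y z a (Suc j) \<and> pCons 0 p \<in> line_ann y z a (Suc j)"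
proof -
  assume "p \<in> line_ann y z a j"
  then obtain p' where p': "p' \<in> poly_comp j" "p' * a \<in> ann" "p = on_line y z p'" by (auto simp: line_ann_def)
  obtain s where s: "s \<in> poly_comp 1" "on_line y z s = 1" using chart_lift[OF chart, of 1 1] by auto
  obtain t where t: "t \<in> poly_comp 1" "on_line y z t = [:0, 1:]" using chart_lift[OF chart, of "[:0, 1:]" 1] by auto
  have "on_line y z (e * p') \<in> line_ann y z a (Suc j)" if e: "e \<in> poly_comp 1" for e
    unfolding line_ann_def
  proof (intro imageI CollectI conjI)
    show "e * p' \<in> poly_comp (Suc j)" using poly_comp_mult[OF e p'(1)] by simp
    show "e * p' * a \<in> ann" using ann_mult'[OF p'(2), of e] by (simp add: mult.assoc)
  qed
  from this[OF s(1)] this[OF t(1)]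
  have "on_line y z (s * p') \<in> line_ann y z a (Suc j)" "on_line y z (t * p') \<in> line_ann y z a (Suc j)" .
  then show ?thesis using s t p'(3) by simp
qed

text \<open>
  In degree \<open>m\<close> the annihilator restricted to the line has codimension at least
  two: otherwise a second linear form kills \<open>a\<close>.
\<close>

lemma dim_line_ann_m: "PS.dim (line_ann y z a m) < m"
proof (rule ccontr)
  assume not: "\<not> ?thesis"
  \<comment> \<open>With codimension at most one, a form of degree \<open>m\<close> pairs with \<open>a\<close> as a multiple of a fixed \<open>w\<close>; then every \<open>v\<close> with \<open>\<phi> (v a w) = 0\<close> kills \<open>a\<close>.\<close>
  obtain C where C: "finite C" "C \<subseteq> {p. degree p \<le> m}" "{p. degree p \<le> m} \<subseteq> PS.span (line_ann y z a m \<union> C)"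
    "card C = Suc m - PS.dim (line_ann y z a m)"
    using PS.complement_basis[OF fin_dim_polys line_ann_bounds] unfolding dim_polys by metis
  have "\<exists>c. degree c \<le> m \<and> C \<subseteq> {c}"
  proof (cases "C = {}")
    case True
    then show ?thesis by (intro exI[of _ 0]) simp
  next
    case False
    then obtain c where "c \<in> C" by blast
    moreover have "card C \<le> 1" using C(4) not by simp
    ultimately have "C = {c}" using C(1) by (metis card_le_Suc0_iff_eq One_nat_def empty_iff insert_iff subsetI subset_antisym)
    with C(2) show ?thesis by blast
  qed
  then obtain c where c: "degree c \<le> m" "C \<subseteq> {c}" by blast
  obtain w where w: "w \<in> poly_comp m" "on_line y z w = c" using chart_lift[OF chart c(1)] by blast
  have rep: "\<exists>k. (p - mconst k * w) * a \<in> ann" if p: "p \<in> poly_comp m" for p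
  proof -
    have "on_line y z p \<in> PS.span (insert c (line_ann y z a m))"
      using C(3) form_on_line(1)[OF p] PS.span_mono[of "line_ann y z a m \<union> C" "insert c (line_ann y z a m)"] c(2) by auto
    then obtain k where "on_line y z p - smult k c \<in> line_ann y z a m"
      using PS.span_eq_iff[THEN iffD2, OF line_ann_bounds(2)] by (auto simp: PS.span_insert)
    then have "on_line y z (p - mconst k * w) \<in> line_ann y z a m" using w by simp
    then show ?thesis using in_line_ann_iff[of "p - mconst k * w" m] p w(1) by auto
  qed
  obtain v where v: "cross u v \<noteq> (\<lambda>_. 0)" "\<phi> (lin v * (a * w)) = 0"
    using ex_second_zero[OF good_nonzero[OF good], of "\<lambda>v. \<phi> (lin v * (a * w))"]
    by (auto simp: lin_add lin_scale distrib_right mult.assoc phi)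
  have "lin v * a \<in> ann"
  proof (rule in_annI[of _ "1 + m"])
    show "lin v * a \<in> poly_comp (1 + m)" by (intro poly_comp_mult lin_in_poly_comp a)
    fix r :: "(3, 'k) mpoly" and n assume r: "r \<in> poly_comp n" "1 + m + n = 2 * m + 1"
    then have "r \<in> poly_comp m" by simp
    then obtain k where k: "(r - mconst k * w) * a \<in> ann" using rep by blast
    have "lin v * a * r = lin v * ((r - mconst k * w) * a) + mconst k * (lin v * (a * w))" by (simp add: algebra_simps)
    then show "\<phi> (lin v * a * r) = 0" using phi_ann[OF ann_mult'[OF k]] v(2) by (simp only: phi mult_zero_right add_0_left)
  qed
  then show False using good_killers[OF good a] v(1) by blast
qed

text \<open>
  The dimension grows by at least one from each degree to the next, so the bound in degree \<open>m\<close>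
  propagates downwards.
\<close>

lemma dim_line_ann:
  assumes "j \<le> m" "line_ann y z a j \<noteq> {0}"
  shows "PS.dim (line_ann y z a j) < j"
proof -
  have "PS.dim (line_ann y z a j) + (m - j) \<le> PS.dim (line_ann y z a (j + (m - j)))"
    by (rule dim_growth(1)) (use line_ann_bounds line_ann_Suc assms(2) in auto)
  then show ?thesis using dim_line_ann_m assms(1) by simp
qed

lemma killed_by_linear: "b \<in> poly_comp 1 \<Longrightarrow> b * a \<in> ann \<Longrightarrow> on_line y z b = 0"
proof -
  assume b: "b \<in> poly_comp 1" "b * a \<in> ann"
  have "line_ann y z a 1 = {0}"
  proof (rule ccontr)
    assume ne: "line_ann y z a 1 \<noteq> {0}"
    have "PS.dim (line_ann y z a 1) < 1" by (rule dim_line_ann) (use ne m_ge_2 in auto)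
    then have "PS.dim (line_ann y z a 1) \<le> PS.dim {0 :: 'k poly}" by simp
    moreover have "{0} \<subseteq> line_ann y z a 1" using PS.subspace_0[OF line_ann_bounds(2)] by simp
    ultimately have "{0} = line_ann y z a 1"
      by (intro PS.subspace_eq_if_dim_le PS.fin_dim_subset[OF fin_dim_polys line_ann_bounds(1)] PS.subspace_single_0)
    with ne show False by simp
  qed
  with in_line_ann_iff[OF b(1)] b(2) show ?thesis by blast
qed

lemma multiple_of_lin: "b \<in> poly_comp 1 \<Longrightarrow> on_line y z b = 0 \<Longrightarrow> \<exists>k. b = mconst k * lin u"
proof -
  assume b: "b \<in> poly_comp 1" "on_line y z b = 0"
  then obtain r where "b = lin u * r" using chart_kernel[OF chart] by blast
  then have "b = lin u * hcomp 0 r" using homogeneous_cofactor[of b 0 "lin u" r] b(1) by simp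
  moreover obtain k where "hcomp 0 r = mconst k" using poly_comp_0_const[OF hcomp_in_poly_comp] by blast
  ultimately show ?thesis by (auto simp: mult.commute)
qed

text \<open>
  On the line, the annihilator has dimension at most \<open>j - 1\<close> in degree \<open>j\<close>, which is the dimension
  of the multiples of the conic \<open>q\<close>. The two therefore agree, and lifting from the line, which is
  possible up to multiples of \<open>u\<close>, shows that \<open>u\<close> and \<open>q\<close> generate the annihilator. In degree one there is no room for \<open>q\<close>, so \<open>s\<close> is zero there.
\<close>

lemma killed_by_multiples_of_conic:
  assumes q: "q \<in> poly_comp 2" "q * a \<in> ann" "on_line y z q \<noteq> 0" and j: "1 \<le> j" "j \<le> m"
    and b: "b \<in> poly_comp j" "b * a \<in> ann"
  shows "\<exists>r\<in>poly_comp (j - 1). \<exists>s. b = lin u * r + q * s \<and> (s = 0 \<or> j \<ge> 2 \<and> s \<in> poly_comp (j - 2))"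
proof (cases "j = 1")
  case True
  then obtain k where "b = mconst k * lin u" using killed_by_linear multiple_of_lin b by blast
  then show ?thesis using True by (intro bexI[of _ "mconst k"] exI[of _ 0]) (auto simp: mult.commute)
next
  case False
  with j have j2: "j \<ge> 2" by simp
  let ?M = "(*) (on_line y z q) ` {p. degree p \<le> j - 2}"
  have MT: "?M \<subseteq> line_ann y z a j"
  proof safe
    fix c :: "'k poly" assume "degree c \<le> j - 2"
    then obtain s where s: "s \<in> poly_comp (j - 2)" "on_line y z s = c" using chart_lift[OF chart] by blast
    have "q * s \<in> poly_comp j" using poly_comp_mult[OF q(1) s(1)] unfolding le_add_diff_inverse[OF j2] .
    moreover have "q * s * a \<in> ann" using ann_mult[OF q(2), of s] by (simp add: mult_ac)
    ultimately have "on_line y z (q * s) \<in> line_ann y z a j" using in_line_ann_iff by blast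
    then show "on_line y z q * c \<in> line_ann y z a j" by (simp add: s)
  qed
  have subM: "PS.subspace ?M"
    unfolding PS.subspace_def
  proof (intro conjI ballI allI)
    show "0 \<in> ?M" by (intro image_eqI[of _ _ 0]) auto
    show "x + w \<in> ?M" if "x \<in> ?M" "w \<in> ?M" for x w
      using that by (auto simp: degree_add_le simp flip: distrib_left)
    show "smult c x \<in> ?M" if "x \<in> ?M" for c x
      using that by (auto simp flip: mult_smult_right intro!: imageI intro: order_trans[OF degree_smult_le])
  qed
  have "on_line y z q \<in> ?M" by (rule image_eqI[of _ _ 1]) auto
  then have "on_line y z q \<in> line_ann y z a j" using MT by blast
  then have "line_ann y z a j \<noteq> {0}" using q(3) by auto
  then have "PS.dim (line_ann y z a j) \<le> PS.dim ?M"
    using dim_line_ann[OF j(2)] dim_polys_multiple[OF q(3), of "j - 2"] j2 by simp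
  then have "?M = line_ann y z a j"
    by (intro PS.subspace_eq_if_dim_le[OF _ MT subM] PS.fin_dim_subset[OF fin_dim_polys line_ann_bounds(1)])
  moreover have "on_line y z b \<in> line_ann y z a j" using in_line_ann_iff[OF b(1)] b(2) by blast
  ultimately obtain c where c: "degree c \<le> j - 2" "on_line y z b = on_line y z q * c" by blast
  obtain s where s: "s \<in> poly_comp (j - 2)" "on_line y z s = c" using chart_lift[OF chart c(1)] by blast
  have bqs: "b - q * s \<in> poly_comp j" using poly_comp_mult[OF q(1) s(1)] b(1) unfolding le_add_diff_inverse[OF j2] by blast
  obtain r where r: "b - q * s = lin u * r" using chart_kernel[OF chart bqs] c s by auto
  have "b - q * s = lin u * hcomp (j - 1) r"
    using homogeneous_cofactor[of _ "j - 1" "lin u" r] bqs r j by simp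
  then have "b = lin u * hcomp (j - 1) r + q * s" by (metis diff_add_cancel)
  then show ?thesis using s j2 by (intro bexI[of _ "hcomp (j - 1) r"] exI[of _ s]) auto
qed

end

lemma ann_if_mvars:
  assumes "p \<in> poly_comp n" "n < 2 * m + 1" "\<And>i. mvar i * p \<in> ann"
  shows "p \<in> ann"
proof (rule ann_if_all_lin[OF assms(1,2)])
  fix v
  show "lin v * p \<in> ann" unfolding lin_def sum3 using assms(3)
    by (simp add: distrib_right mult.assoc ann_add ann_mult')
qed

text \<open>
  The relation \<open>u x = 0\<close> lifts to \<open>v x + u x' = 0\<close> in every direction \<open>v\<close>. Multiplied by \<open>x\<close> this says
  that \<open>v\<close> kills the square of \<open>x\<close>; its degree \<open>2m\<close> is below that of the socle, so the square is zero.
\<close>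

lemma generic_square_zero:
  "\<exists>G. generic_linear G \<and> (\<forall>u\<in>poly_comp 1. \<forall>v\<in>poly_comp 1. \<forall>x\<in>poly_comp m. u \<in> G \<longrightarrow> u * x \<in> ann \<longrightarrow>
     x * x \<in> ann \<and> (\<exists>x'\<in>poly_comp m. v * x + u * x' \<in> ann))"
proof -
  obtain G where G: "generic_linear G" and lift: "\<And>u v x. u \<in> poly_comp 1 \<Longrightarrow> v \<in> poly_comp 1 \<Longrightarrow> x \<in> poly_comp m \<Longrightarrow>
      u \<in> G \<Longrightarrow> u * x \<in> ann \<Longrightarrow> \<exists>x'\<in>poly_comp m. v * x + u * x' \<in> ann"
    using lift_single[OF polymap_id, of m] by blast
  have "x * x \<in> ann" if u: "u \<in> poly_comp 1" "x \<in> poly_comp m" "u \<in> G" "u * x \<in> ann" for u x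
  proof (rule ann_if_mvars[OF poly_comp_mult[OF u(2,2)]])
    fix i
    obtain x' where x': "mvar i * x + u * x' \<in> ann" using lift[OF u(1) mvar_in_poly_comp u(2,3,4)] by blast
    have "mvar i * (x * x) = (mvar i * x + u * x') * x - x' * (u * x)" by (simp add: algebra_simps)
    then show "mvar i * (x * x) \<in> ann" using ann_diff[OF ann_mult[OF x'] ann_mult'[OF u(4)]] by simp
  qed simp
  with G lift show ?thesis by blast
qed

lemma ex_multiple_notin_ann:
  assumes "e \<in> poly_comp i" "e \<notin> ann" "i + n \<le> 2 * m + 1"
  shows "\<exists>c\<in>poly_comp n. e * c \<notin> ann"
  using assms(3)
proof (induction n)
  case 0
  then show ?case using assms(2) mconst_in_poly_comp[of 1] by (intro bexI[of _ 1]) auto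
next
  case (Suc n)
  then obtain c where c: "c \<in> poly_comp n" "e * c \<notin> ann" by auto
  have "\<exists>v. lin v * (e * c) \<notin> ann"
    using ann_if_all_lin[OF poly_comp_mult[OF assms(1) c(1)]] Suc.prems c(2) by auto
  then obtain v where "lin v * (e * c) \<notin> ann" by blast
  then show ?case using poly_comp_mult[OF lin_in_poly_comp c(1), of v]
    by (intro bexI[of _ "lin v * c"]) (auto simp: mult_ac)
qed

lemma generic_power_notin:
  assumes c: "c \<in> poly_comp m" "c \<notin> ann"
  shows "generic_linear {u. \<phi> (u ^ (m + 1) * c) \<noteq> 0}"
proof -
  from in_annI[OF c(1)] c(2) obtain r k where r: "r \<in> poly_comp k" "m + k = 2 * m + 1" "\<phi> (c * r) \<noteq> 0" by blast
  then have "r \<in> poly_comp (m + 1)" by (metis add.assoc add_left_cancel mult_2)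
  moreover have "\<phi> (r * c) \<noteq> 0" using r(3) by (simp add: mult.commute)
  ultimately show ?thesis by (rule generic_linear_power[OF linfun_mult[OF linfun]])
qed

end

section \<open>Socle degree five\<close>

lemma mconst_2: "mconst (2 :: 'k::field) = (2 :: (3, 'k) mpoly)"
  using mconst_add[of 1 "1 :: 'k"] by simp

lemma smult_combination:
  fixes p r :: "'k::field poly"
  shows "smult 3 p = smult 2 (smult 2 p + r) - (smult 2 r + p)"
  by (intro poly_eqI) (simp add: algebra_simps)

lemma smult_3_cancel:
  fixes p r :: "'k::field_char_0 poly"
  assumes "smult 3 p = smult k r"
  shows "p = smult (k / 3) r"
proof -
  have "smult (1 / 3) (smult 3 p) = smult (1 / 3) (smult k r)" using assms by simp
  then show ?thesis by simp
qed

lemma shifted_multiple: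
  fixes r :: "'k::field poly"
  assumes "[:0, 1:] * smult k r = smult k' r" "r \<noteq> 0"
  shows "k = 0"
proof (rule ccontr)
  assume "k \<noteq> 0"
  then have "degree (pCons 0 (smult k r)) = Suc (degree r)" using assms(2) by simp
  moreover have "pCons 0 (smult k r) = smult k' r" using assms(1) by simp
  moreover have "degree (smult k' r) \<le> degree r" by (rule degree_smult_le)
  ultimately show False by simp
qed

context lefschetz_failure
begin

text \<open>
  On the line, the annihilator of a class \<open>a\<close> killed by a generic \<open>u\<close> is spanned by \<open>a\<close> in degree two.
  Differentiating \<open>u a = 0\<close> once gives \<open>x\<^sub>i a + u a' = 0\<close>, and once more \<open>a' a = 0\<close>, so that \<open>a'\<close> is a
  multiple of \<open>a\<close> up to a multiple of \<open>u\<close>, which turns the relation into \<open>x\<^sub>i a + u\<^sup>2 b\<^sub>i = 0\<close>.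
  Differentiating that relation, \<open>2 x\<^sub>j b\<^sub>i + x\<^sub>i b\<^sub>j\<close> restricts to a multiple of \<open>a\<close> on the line. By
  symmetry in \<open>i\<close> and \<open>j\<close> all \<open>x\<^sub>j b\<^sub>i\<close> do, which is impossible for degree reasons unless \<open>b\<^sub>i\<close> vanishes
  on the line. Then \<open>b\<^sub>i = \<tau>\<^sub>i u\<close>, and \<open>x\<^sub>i a = - \<tau>\<^sub>i u\<^sup>3\<close> for all \<open>i\<close>, so that a linear form independent
  of \<open>u\<close> kills \<open>a\<close>.
\<close>

lemma not_m_2: "m \<noteq> 2"
proof
  assume m: "m = 2"
  obtain c where c: "c \<in> poly_comp m" "c \<notin> ann" using no_lefschetz[of 0] by auto
  obtain Gg where Gg: "generic_linear Gg" "\<And>u. lin u \<in> Gg \<Longrightarrow> good u" using generic_good by blast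
  obtain G1 where G1: "generic_linear G1" "\<forall>u\<in>poly_comp 1. \<forall>v\<in>poly_comp 1. \<forall>x\<in>poly_comp m. u \<in> G1 \<longrightarrow> u * x \<in> ann \<longrightarrow>
     x * x \<in> ann \<and> (\<exists>x'\<in>poly_comp m. v * x + u * x' \<in> ann)" using generic_square_zero by blast
  obtain Gs where Gs: "generic_linear Gs" "\<forall>u\<in>poly_comp 1. \<forall>v\<in>poly_comp 1. \<forall>x\<in>poly_comp 1. u \<in> Gs \<longrightarrow> u ^ 2 * x \<in> ann \<longrightarrow>
     (\<exists>x'\<in>poly_comp 1. of_nat 2 * u ^ (2 - 1) * v * x + u ^ 2 * x' \<in> ann)"
    using lift_single[OF polymap_power[of 2], of 1] by blast
  have "\<forall>i. \<exists>G. generic_linear G \<and> (\<forall>u\<in>poly_comp 1. \<forall>w\<in>poly_comp 1. \<forall>x\<in>poly_comp 2. \<forall>y\<in>poly_comp 2. u \<in> G \<longrightarrow>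
     u * x \<in> ann \<longrightarrow> mvar i * x + u * y \<in> ann \<longrightarrow>
     (\<exists>x'\<in>poly_comp 2. \<exists>y'\<in>poly_comp 2. w * x + u * x' \<in> ann \<and> w * y + mvar i * x' + u * y' \<in> ann))"
    using lift_derived[OF polymap_id, of 2 2] by blast
  then obtain G2 where G2: "\<And>i. generic_linear (G2 i)" "\<And>i. \<forall>u\<in>poly_comp 1. \<forall>w\<in>poly_comp 1. \<forall>x\<in>poly_comp 2. \<forall>y\<in>poly_comp 2. u \<in> G2 i \<longrightarrow>
     u * x \<in> ann \<longrightarrow> mvar i * x + u * y \<in> ann \<longrightarrow>
     (\<exists>x'\<in>poly_comp 2. \<exists>y'\<in>poly_comp 2. w * x + u * x' \<in> ann \<and> w * y + mvar i * x' + u * y' \<in> ann)"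
    unfolding choice_iff by blast
  have "\<forall>i. \<exists>G. generic_linear G \<and> (\<forall>u\<in>poly_comp 1. \<forall>w\<in>poly_comp 1. \<forall>x\<in>poly_comp 2. \<forall>y\<in>poly_comp 1. u \<in> G \<longrightarrow>
     u * x \<in> ann \<longrightarrow> mvar i * x + u ^ 2 * y \<in> ann \<longrightarrow>
     (\<exists>x'\<in>poly_comp 2. \<exists>y'\<in>poly_comp 1. w * x + u * x' \<in> ann \<and> of_nat 2 * u ^ (2 - 1) * w * y + mvar i * x' + u ^ 2 * y' \<in> ann))"
    using lift_derived[OF polymap_power[of 2], of 2 1] by blast
  then obtain G3 where G3: "\<And>i. generic_linear (G3 i)" "\<And>i. \<forall>u\<in>poly_comp 1. \<forall>w\<in>poly_comp 1. \<forall>x\<in>poly_comp 2. \<forall>y\<in>poly_comp 1. u \<in> G3 i \<longrightarrow>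
     u * x \<in> ann \<longrightarrow> mvar i * x + u ^ 2 * y \<in> ann \<longrightarrow>
     (\<exists>x'\<in>poly_comp 2. \<exists>y'\<in>poly_comp 1. w * x + u * x' \<in> ann \<and> of_nat 2 * u ^ (2 - 1) * w * y + mvar i * x' + u ^ 2 * y' \<in> ann)"
    unfolding choice_iff by blast
  have "generic_linear ((((Gg \<inter> G1) \<inter> Gs) \<inter> {u. \<phi> (u ^ (m + 1) * c) \<noteq> 0}) \<inter> ((\<Inter>i\<in>UNIV. G2 i) \<inter> (\<Inter>i\<in>UNIV. G3 i)))"
    by (intro generic_linear_Int generic_linear_INT Gg G1 Gs G2 G3 generic_power_notin c) auto
  then obtain u where u: "lin u \<in> (((Gg \<inter> G1) \<inter> Gs) \<inter> {u. \<phi> (u ^ (m + 1) * c) \<noteq> 0}) \<inter> ((\<Inter>i\<in>UNIV. G2 i) \<inter> (\<Inter>i\<in>UNIV. G3 i))"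
    by (rule generic_linear_witness)
  define L where "L = lin u"
  have L1: "L \<in> poly_comp 1" by (simp add: L_def)
  have good: "good u" using Gg(2) u by blast
  have sq: "x * x \<in> ann" and lift1: "\<exists>x'\<in>poly_comp 2. v * x + L * x' \<in> ann"
    if "x \<in> poly_comp 2" "L * x \<in> ann" "v \<in> poly_comp 1" for x v
    using G1(2)[rule_format, of L v x] u that L1 m by (auto simp: L_def)
  have lifts: "\<exists>x'\<in>poly_comp 1. 2 * L * v * x + L * L * x' \<in> ann"
    if "x \<in> poly_comp 1" "L * L * x \<in> ann" "v \<in> poly_comp 1" for x v
    using Gs(2)[rule_format, of L v x] u that L1 by (auto simp: L_def power2_eq_square)
  have lift2: "\<exists>x'\<in>poly_comp 2. \<exists>y'\<in>poly_comp 2. w * x + L * x' \<in> ann \<and> w * y + mvar i * x' + L * y' \<in> ann"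
    if "w \<in> poly_comp 1" "x \<in> poly_comp 2" "y \<in> poly_comp 2" "L * x \<in> ann" "mvar i * x + L * y \<in> ann" for w x y i
    using G2(2)[of i, rule_format, of L w x y] u that L1 by (auto simp: L_def)
  have lift3: "\<exists>x'\<in>poly_comp 2. \<exists>y'\<in>poly_comp 1. w * x + L * x' \<in> ann \<and> 2 * L * w * y + mvar i * x' + L * L * y' \<in> ann"
    if "w \<in> poly_comp 1" "x \<in> poly_comp 2" "y \<in> poly_comp 1" "L * x \<in> ann" "mvar i * x + L * L * y \<in> ann" for w x y i
    using G3(2)[of i, rule_format, of L w x y] u that L1 by (auto simp: L_def power2_eq_square)
  have cube: "mconst k * (L * (L * L)) \<in> ann \<Longrightarrow> k = 0" for k
    using phi_ann[OF ann_mult, of "mconst k * (L * (L * L))" c] u m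
    by (auto simp: L_def power3_eq_cube mult.assoc phi numeral_3_eq_3)
  have ann2: "x = 0" if "x \<in> poly_comp 2" "x \<in> ann" for x using ann_2 that by blast
  obtain y z where chart: "chart u y z" using ex_chart[OF good_nonzero[OF good]] by blast
  let ?\<rho> = "on_line y z"
  have \<rho>L: "?\<rho> L = 0" using chart_lin[OF chart] by (simp add: L_def)
  have divL: "\<exists>b\<in>poly_comp 1. x = L * b" if x: "x \<in> poly_comp 2" "?\<rho> x = 0" for x
  proof -
    obtain r where "x = L * r" using chart_kernel[OF chart x] by (auto simp: L_def)
    then have "x = L * hcomp 1 r" using homogeneous_cofactor[of x 1 L r] x(1) L1 by (simp add: numeral_2_eq_2)
    then show ?thesis by blast
  qed
  \<comment> \<open>A class killed by \<open>u\<close> is determined by its restriction to the line.\<close>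
  have inj: "x = 0" if x: "x \<in> poly_comp 2" "L * x \<in> ann" "?\<rho> x = 0" for x
  proof (rule ccontr)
    assume x0: "x \<noteq> 0"
    then have xa: "x \<in> poly_comp m" "x \<notin> ann" "lin u * x \<in> ann" using x ann2 m by (auto simp: L_def)
    obtain b where b: "b \<in> poly_comp 1" "x = L * b" using divL[OF x(1,3)] by blast
    have "b * x \<in> ann"
    proof (rule ann_if_mvars)
      show "b * x \<in> poly_comp (1 + 2)" by (intro poly_comp_mult b x)
      fix i
      obtain b' where b': "2 * L * mvar i * b + L * L * b' \<in> ann"
        using lifts[OF b(1) _ mvar_in_poly_comp, of i] x(2) b(2) by (auto simp: mult.assoc)
      have "mconst 2 * (mvar i * (b * x)) = (2 * L * mvar i * b + L * L * b') * b - b' * (L * x)"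
        by (simp add: mconst_2 b(2) algebra_simps)
      then have "mconst 2 * (mvar i * (b * x)) \<in> ann" using ann_diff[OF ann_mult[OF b'] ann_mult'[OF x(2)]] by simp
      then show "mvar i * (b * x) \<in> ann" by (rule ann_cancel) simp
    qed (simp add: m)
    then obtain k where k: "b = mconst k * L"
      using killed_by_linear[OF good chart xa b(1)] multiple_of_lin[OF good chart xa b(1)] by (auto simp: L_def)
    then have "mconst k * (L * (L * L)) \<in> ann" using x(2) b(2) by (simp add: mult_ac)
    then have "k = 0" by (rule cube)
    with k b(2) x0 show False by simp
  qed
  obtain a where a: "a \<in> poly_comp 2" "a \<notin> ann" "L * a \<in> ann" using no_lefschetz[OF L1] m by auto
  have am: "a \<in> poly_comp m" "a \<notin> ann" "lin u * a \<in> ann" using a m by (auto simp: L_def)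
  have \<rho>a: "?\<rho> a \<noteq> 0" using inj[OF a(1,3)] a(2) by auto
  have aa: "a * a \<in> ann" using sq[OF a(1,3) L1] .
  \<comment> \<open>On the line, only multiples of \<open>a\<close> kill \<open>a\<close>.\<close>
  have kill: "\<exists>k. ?\<rho> p = smult k (?\<rho> a)" if p: "p \<in> poly_comp 2" "p * a \<in> ann" for p
  proof (rule PS.dim_le_1_multiple)
    show "PS.fin_dim (line_ann y z a 2)" by (rule PS.fin_dim_subset[OF fin_dim_polys line_ann_bounds(1)])
    show "PS.dim (line_ann y z a 2) \<le> 1" using dim_line_ann_m[OF good chart am] m by simp
    show "?\<rho> a \<in> line_ann y z a 2" "?\<rho> p \<in> line_ann y z a 2"
      using in_line_ann_iff[OF good chart am, of _ 2] a(1) aa p by auto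
  qed (rule \<rho>a)
  have ker: "\<exists>k. x = mconst k * a" if x: "x \<in> poly_comp 2" "L * x \<in> ann" for x
  proof -
    have "(x + a) * (x + a) \<in> ann" using sq[of "x + a", OF _ _ L1] x a by (auto simp: distrib_left ann_add)
    moreover have "mconst 2 * (x * a) = (x + a) * (x + a) - x * x - a * a"
      by (simp add: mconst_2 algebra_simps)
    ultimately have "mconst 2 * (x * a) \<in> ann" using sq[OF x L1] aa by (simp add: ann_diff)
    then have "x * a \<in> ann" by (rule ann_cancel) simp
    then obtain k where k: "?\<rho> x = smult k (?\<rho> a)" using kill[OF x(1)] by blast
    have "x - mconst k * a = 0"
    proof (rule inj)
      show "L * (x - mconst k * a) \<in> ann"
        using ann_diff[OF x(2) ann_mult'[OF a(3), of "mconst k"]] by (simp add: algebra_simps)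
    qed (use x a k in auto)
    then show ?thesis by auto
  qed
  \<comment> \<open>Second order: the derivatives of \<open>a\<close> also kill \<open>a\<close>.\<close>
  have "\<exists>b\<in>poly_comp 1. mvar i * a + L * L * b \<in> ann" for i
  proof -
    obtain a' where a': "a' \<in> poly_comp 2" "mvar i * a + L * a' \<in> ann"
      using lift1[OF a(1,3) mvar_in_poly_comp] by blast
    have "a' * a \<in> ann"
    proof (rule ann_if_mvars)
      show "a' * a \<in> poly_comp (2 + 2)" by (intro poly_comp_mult a' a)
      fix j
      obtain c' d where cd: "mvar j * a + L * c' \<in> ann" "mvar j * a' + mvar i * c' + L * d \<in> ann"
        using lift2[OF mvar_in_poly_comp a(1) a'(1) a(3) a'(2), of j] by blast
      have "mconst 2 * (mvar j * (a' * a)) = (mvar j * a' + mvar i * c' + L * d) * a - d * (L * a)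
          + (mvar j * a + L * c') * a' - (mvar i * a + L * a') * c'"
        by (simp add: mconst_2 algebra_simps)
      also have "\<dots> \<in> ann"
        by (intro ann_add ann_diff ann_mult ann_mult' cd a' a)
      finally show "mvar j * (a' * a) \<in> ann" by (rule ann_cancel) simp
    qed (simp add: m)
    then obtain k where k: "?\<rho> a' = smult k (?\<rho> a)" using kill[OF a'(1)] by blast
    obtain b where b: "b \<in> poly_comp 1" "a' - mconst k * a = L * b"
      using divL[of "a' - mconst k * a"] a' a k by auto
    have "mvar i * a + L * L * b = mvar i * a + L * (a' - mconst k * a)" by (simp only: b(2) mult.assoc)
    also have "\<dots> = (mvar i * a + L * a') - mconst k * (L * a)" by (simp add: algebra_simps)
    also have "\<dots> \<in> ann" by (intro ann_diff a' ann_mult'[OF a(3)])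
    finally show ?thesis using b(1) by blast
  qed
  then have "\<forall>i. \<exists>b. b \<in> poly_comp 1 \<and> mvar i * a + L * L * b \<in> ann" by blast
  then obtain b where b: "\<And>i. b i \<in> poly_comp 1" "\<And>i. mvar i * a + L * L * b i \<in> ann"
    unfolding choice_iff by blast
  \<comment> \<open>Third order. The coefficient 2 comes from \<open>u\<^sup>2\<close>; for \<open>i\<close>, \<open>j\<close> and \<open>j\<close>, \<open>i\<close> the two relations form a system of determinant 3.\<close>
  have third: "\<exists>k. smult 2 (?\<rho> (mvar j) * ?\<rho> (b i)) + ?\<rho> (mvar i) * ?\<rho> (b j) = smult k (?\<rho> a)" for i j
  proof -
    obtain x' y' where xy: "x' \<in> poly_comp 2" "y' \<in> poly_comp 1" "mvar j * a + L * x' \<in> ann"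
      "2 * L * mvar j * b i + mvar i * x' + L * L * y' \<in> ann"
      using lift3[OF mvar_in_poly_comp a(1) b(1) a(3) b(2), of j i] by blast
    have Lb: "L * b j \<in> poly_comp 2" using poly_comp_mult[OF L1 b(1), of j] by (simp add: numeral_2_eq_2)
    have "L * (x' - L * b j) = (mvar j * a + L * x') - (mvar j * a + L * L * b j)" by (simp add: algebra_simps)
    also have "\<dots> \<in> ann" by (intro ann_diff xy(3) b(2))
    finally have "L * (x' - L * b j) \<in> ann" .
    then obtain k where k: "x' - L * b j = mconst k * a" using ker[of "x' - L * b j"] xy(1) Lb by blast
    then have x': "x' = L * b j + mconst k * a" by (simp add: algebra_simps)
    define e where "e = 2 * mvar j * b i + mvar i * b j - mconst k * (L * b i) + L * y'"
    have e: "e \<in> poly_comp 2"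
    proof -
      have pr: "p * q \<in> poly_comp 2" if "p \<in> poly_comp 1" "q \<in> poly_comp 1" for p q :: "(3, 'k) mpoly"
        using poly_comp_mult[OF that] by (simp add: numeral_2_eq_2)
      have "mvar j * b i + mvar j * b i \<in> poly_comp 2" by (intro poly_comp_add pr mvar_in_poly_comp b(1))
      also have "mvar j * b i + mvar j * b i = 2 * mvar j * b i" by (simp add: algebra_simps)
      finally have f: "2 * mvar j * b i \<in> poly_comp 2" .
      show ?thesis unfolding e_def
        by (intro poly_comp_add poly_comp_diff poly_comp_scale f pr[OF mvar_in_poly_comp b(1)] pr[OF L1 b(1)] pr[OF L1 xy(2)])
    qed
    have "L * e = (2 * L * mvar j * b i + mvar i * x' + L * L * y') - mconst k * (mvar i * a + L * L * b i)"
      unfolding e_def x' by (simp add: algebra_simps)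
    also have "\<dots> \<in> ann" by (intro ann_diff xy(4) ann_mult'[OF b(2)])
    finally have "L * e \<in> ann" .
    then obtain k' where "e = mconst k' * a" using ker[OF e] by blast
    then have "?\<rho> e = smult k' (?\<rho> a)" by simp
    moreover have "?\<rho> e = smult 2 (?\<rho> (mvar j) * ?\<rho> (b i)) + ?\<rho> (mvar i) * ?\<rho> (b j)"
    proof -
      have "?\<rho> e = ?\<rho> (mconst 2 * (mvar j * b i)) + ?\<rho> (mvar i * b j)"
        unfolding e_def using \<rho>L by (simp add: mconst_2 mult.assoc)
      then show ?thesis by simp
    qed
    ultimately show ?thesis by metis
  qed
  have prod: "\<exists>k. ?\<rho> (mvar j) * ?\<rho> (b i) = smult k (?\<rho> a)" for i j
  proof -
    obtain k k' where k: "smult 2 (?\<rho> (mvar j) * ?\<rho> (b i)) + ?\<rho> (mvar i) * ?\<rho> (b j) = smult k (?\<rho> a)"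
      "smult 2 (?\<rho> (mvar i) * ?\<rho> (b j)) + ?\<rho> (mvar j) * ?\<rho> (b i) = smult k' (?\<rho> a)" using third by metis
    have "smult 3 (?\<rho> (mvar j) * ?\<rho> (b i)) = smult 2 (smult 2 (?\<rho> (mvar j) * ?\<rho> (b i)) + ?\<rho> (mvar i) * ?\<rho> (b j))
        - (smult 2 (?\<rho> (mvar i) * ?\<rho> (b j)) + ?\<rho> (mvar j) * ?\<rho> (b i))"
      by (rule smult_combination)
    also have "\<dots> = smult (2 * k - k') (?\<rho> a)" unfolding k by (simp add: smult_diff_left)
    finally show ?thesis using smult_3_cancel by blast
  qed
  have prodl: "\<exists>k. ?\<rho> s * ?\<rho> (b i) = smult k (?\<rho> a)" if s: "s \<in> poly_comp 1" for s i
  proof -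
    obtain w where w: "s = lin w" using poly_comp_1_lin[OF s] by blast
    have "\<forall>j. \<exists>k. ?\<rho> (mvar j) * ?\<rho> (b i) = smult k (?\<rho> a)" using prod by blast
    then obtain k where k: "\<And>j. ?\<rho> (mvar j) * ?\<rho> (b i) = smult (k j) (?\<rho> a)" unfolding choice_iff by blast
    have "?\<rho> s * ?\<rho> (b i) = (\<Sum>j\<in>UNIV. smult (w j) (?\<rho> (mvar j) * ?\<rho> (b i)))"
      by (simp add: w lin_def on_line_sum sum_distrib_right del: on_line_simps(4))
    also have "\<dots> = smult (\<Sum>j\<in>UNIV. w j * k j) (?\<rho> a)"
      unfolding k by (simp add: smult_sum)
    finally show ?thesis by blast
  qed
  have "?\<rho> (b i) = 0" for i
  proof -
    obtain s where s: "s \<in> poly_comp 1" "?\<rho> s = 1" using chart_lift[OF chart, of 1 1] by auto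
    obtain t where t: "t \<in> poly_comp 1" "?\<rho> t = [:0, 1:]" using chart_lift[OF chart, of "[:0, 1:]" 1] by auto
    obtain k where k: "?\<rho> (b i) = smult k (?\<rho> a)" using prodl[OF s(1), of i] s(2) by auto
    obtain k' where "[:0, 1:] * ?\<rho> (b i) = smult k' (?\<rho> a)" using prodl[OF t(1), of i] t(2) by auto
    then have "k = 0" unfolding k using \<rho>a by (rule shifted_multiple)
    then show ?thesis using k by simp
  qed
  then have "\<exists>k. b i = mconst k * L" for i
    using multiple_of_lin[OF good chart am b(1)] by (auto simp: L_def)
  then have "\<forall>i. \<exists>k. b i = mconst k * L" by blast
  then obtain \<tau> where \<tau>: "\<And>i. b i = mconst (\<tau> i) * L" unfolding choice_iff by blast
  obtain v where v: "cross u v \<noteq> (\<lambda>_. 0)" "dot \<tau> v = 0"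
    using ex_second_zero[OF good_nonzero[OF good], of "dot \<tau>"] by (auto simp: dot3 algebra_simps)
  have "lin v * a = (\<Sum>i\<in>UNIV. mconst (v i) * (mvar i * a + L * L * b i)) - mconst (dot \<tau> v) * (L * L * L)"
    unfolding \<tau> lin_def sum3 dot3 by (simp add: mconst_add mconst_mult algebra_simps)
  also have "\<dots> \<in> ann" unfolding v(2) sum3 by (auto intro!: ann_add ann_mult' b(2))
  finally show False using good_killers[OF good am] v(1) by blast
qed

section \<open>Repeated division by a generic linear form\<close>

text \<open>
  Up to degree \<open>m\<close>, the annihilator of \<open>a\<close> is the ideal generated by \<open>u\<close>, \<open>q\<close> and \<open>ann\<close>. The
  disjunction accounts for degree one, which contains no multiples of \<open>q\<close>.
\<close>

definition annihilator_generated :: "(3, 'k) mpoly \<Rightarrow> (3 \<Rightarrow> 'k) \<Rightarrow> (3, 'k) mpoly \<Rightarrow> bool" where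
  "annihilator_generated q u a \<longleftrightarrow>
    (\<forall>j b. 1 \<le> j \<longrightarrow> j \<le> m \<longrightarrow> b \<in> poly_comp j \<longrightarrow> b * a \<in> ann \<longrightarrow>
       (\<exists>r\<in>poly_comp (j - 1). \<exists>s. b - (lin u * r + q * s) \<in> ann \<and> (s = 0 \<or> j \<ge> 2 \<and> s \<in> poly_comp (j - 2))))"

text \<open>
  Let \<open>q\<close> be a conic killed by two linear forms \<open>l1\<close>, \<open>l2\<close>, and let \<open>u\<close> complete them to a basis, so that
  multiples of \<open>q\<close> are multiples of \<open>q u\<^sup>n\<close>. The claim is that \<open>a = \<gamma> q u\<^sup>m\<^sup>-\<^sup>2 + u\<^sup>k b\<close> for all \<open>k\<close> up to
  \<open>m\<close>. It is passed from \<open>k\<close> to \<open>k + 1\<close> if \<open>b a = 0\<close>, since then \<open>b = u r + q s\<close>. Now \<open>u a = 0\<close> is the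
  syzygy \<open>\<gamma> q u\<^sup>m\<^sup>-\<^sup>1 + u\<^sup>k\<^sup>+\<^sup>1 b = 0\<close>; its derivative in the direction \<open>v\<close>, multiplied by \<open>b\<close>, gives
  \<open>(k + 1) v b a + q s = 0\<close> for \<open>v\<close> among \<open>l1\<close>, \<open>l2\<close>. Multiplied by \<open>u\<^sup>k\<close> this shows \<open>q s = 0\<close>, so \<open>b a\<close>
  is killed by \<open>l1\<close>, \<open>l2\<close> and \<open>u\<close> and must be zero. At \<open>k = m\<close>, \<open>a\<close> is a combination of \<open>q u\<^sup>m\<^sup>-\<^sup>2\<close> and
  \<open>u\<^sup>m\<close>; the class \<open>c\<close>, which \<open>q\<close> kills, detects the coefficient of \<open>u\<^sup>m\<close> in \<open>u a = 0\<close>, and so both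
  coefficients are zero.
\<close>

lemma iterated_division:
  assumes q: "q \<in> poly_comp 2" and c: "c \<in> poly_comp m" "c \<notin> ann" "c * q \<in> ann"
  shows "\<exists>G. generic_linear G \<and> (\<forall>u l1 l2 a. lin u \<in> G \<longrightarrow> det3 l1 l2 u \<noteq> 0 \<longrightarrow> lin l1 * q \<in> ann \<longrightarrow> lin l2 * q \<in> ann \<longrightarrow>
    (q = 0 \<or> \<phi> (q * lin u ^ (2 * m - 1)) \<noteq> 0) \<longrightarrow> a \<in> poly_comp m \<longrightarrow> lin u * a \<in> ann \<longrightarrow>
    annihilator_generated q u a \<longrightarrow>
    a \<in> ann)"
proof -
  obtain G1 where G1: "generic_linear G1" "\<forall>u\<in>poly_comp 1. \<forall>v\<in>poly_comp 1. \<forall>x\<in>poly_comp m. u \<in> G1 \<longrightarrow> u * x \<in> ann \<longrightarrow>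
     x * x \<in> ann \<and> (\<exists>x'\<in>poly_comp m. v * x + u * x' \<in> ann)" using generic_square_zero by blast
  have "\<forall>k. \<exists>G. generic_linear G \<and> (\<forall>u\<in>poly_comp 1. \<forall>v\<in>poly_comp 1. \<forall>x\<in>poly_comp 0. \<forall>y\<in>poly_comp (m - k). u \<in> G \<longrightarrow>
     q * u ^ (m - 1) * x + u ^ (k + 1) * y \<in> ann \<longrightarrow> (\<exists>x'\<in>poly_comp 0. \<exists>y'\<in>poly_comp (m - k).
       q * (of_nat (m - 1) * u ^ (m - 1 - 1) * v) * x + of_nat (k + 1) * u ^ (k + 1 - 1) * v * y
       + q * u ^ (m - 1) * x' + u ^ (k + 1) * y' \<in> ann))"
    using lift_sum[OF polymap_mult_power polymap_power] by blast
  then obtain Gq where Gq: "\<And>k. generic_linear (Gq k)" "\<And>k. \<forall>u\<in>poly_comp 1. \<forall>v\<in>poly_comp 1. \<forall>x\<in>poly_comp 0. \<forall>y\<in>poly_comp (m - k). u \<in> Gq k \<longrightarrow>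
     q * u ^ (m - 1) * x + u ^ (k + 1) * y \<in> ann \<longrightarrow> (\<exists>x'\<in>poly_comp 0. \<exists>y'\<in>poly_comp (m - k).
       q * (of_nat (m - 1) * u ^ (m - 1 - 1) * v) * x + of_nat (k + 1) * u ^ (k + 1 - 1) * v * y
       + q * u ^ (m - 1) * x' + u ^ (k + 1) * y' \<in> ann)"
    unfolding choice_iff by blast
  define G where "G = (G1 \<inter> (\<Inter>k\<in>{..<m}. Gq k)) \<inter> {u. \<phi> (u ^ (m + 1) * c) \<noteq> 0}"
  have G: "generic_linear G" unfolding G_def
    by (intro generic_linear_Int generic_linear_INT G1 Gq generic_power_notin c) auto
  moreover have "a \<in> ann"
    if u: "lin u \<in> G" and det: "det3 l1 l2 u \<noteq> 0" and l: "lin l1 * q \<in> ann" "lin l2 * q \<in> ann"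
      and qu: "q = 0 \<or> \<phi> (q * lin u ^ (2 * m - 1)) \<noteq> 0" and a: "a \<in> poly_comp m" "lin u * a \<in> ann"
      and kill: "annihilator_generated q u a"
    for u l1 l2 a
  proof -
    define L where "L = lin u"
    have L1: "L \<in> poly_comp 1" by (simp add: L_def)
    have La: "L * a \<in> ann" using a(2) by (simp add: L_def)
    have qs: "\<exists>k. q * s - mconst k * (q * L ^ n) \<in> ann" if s: "s \<in> poly_comp n" for s n
    proof -
      obtain r r' k where "s = lin l1 * r + lin l2 * r' + mconst k * lin u ^ n"
        using form_mod_two_linear_forms[OF det s] by blast
      then have eq: "q * s - mconst k * (q * L ^ n) = (lin l1 * q) * r + (lin l2 * q) * r'" by (simp add: L_def algebra_simps)
      have "q * s - mconst k * (q * L ^ n) \<in> ann" unfolding eq by (intro ann_add ann_mult l)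
      then show ?thesis by blast
    qed
    have qL: "k = 0 \<or> q = 0" if "mconst k * (q * L ^ n) \<in> ann" "n \<le> 2 * m - 1" for k n
    proof -
      have "mconst k * (q * L ^ n) * L ^ (2 * m - 1 - n) = mconst k * (q * L ^ (2 * m - 1))"
        unfolding mult.assoc power_add[symmetric] le_add_diff_inverse[OF that(2)] ..
      then have "\<phi> (mconst k * (q * L ^ (2 * m - 1))) = 0" using phi_ann[OF ann_mult[OF that(1)]] by metis
      then show ?thesis using qu by (auto simp: phi L_def)
    qed
    \<comment> \<open>A multiple of \<open>q\<close> in the cofactor of \<open>u\<^sup>k\<close> is absorbed into the term \<open>q u\<^sup>m\<^sup>-\<^sup>2\<close>.\<close>
    have absorb: "\<exists>\<gamma>. \<exists>b'\<in>poly_comp (m - Suc k). a - (mconst \<gamma> * (q * L ^ (m - 2)) + L ^ Suc k * b') \<in> ann"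
      if k: "k < m" and b: "b \<in> poly_comp (m - k)" and ba: "b * a \<in> ann"
        and rep: "a - (mconst \<gamma> * (q * L ^ (m - 2)) + L ^ k * b) \<in> ann" for k \<gamma> b
    proof -
      obtain r s where rs: "r \<in> poly_comp (m - k - 1)" "b - (L * r + q * s) \<in> ann"
        "s = 0 \<or> m - k \<ge> 2 \<and> s \<in> poly_comp (m - k - 2)"
      proof -
        have kk: "1 \<le> m - k" "m - k \<le> m" using k by auto
        show thesis using kill[unfolded annihilator_generated_def, rule_format, OF kk b ba] that unfolding L_def by blast
      qed
      have "\<exists>\<kappa>. L ^ k * (q * s) - mconst \<kappa> * (q * L ^ (m - 2)) \<in> ann"
      proof (cases "s = 0")
        case True
        then show ?thesis by (intro exI[of _ 0]) simp
      next
        case False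
        with rs(3) have s: "m - k \<ge> 2" "s \<in> poly_comp (m - k - 2)" by auto
        obtain \<kappa> where \<kappa>: "q * s - mconst \<kappa> * (q * L ^ (m - k - 2)) \<in> ann" using qs[OF s(2)] by blast
        have "k + (m - k - 2) = m - 2" using s(1) by simp
        then have "L ^ (m - 2) = L ^ k * L ^ (m - k - 2)" by (metis power_add)
        then have "L ^ k * (q * s) - mconst \<kappa> * (q * L ^ (m - 2)) = L ^ k * (q * s - mconst \<kappa> * (q * L ^ (m - k - 2)))"
          by (simp add: algebra_simps)
        also have "\<dots> \<in> ann" by (rule ann_mult'[OF \<kappa>])
        finally show ?thesis by blast
      qed
      then obtain \<kappa> where \<kappa>: "L ^ k * (q * s) - mconst \<kappa> * (q * L ^ (m - 2)) \<in> ann" by blast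
      have "a - (mconst (\<gamma> + \<kappa>) * (q * L ^ (m - 2)) + L ^ Suc k * r) =
          (a - (mconst \<gamma> * (q * L ^ (m - 2)) + L ^ k * b)) + L ^ k * (b - (L * r + q * s))
          + (L ^ k * (q * s) - mconst \<kappa> * (q * L ^ (m - 2)))"
        by (simp add: algebra_simps mconst_add)
      also have "\<dots> \<in> ann" by (intro ann_add rep \<kappa> ann_mult'[OF rs(2)])
      finally show ?thesis using rs(1) by (intro exI[of _ "\<gamma> + \<kappa>"] bexI[of _ r]) auto
    qed
    have step: "\<exists>\<gamma>. \<exists>b\<in>poly_comp (m - k). a - (mconst \<gamma> * (q * L ^ (m - 2)) + L ^ k * b) \<in> ann"
      if "1 \<le> k" "k \<le> m" for k
      using that
    proof (induction k rule: dec_induct)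
      case base
      have "a * a \<in> ann" using G1(2) u a L1 unfolding G_def L_def by blast
      then show ?case using absorb[of 0 a 0] a(1) m_ge_2 by simp
    next
      case (step k)
      then obtain \<gamma> b where b: "b \<in> poly_comp (m - k)" and rep: "a - (mconst \<gamma> * (q * L ^ (m - 2)) + L ^ k * b) \<in> ann"
        by auto
      have km: "k < m" using step by simp
      have Lm: "L * L ^ (m - 2) = L ^ (m - 1)"
      using power_Suc[of L "m - 2"] m_ge_2 by (simp add: numeral_2_eq_2 Suc_diff_Suc)
      have syz: "q * L ^ (m - 1) * mconst \<gamma> + L ^ (k + 1) * b \<in> ann"
      proof -
        have "q * L ^ (m - 1) * mconst \<gamma> + L ^ (k + 1) * b = L * a - L * (a - (mconst \<gamma> * (q * L ^ (m - 2)) + L ^ k * b))"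
          unfolding Lm[symmetric] by (simp add: algebra_simps)
        also have "\<dots> \<in> ann" by (intro ann_diff La ann_mult'[OF rep])
        finally show ?thesis .
      qed
      have half: "lin v * (b * a) \<in> ann" if v: "lin v * q \<in> ann" for v
      proof -
        obtain x' y' where xy: "x' \<in> poly_comp 0" "y' \<in> poly_comp (m - k)"
          "q * (of_nat (m - 1) * L ^ (m - 1 - 1) * lin v) * mconst \<gamma> + of_nat (k + 1) * L ^ (k + 1 - 1) * lin v * b
             + q * L ^ (m - 1) * x' + L ^ (k + 1) * y' \<in> ann" (is "?e \<in> ann")
          using Gq(2)[of k, rule_format, OF L1 lin_in_poly_comp mconst_in_poly_comp b _ syz, of v] u km
          unfolding G_def L_def by blast
        define s where "s = L ^ (m - 1) * x' * b - mconst \<gamma> * (L ^ (m - 1) * y')"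
        have sdeg: "s \<in> poly_comp (2 * m - 1 - k)"
        proof -
          have "L ^ (m - 1) * x' * b \<in> poly_comp (m - 1 + 0 + (m - k))"
            by (intro poly_comp_mult poly_comp_power1 L1 xy b)
          moreover have "L ^ (m - 1) * y' \<in> poly_comp (m - 1 + (m - k))"
            by (intro poly_comp_mult poly_comp_power1 L1 xy)
          moreover have "m - 1 + 0 + (m - k) = 2 * m - 1 - k" "m - 1 + (m - k) = 2 * m - 1 - k" using km m_ge_2 by auto
          ultimately show ?thesis unfolding s_def by auto
        qed
        obtain \<kappa> where \<kappa>: "q * s - mconst \<kappa> * (q * L ^ (2 * m - 1 - k)) \<in> ann" using qs[OF sdeg] by blast
        \<comment> \<open>The derivative of the syzygy, multiplied by \<open>b\<close>: terms with \<open>v q\<close> vanish, and \<open>u\<^sup>k b\<close> is \<open>a\<close> up to a multiple of \<open>q\<close>.\<close>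
        have E: "of_nat (k + 1) * (lin v * (b * a)) + q * s =
            ?e * b - (q * lin v) * (of_nat (m - 1) * L ^ (m - 1 - 1) * mconst \<gamma> * b)
            - (q * L ^ (m - 1) * mconst \<gamma> + L ^ (k + 1) * b) * y'
            + of_nat (k + 1) * lin v * b * (a - (mconst \<gamma> * (q * L ^ (m - 2)) + L ^ k * b))
            + of_nat (k + 1) * b * mconst \<gamma> * L ^ (m - 2) * (q * lin v)"
          unfolding s_def by (simp add: algebra_simps)
        have qv: "q * lin v \<in> ann" using v by (simp add: mult.commute)
        have e1: "of_nat (k + 1) * (lin v * (b * a)) + q * s \<in> ann"
          unfolding E by (intro ann_add ann_diff ann_mult[OF xy(3)] ann_mult[OF syz] ann_mult[OF qv] ann_mult'[OF rep] ann_mult'[OF qv])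
        have e2: "of_nat (k + 1) * (lin v * (b * a)) + mconst \<kappa> * (q * L ^ (2 * m - 1 - k)) \<in> ann"
        proof -
          have "of_nat (k + 1) * (lin v * (b * a)) + mconst \<kappa> * (q * L ^ (2 * m - 1 - k)) =
            (of_nat (k + 1) * (lin v * (b * a)) + q * s) - (q * s - mconst \<kappa> * (q * L ^ (2 * m - 1 - k)))" by simp
          also have "\<dots> \<in> ann" by (rule ann_diff[OF e1 \<kappa>])
          finally show ?thesis .
        qed
        have "mconst \<kappa> * (q * L ^ (2 * m - 1)) \<in> ann"
        proof -
          have p1: "L ^ (2 * m - 1) = L ^ k * L ^ (2 * m - 1 - k)"
          proof -
            have "k + (2 * m - 1 - k) = 2 * m - 1" using km by simp
            then show ?thesis by (metis power_add)
          qed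
          have p2: "L ^ k = L ^ (k - 1) * L" using step(1) power_Suc2[of L "k - 1"] by simp
          have "mconst \<kappa> * (q * L ^ (2 * m - 1)) =
              L ^ k * (of_nat (k + 1) * (lin v * (b * a)) + mconst \<kappa> * (q * L ^ (2 * m - 1 - k)))
              - L ^ (k - 1) * of_nat (k + 1) * lin v * b * (L * a)"
            unfolding p1 by (simp add: p2 algebra_simps)
          also have "\<dots> \<in> ann" by (intro ann_diff ann_mult'[OF e2] ann_mult'[OF La])
          finally show ?thesis .
        qed
        then have "\<kappa> = 0 \<or> q = 0" by (rule qL) simp
        then have z: "mconst \<kappa> * (q * L ^ (2 * m - 1 - k)) = 0" by auto
        have "mconst (of_nat (k + 1)) * (lin v * (b * a)) \<in> ann"
          using e2 unfolding z mconst_of_nat add_0_right .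
        then show ?thesis by (rule ann_cancel) (metis of_nat_eq_0_iff add_is_0 one_neq_zero)
      qed
      have "b * a \<in> ann"
      proof (rule ann_if_basis[OF poly_comp_mult[OF b a(1)] _ det half[OF l(1)] half[OF l(2)]])
        show "lin u * (b * a) \<in> ann" using ann_mult'[OF a(2), of b] by (simp add: mult_ac)
      qed simp
      from absorb[OF km b this rep] show ?case .
    qed
    obtain \<gamma> b where b: "b \<in> poly_comp 0" and rep: "a - (mconst \<gamma> * (q * L ^ (m - 2)) + L ^ m * b) \<in> ann"
      using step[of m] m_ge_2 by auto
    obtain \<beta> where \<beta>: "b = mconst \<beta>" using poly_comp_0_const[OF b] by blast
    have Lm: "L * L ^ (m - 2) = L ^ (m - 1)"
      using power_Suc[of L "m - 2"] m_ge_2 by (simp add: numeral_2_eq_2 Suc_diff_Suc)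
    have fin: "mconst \<gamma> * (q * L ^ (m - 1)) + mconst \<beta> * L ^ (m + 1) \<in> ann"
    proof -
      have "mconst \<gamma> * (q * L ^ (m - 1)) + mconst \<beta> * L ^ (m + 1) = L * a - L * (a - (mconst \<gamma> * (q * L ^ (m - 2)) + L ^ m * b))"
        unfolding Lm[symmetric] \<beta> by (simp add: algebra_simps)
      also have "\<dots> \<in> ann" by (intro ann_diff La ann_mult'[OF rep])
      finally show ?thesis .
    qed
    have "\<beta> = 0"
    proof -
      have "mconst \<beta> * (L ^ (m + 1) * c) = (mconst \<gamma> * (q * L ^ (m - 1)) + mconst \<beta> * L ^ (m + 1)) * c - mconst \<gamma> * L ^ (m - 1) * (c * q)"
        by (simp add: algebra_simps)
      also have "\<dots> \<in> ann" by (intro ann_diff ann_mult[OF fin] ann_mult'[OF c(3)])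
      finally have "\<phi> (mconst \<beta> * (L ^ (m + 1) * c)) = 0" by (rule phi_ann)
      then show ?thesis using u by (simp add: phi G_def L_def)
    qed
    with fin have "mconst \<gamma> * (q * L ^ (m - 1)) \<in> ann" by simp
    then have "\<gamma> = 0 \<or> q = 0" by (rule qL) arith
    then have "mconst \<gamma> * (q * L ^ (m - 2)) = 0" by auto
    with rep \<open>\<beta> = 0\<close> \<beta> show "a \<in> ann" by simp
  qed
  ultimately show ?thesis by blast
qed

end

text \<open>
  Choose a line \<open>a\<close> on which \<open>q\<close> has finitely many zeros. If \<open>u\<close> divides \<open>q\<close>, the intersection of \<open>u\<close>
  with this line is one of them, which a generic \<open>u\<close> avoids.
\<close>

lemma generic_not_dividing:
  fixes q :: "(3, 'k::field_char_0) mpoly"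
  assumes q: "q \<in> poly_comp n" "q \<noteq> 0"
  shows "\<exists>G. generic_linear G \<and> (\<forall>u. lin u \<in> G \<longrightarrow> (\<nexists>r. q = lin u * r))"
proof (cases "n = 0")
  case True
  then obtain c where c: "q = mconst c" using poly_comp_0_const q(1) by blast
  have "(\<nexists>r. q = lin u * r)" for u
  proof
    assume "\<exists>r. q = lin u * r"
    then obtain r where r: "q = lin u * r" by blast
    obtain y where "y \<noteq> (\<lambda>_. 0)" "dot u y = 0" using ex_common_point[of u u] by blast
    then have "ev y q = 0" unfolding r by simp
    then show False using c q(2) by simp
  qed
  moreover have "generic_linear UNIV" unfolding MP.generic_def using poly_comp_0 by auto
  ultimately show ?thesis by blast
next
  case False
  obtain y0 where y0: "ev y0 q \<noteq> 0" using form_eq_0[OF infinite_UNIV_char_0 q(1)] q(2) by blast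
  have "y0 \<noteq> (\<lambda>_. 0)"
  proof
    assume "y0 = (\<lambda>_. 0)"
    then have "ev y0 q = 0" using ev_scale[OF q(1), of 0 y0] False by (simp add: power_0_left)
    with y0 show False by simp
  qed
  then obtain a b where ab: "cross a b = y0" using ex_cross_product by blast
  then have a: "a \<noteq> (\<lambda>_. 0)" "dot a y0 = 0" using \<open>y0 \<noteq> _\<close> cross_zero[of b] by auto
  let ?S = "{y. y \<noteq> (\<lambda>_. 0) \<and> dot a y = 0 \<and> ev y q = 0}"
  have "projectively_finite ?S"
  proof (rule ccontr)
    assume "\<not> projectively_finite ?S"
    then obtain r where r: "q = lin a * r" using line_divides[OF a(1) q(1)] by blast
    have "ev y0 q = 0" unfolding r using a(2) by simp
    with y0 show False by simp
  qed
  then obtain G where G: "generic_linear G" "\<And>u y. lin u \<in> G \<Longrightarrow> y \<in> ?S \<Longrightarrow> y \<noteq> (\<lambda>_. 0) \<Longrightarrow> dot u y \<noteq> 0"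
    using generic_linear_avoid_points by blast
  have "\<nexists>r. q = lin u * r" if "lin u \<in> G" for u
  proof
    assume "\<exists>r. q = lin u * r"
    then obtain r where r: "q = lin u * r" by blast
    obtain y where y: "y \<noteq> (\<lambda>_. 0)" "dot a y = 0" "dot u y = 0" using ex_common_point by blast
    have "ev y q = 0" unfolding r using y(3) by simp
    then show False using G(2)[OF that, of y] y by blast
  qed
  with G(1) show ?thesis by blast
qed

lemma (in fd_space) dim_le_2_combination:
  assumes T: "fin_dim T" "dim T \<le> 2" "x \<in> T" "y \<in> T" "w \<in> T"
    and ind: "\<And>a b. scale a x + scale b y = 0 \<Longrightarrow> a = 0 \<and> b = 0"
  shows "\<exists>a b. w = scale a x + scale b y"
proof (rule ccontr)
  assume not: "\<not> ?thesis"
  have x0: "x \<noteq> 0" using ind[of 1 0] by auto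
  have y: "y \<notin> span {x}"
  proof
    assume "y \<in> span {x}"
    then obtain k where "y = scale k x" by (auto simp: span_singleton)
    then have "scale (- k) x + scale 1 y = 0" by simp
    then show False using ind[of "- k" 1] by simp
  qed
  have w: "w \<notin> span {y, x}"
  proof
    assume "w \<in> span {y, x}"
    then obtain k where "w - scale k y \<in> span {x}" unfolding span_insert by blast
    then obtain j where "w - scale k y = scale j x" by (auto simp: span_singleton)
    then have "w = scale j x + scale k y" by (simp add: algebra_simps)
    with not show False by blast
  qed
  have "independent {w, y, x}"
    using x0 y w by (intro independent_insertI) (auto simp: independent_empty)
  then have "card {w, y, x} \<le> dim T" using independent_card_le[OF T(1), of "{w, y, x}"] T by simp
  moreover have "y \<noteq> x" "w \<noteq> y" "w \<noteq> x" using y w span_base[of x "{x}"] span_base[of _ "{y, x}"] by auto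
  ultimately show False using T(2) by simp
qed

definition no_linear_relation :: "(3, 'k::field) mpoly \<Rightarrow> (3, 'k) mpoly \<Rightarrow> bool" where
  "no_linear_relation g1 g2 \<longleftrightarrow> (\<forall>a b. lin a * g1 + lin b * g2 = 0 \<longrightarrow> a = (\<lambda>_. 0) \<and> b = (\<lambda>_. 0))"

text \<open>The multiples of the two forms by the three variables are independent.\<close>

lemma six_multiples:
  fixes g1 g2 :: "(3, 'k::field) mpoly"
  assumes rel: "no_linear_relation g1 g2" and U: "MP.fin_dim U" and mem: "\<And>i. mvar i * g1 \<in> U" "\<And>i. mvar i * g2 \<in> U"
  shows "6 \<le> MP.dim U"
proof (rule MP.indep_image_le_dim[OF U])
  define ys :: "nat \<Rightarrow> (3, 'k) mpoly" where
    "ys j = (if j = 0 then mvar 0 * g1 else if j = 1 then mvar 1 * g1 else if j = 2 then mvar 2 * g1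
      else if j = 3 then mvar 0 * g2 else if j = 4 then mvar 1 * g2 else mvar 2 * g2)" for j
  show "Poly_Mapping.lookup (x + y) i = Poly_Mapping.lookup x i + Poly_Mapping.lookup y i" for x y :: "(3, 'k) mpoly" and i
    by (simp add: lookup_add)
  show scale: "Poly_Mapping.lookup (mscale c x) i = c * Poly_Mapping.lookup x i" for c and x :: "(3, 'k) mpoly" and i
  proof -
    have "mscale c x = (\<Sum>t\<in>Poly_Mapping.keys x. Poly_Mapping.single t (c * Poly_Mapping.lookup x t))"
      by (subst sum_monomials[of x, symmetric]) (simp add: mscale_def mconst_def sum_distrib_left mult_single)
    then have "Poly_Mapping.lookup (mscale c x) i = (\<Sum>t\<in>Poly_Mapping.keys x. if t = i then c * Poly_Mapping.lookup x i else 0)"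
      by (simp add: lookup_sum lookup_single when_def cong: if_cong)
    also have "\<dots> = c * Poly_Mapping.lookup x i" by (auto simp: in_keys_iff)
    finally show ?thesis .
  qed
  show "ys j \<in> U" for j using mem by (simp add: ys_def)
  show "indep 6 (\<lambda>j. Poly_Mapping.lookup (ys j))"
    unfolding indep_def
  proof (intro allI impI)
    fix c j assume c: "\<forall>i. (\<Sum>j<6. c j * Poly_Mapping.lookup (ys j) i) = 0" and j: "j < (6 :: nat)"
    have "(\<Sum>j<6. mscale (c j) (ys j)) = 0"
      by (intro poly_mapping_eqI) (simp add: lookup_sum scale c)
    then have s: "mscale (c 0) (ys 0) + mscale (c 1) (ys 1) + mscale (c 2) (ys 2) + mscale (c 3) (ys 3) + mscale (c 4) (ys 4) + mscale (c 5) (ys 5) = 0"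
      by (simp add: eval_nat_numeral add.assoc)
    define a where "a = (\<lambda>i :: 3. if i = 0 then c 0 else if i = 1 then c 1 else c 2)"
    define b where "b = (\<lambda>i :: 3. if i = 0 then c 3 else if i = 1 then c 4 else c 5)"
    have "lin a * g1 + lin b * g2 = 0"
      using s by (simp add: lin_def sum3 a_def b_def ys_def mscale_def algebra_simps)
    then have "a = (\<lambda>_. 0)" "b = (\<lambda>_. 0)" using rel unfolding no_linear_relation_def by blast+
    then have z: "a 0 = 0" "a 1 = 0" "a 2 = 0" "b 0 = 0" "b 1 = 0" "b 2 = 0" by simp_all
    have "j = 0 \<or> j = 1 \<or> j = 2 \<or> j = 3 \<or> j = 4 \<or> j = 5" using j by linarith
    with z show "c j = 0" by (auto simp: a_def b_def)
  qed
qed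

lemma homogeneous_cofactor':
  assumes "q \<in> poly_comp k" "p \<in> poly_comp (k + n)" "p = q * r"
  shows "p = q * hcomp n r"
  using hcomp_mult[OF assms(1), of n r] hcomp_same[OF assms(2)] assms(3) by simp

text \<open>
  Nine of the ten points impose nine conditions on quartics, leaving dimension six, which is the
  dimension of the linear multiples of the two cubics. So every quartic through nine of the points
  passes through the tenth. Let \<open>q\<close> be a conic through five of the points. For each other point \<open>y\<close>,
  some conic \<open>p\<close> passes through the remaining four but not through \<open>y\<close>; as \<open>q p\<close> vanishes at nine points,
  \<open>q\<close> vanishes at \<open>y\<close>. So \<open>q\<close> passes through all ten points, and its multiples make up the whole
  space of quartics. Then \<open>q\<close> divides both cubics, and the linear cofactors give a linear relation.
\<close>

lemma ten_common_zeros: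
  fixes g1 g2 :: "(3, 'k::field_char_0) mpoly"
  assumes g: "g1 \<in> poly_comp 3" "g2 \<in> poly_comp 3" and rel: "no_linear_relation g1 g2"
    and T: "finite T" "card T = 10" "general_position T" "(\<lambda>_. 0) \<notin> T" and zero: "\<And>y. y \<in> T \<Longrightarrow> ev y g1 = 0 \<and> ev y g2 = 0"
  shows False
proof -
  let ?W = "\<lambda>S. {p \<in> poly_comp 4. \<forall>y\<in>S. ev y p = 0}"
  have sub: "MP.subspace (?W S)" for S by (auto simp: MP.subspace_def mscale_def)
  have fin: "MP.fin_dim (?W S)" for S by (rule MP.fin_dim_subset[OF fin_dim_poly_comp]) auto
  have mul: "mvar i * g \<in> poly_comp 4" if "g \<in> poly_comp 3" for i and g :: "(3, 'k) mpoly"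
    using poly_comp_mult[OF mvar_in_poly_comp that, of i] by simp
  have six: "6 \<le> MP.dim (?W T)"
    by (rule six_multiples[OF rel fin]) (use mul g zero in auto)
  have eq: "?W T = ?W (T - {y})" if "y \<in> T" for y
  proof (rule MP.subspace_eq_if_dim_le[OF fin _ sub])
    have "MP.dim (?W (T - {y})) + card (T - {y}) \<le> MP.dim (poly_comp 4 :: (3, 'k) mpoly set)"
      by (rule general_position_conditions) (use T that general_position_subset[OF T(3)] in auto)
    then show "MP.dim (?W (T - {y})) \<le> MP.dim (?W T)" using six T that dim_poly_comp_small(4)[where 'k = 'k] by simp
  qed auto
  obtain A where A: "A \<subseteq> T" "card A = 5" "finite A"
  proof -
    have "5 \<le> card T" using T(2) by simp
    from obtain_subset_with_card_n[OF this] show thesis using that by blast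
  qed
  obtain q where q: "q \<in> poly_comp 2" "q \<noteq> 0" "\<And>y. y \<in> A \<Longrightarrow> ev y q = 0"
    using MP.vanishing_on_few[OF A(3) fin_dim_poly_comp subspace_poly_comp, of ev 2] A(2) dim_poly_comp_small(2)[where 'k = 'k]
    by (auto simp: mscale_def)
  have qT: "ev y q = 0" if y: "y \<in> T" for y
  proof (cases "y \<in> A")
    case False
    have yT: "y \<in> T" "T - A - {y} \<subseteq> T" using y by auto
    have "card (T - A - {y}) = 4" using A T y False by (simp add: card_Diff_subset)
    then have "\<exists>p\<in>poly_comp 2. ev y p \<noteq> 0 \<and> (\<forall>b\<in>T - A - {y}. ev b p = 0)"
    proof (intro separating_form)
      show "finite (T - A - {y})" using T by simp
      show "y \<noteq> (\<lambda>_. 0)" using y T(4) by metis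
      show "cross y b \<noteq> (\<lambda>_. 0)" if "b \<in> T - A - {y}" for b using general_position_pair[OF T(3) y, of b] that by auto
      show "det3 y b c \<noteq> 0" if "b \<in> T - A - {y}" "c \<in> T - A - {y}" "b \<noteq> c" for b c
        using general_position_triple[OF T(3) y, of b c] that by auto
    qed simp
    then obtain p where p: "p \<in> poly_comp 2" "ev y p \<noteq> 0" "\<And>b. b \<in> T - A - {y} \<Longrightarrow> ev b p = 0" by blast
    have "q * p \<in> ?W (T - {y})" using poly_comp_mult[OF q(1) p(1)] q(3) p(3) by auto
    then have "q * p \<in> ?W T" using eq[OF y] by simp
    then have "ev y (q * p) = 0" using y by blast
    then show ?thesis using p(2) by simp
  qed (rule q(3))
  have "(*) q ` poly_comp 2 = ?W T"
  proof (rule MP.subspace_eq_if_dim_le[OF fin])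
    show "(*) q ` poly_comp 2 \<subseteq> ?W T" using poly_comp_mult[OF q(1), of _ 2] qT by auto
    show "MP.subspace ((*) q ` poly_comp 2)"
      unfolding MP.subspace_def
    proof (intro conjI ballI allI)
      show "0 \<in> (*) q ` poly_comp 2" by (intro image_eqI[of _ _ 0]) auto
      show "x + w \<in> (*) q ` poly_comp 2" if "x \<in> (*) q ` poly_comp 2" "w \<in> (*) q ` poly_comp 2" for x w
        using that by (auto simp flip: distrib_left)
      show "mscale c x \<in> (*) q ` poly_comp 2" if "x \<in> (*) q ` poly_comp 2" for c x
        using that by (auto simp: mscale_def mult.left_commute[of "mconst c" q])
    qed
    have "MP.dim ((*) q ` poly_comp 2) = MP.dim (poly_comp 2 :: (3, 'k) mpoly set)"
      by (rule MP.dim_image_inj[OF fin_dim_poly_comp subspace_poly_comp])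
         (use q(2) in \<open>auto simp: mscale_def algebra_simps\<close>)
    moreover obtain y where "y \<in> T" using T(2) by fastforce
    then have "MP.dim (?W T) + 9 \<le> 15"
      using general_position_conditions[of "T - {y}" 4] T general_position_subset[OF T(3)] eq[of y] dim_poly_comp_small(4)[where 'k = 'k]
      by auto
    ultimately show "MP.dim (?W T) \<le> MP.dim ((*) q ` poly_comp 2)" using dim_poly_comp_small(2)[where 'k = 'k] by simp
  qed
  then have mult: "\<exists>s. mvar i * g = q * s" if "g \<in> poly_comp 3" "\<And>y. y \<in> T \<Longrightarrow> ev y g = 0" for i g
    using mul[OF that(1), of i] that(2) by force
  have fac: "\<exists>s\<in>poly_comp 1. g = q * s" if gg: "g \<in> poly_comp 3" "\<And>y. y \<in> T \<Longrightarrow> ev y g = 0" for g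
  proof -
    obtain s0 s1 where s: "mvar 0 * g = q * s0" "mvar 1 * g = q * s1" using mult[OF gg] by metis
    have s0: "mvar 0 * g = q * hcomp 2 s0"
      using homogeneous_cofactor'[OF q(1) _ s(1), of 2] poly_comp_mult[OF mvar_in_poly_comp gg(1), of 0] by simp
    have "q * (mvar 1 * hcomp 2 s0) = q * (mvar 0 * s1)"
      using s0 s(2) by (metis (no_types, lifting) mult.left_commute)
    then have e: "mvar 1 * hcomp 2 s0 = mvar 0 * s1" using q(2) by simp
    define u :: "3 \<Rightarrow> 'k" where "u = (\<lambda>i. if i = 0 then 1 else 0)"
    have mu: "mvar 0 = lin u" by (simp add: mvar_eq_lin u_def)
    have u0: "u \<noteq> (\<lambda>_. 0)" by (auto simp: u_def fun_eq_iff)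
    obtain y z where yz: "chart u y z" using ex_chart[OF u0] by blast
    have "on_line y z (mvar 1) \<noteq> 0"
    proof
      assume "on_line y z (mvar 1) = 0"
      then obtain r where r: "mvar 1 = lin u * r" using chart_kernel[OF yz mvar_in_poly_comp] by blast
      have "ev (\<lambda>i. if i = 1 then 1 else 0) (mvar 1 :: (3, 'k) mpoly) = 0"
        unfolding r by (simp add: dot3 u_def)
      then show False by simp
    qed
    moreover have "on_line y z (mvar 1) * on_line y z (hcomp 2 s0) = 0"
      using arg_cong[OF e, of "on_line y z"] chart_lin[OF yz] unfolding mu by (simp del: on_line_simps(4))
    ultimately have "on_line y z (hcomp 2 s0) = 0" unfolding mult_eq_0_iff by blast
    then obtain r where "hcomp 2 s0 = lin u * r" using chart_kernel[OF yz hcomp_in_poly_comp] by blast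
    then have "mvar 0 * g = mvar 0 * (q * r)" using s0 unfolding mu by (simp add: mult_ac)
    moreover have "lin u \<noteq> 0" using u0 by simp
    ultimately have "g = q * r" unfolding mu by simp
    then show ?thesis using homogeneous_cofactor'[OF q(1), of g 1 r] gg(1) by auto
  qed
  obtain s where s: "s \<in> poly_comp 1" "g1 = q * s" using fac[OF g(1)] zero by blast
  obtain s' where s': "s' \<in> poly_comp 1" "g2 = q * s'" using fac[OF g(2)] zero by blast
  obtain a b where ab: "s = lin a" "s' = lin b" using poly_comp_1_lin s s' by metis
  have "lin (\<lambda>i. (- 1) * b i) * g1 + lin a * g2 = 0"
    unfolding lin_scale s(2) s'(2) ab by (simp add: mconst_uminus algebra_simps)
  then have "a = (\<lambda>_. 0)" using rel unfolding no_linear_relation_def by blast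
  then have "g1 = 0" using s(2) ab by simp
  then have "lin (\<lambda>_. 1) * g1 + lin (\<lambda>_. 0) * g2 = 0" by (simp add: lin_def)
  then have "(\<lambda>_ :: 3. 1 :: 'k) = (\<lambda>_. 0)" using rel unfolding no_linear_relation_def by blast
  then show False by (metis zero_neq_one)
qed

text \<open>
  A zero of the common factor \<open>t\<close> is a common zero. If \<open>t\<close> is constant, the restrictions have degree
  smaller than \<open>n\<close>, so both forms vanish at the point at infinity.
\<close>

lemma common_zero_on_line:
  fixes f1 f2 :: "(3, 'k::{field_char_0, alg_closed_field}) mpoly"
  assumes chart: "chart u y z" and f: "f1 \<in> poly_comp n" "f2 \<in> poly_comp n" "n \<ge> 2"
    and t: "on_line y z f1 = t * e1" "on_line y z f2 = t * e2" "degree e1 \<le> 1" "degree e2 \<le> 1"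
  shows "\<exists>w. w \<noteq> (\<lambda>_. 0) \<and> dot u w = 0 \<and> ev w f1 = 0 \<and> ev w f2 = 0"
proof (cases "degree t = 0")
  case True
  have "ev z f = 0" if "f \<in> poly_comp n" "on_line y z f = t * e" "degree e \<le> 1" for f e
  proof -
    have "degree (on_line y z f) \<le> degree t + degree e" unfolding that(2) by (rule degree_mult_le)
    then have "degree (on_line y z f) < n" using True that(3) f(3) by simp
    then have "coeff (on_line y z f) n = 0" by (rule coeff_eq_0)
    then show ?thesis using form_on_line(2)[OF that(1)] by simp
  qed
  then show ?thesis using chart_nonzero(1)[OF chart] chart_dot(2)[OF chart] f t by blast
next
  case False
  then obtain x where x: "poly t x = 0" using alg_closed_imp_poly_has_root[of t] by blast
  let ?w = "\<lambda>i. y i + x * z i"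
  have "ev ?w f1 = 0" "ev ?w f2 = 0"
    using form_on_line(3)[OF f(1), of y z x] form_on_line(3)[OF f(2), of y z x] x t by simp_all
  moreover have "dot u ?w = dot u y + x * dot u z" by (simp add: dot3 algebra_simps)
  then have "dot u ?w = 0" using chart_dot[OF chart] by simp
  ultimately show ?thesis using chart_nonzero(2)[OF chart, of x] by blast
qed

text \<open>
  The restrictions of the two forms to the line are independent and are not both linear multiples
  of one polynomial.
\<close>

definition transversal :: "(3, 'k::field) mpoly \<Rightarrow> (3, 'k) mpoly \<Rightarrow> (3 \<Rightarrow> 'k) \<Rightarrow> (3 \<Rightarrow> 'k) \<Rightarrow> bool" where
  "transversal g1 g2 y z \<longleftrightarrow> (\<forall>a b. smult a (on_line y z g1) + smult b (on_line y z g2) = 0 \<longrightarrow> a = 0 \<and> b = 0) \<and>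
     (\<forall>t e1 e2. on_line y z g1 = t * e1 \<longrightarrow> on_line y z g2 = t * e2 \<longrightarrow> degree e1 \<le> 1 \<longrightarrow> degree e2 \<le> 1 \<longrightarrow> False)"

text \<open>
  If \<open>f1\<close> and \<open>f2\<close> have finitely many common zeros, a generic line misses all of them. A common
  linear factor \<open>l\<close> does no harm: solving the two equations for \<open>t\<close> shows that \<open>l\<close> divides \<open>t\<close>.
\<close>

lemma generic_transversal_step:
  fixes f1 f2 :: "(3, 'k::{field_char_0, alg_closed_field}) mpoly"
  assumes f: "f1 \<in> poly_comp n" "f2 \<in> poly_comp n" "n \<ge> 2"
    and fin: "projectively_finite {y. y \<noteq> (\<lambda>_. 0) \<and> ev y f1 = 0 \<and> ev y f2 = 0}" and l: "l \<in> poly_comp k" "l \<noteq> 0"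
  shows "\<exists>G. generic_linear G \<and> (\<forall>u y z. lin u \<in> G \<longrightarrow> chart u y z \<longrightarrow> transversal (l * f1) (l * f2) y z)"
proof -
  let ?S = "{y. y \<noteq> (\<lambda>_. 0) \<and> ev y f1 = 0 \<and> ev y f2 = 0}"
  obtain G where G: "generic_linear G" "\<And>u y. lin u \<in> G \<Longrightarrow> y \<in> ?S \<Longrightarrow> y \<noteq> (\<lambda>_. 0) \<Longrightarrow> dot u y \<noteq> 0"
    using generic_linear_avoid_points[OF fin] by blast
  obtain H where H: "generic_linear H" "\<And>u. lin u \<in> H \<Longrightarrow> \<nexists>r. l = lin u * r" using generic_not_dividing[OF l] by blast
  have "transversal (l * f1) (l * f2) y z" if u: "lin u \<in> G \<inter> H" and chart: "chart u y z" for u y z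
  proof -
    have nozero: False if te: "on_line y z f1 = t * e1" "on_line y z f2 = t * e2" "degree e1 \<le> 1" "degree e2 \<le> 1" for t e1 e2
    proof -
      obtain w where "w \<noteq> (\<lambda>_. 0)" "dot u w = 0" "ev w f1 = 0" "ev w f2 = 0"
        using common_zero_on_line[OF chart f te] by blast
      then show False using G(2)[of u w] u by blast
    qed
    have l0: "on_line y z l \<noteq> 0" using H(2)[of u] u chart_kernel[OF chart l(1)] by blast
    have ind: "a = 0 \<and> b = 0" if "smult a (on_line y z (l * f1)) + smult b (on_line y z (l * f2)) = 0" for a b
    proof -
      have "on_line y z l * (smult a (on_line y z f1) + smult b (on_line y z f2)) = 0"
        using that by (simp add: distrib_left)
      then have s: "smult a (on_line y z f1) + smult b (on_line y z f2) = 0" using l0 by simp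
      show ?thesis
      proof (rule ccontr)
        assume "\<not> ?thesis"
        then consider "a \<noteq> 0" | "b \<noteq> 0" by blast
        then show False
        proof cases
          case 1
          have "smult a (on_line y z f1) = smult (- b) (on_line y z f2)" using s by (simp add: add_eq_0_iff2)
          then have "smult (1 / a) (smult a (on_line y z f1)) = smult (1 / a) (smult (- b) (on_line y z f2))" by simp
          then have "on_line y z f1 = on_line y z f2 * [:- b / a:]" using 1 by simp
          then show False using nozero[of "on_line y z f2" "[:- b / a:]" 1] by simp
        next
          case 2
          have "smult b (on_line y z f2) = smult (- a) (on_line y z f1)" using s by (simp add: add_eq_0_iff)
          then have "smult (1 / b) (smult b (on_line y z f2)) = smult (1 / b) (smult (- a) (on_line y z f1))" by simp
          then have "on_line y z f2 = on_line y z f1 * [:- a / b:]" using 2 by simp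
          then show False using nozero[of "on_line y z f1" 1 "[:- a / b:]"] by simp
        qed
      qed
    qed
    moreover have False
      if t: "on_line y z (l * f1) = t * e1" "on_line y z (l * f2) = t * e2" and e: "degree e1 \<le> 1" "degree e2 \<le> 1" for t e1 e2
    proof -
      define a b c d where "a = coeff e1 0" and "b = coeff e1 1" and "c = coeff e2 0" and "d = coeff e2 1"
      have e12: "e1 = [:a, b:]" "e2 = [:c, d:]" unfolding a_def b_def c_def d_def
        using e by (auto intro!: poly_eqI simp: coeff_pCons coeff_eq_0 split: nat.splits)
      \<comment> \<open>Cramer's rule for the two equations.\<close>
      define D where "D = a * d - b * c"
      have tD: "smult D t = on_line y z l * (smult d (on_line y z f1) - smult b (on_line y z f2))"
      proof -
        have "smult D t = t * (smult d [:a, b:] - smult b [:c, d:])"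
          by (simp add: D_def algebra_simps)
        also have "\<dots> = smult d (t * e1) - smult b (t * e2)" by (simp add: e12 algebra_simps)
        also have "\<dots> = smult d (on_line y z (l * f1)) - smult b (on_line y z (l * f2))" by (simp only: t)
        finally show ?thesis by (simp add: algebra_simps)
      qed
      have "D \<noteq> 0"
      proof
        assume D: "D = 0"
        have r1: "smult d (on_line y z (l * f1)) + smult (- b) (on_line y z (l * f2)) = 0"
          using D tD by (simp add: algebra_simps)
        have "smult c (t * e1) + smult (- a) (t * e2) = t * [:0, - D:]"
          by (simp add: e12 D_def algebra_simps)
        then have r2: "smult c (on_line y z (l * f1)) + smult (- a) (on_line y z (l * f2)) = 0"
          using D by (simp add: t del: on_line_simps)
        have "a = 0" "b = 0" "c = 0" "d = 0" using ind[OF r1] ind[OF r2] by auto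
        then have "smult 1 (on_line y z (l * f1)) + smult 0 (on_line y z (l * f2)) = 0" unfolding t(1) e12 by simp
        with ind[of 1 0] show False by simp
      qed
      define w where "w = smult (1 / D) (smult d (on_line y z f1) - smult b (on_line y z f2))"
      have "t = smult (1 / D) (smult D t)" using \<open>D \<noteq> 0\<close> by simp
      then have tw: "t = on_line y z l * w" unfolding tD w_def by simp
      have "on_line y z f1 = w * e1" "on_line y z f2 = w * e2" using t tw l0 by (auto simp: mult.assoc)
      then show False using nozero e by blast
    qed
    ultimately show ?thesis unfolding transversal_def by blast
  qed
  moreover have "generic_linear (G \<inter> H)" using G(1) H(1) by (rule generic_linear_Int)
  ultimately show ?thesis by blast
qed

text \<open>
  If the cubics have infinitely many common zeros, there is a common line of zeros, as ten zeros in
  general position are excluded. Dividing by it leaves two conics; if these again had infinitely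
  many common zeros, either five of the zeros would be in general position and the conics would be
  proportional, or they would have a second common line and there would be a linear relation.
\<close>

lemma generic_transversal:
  fixes g1 g2 :: "(3, 'k::{field_char_0, alg_closed_field}) mpoly"
  assumes g: "g1 \<in> poly_comp 3" "g2 \<in> poly_comp 3" and rel: "no_linear_relation g1 g2"
  shows "\<exists>G. generic_linear G \<and> (\<forall>u y z. lin u \<in> G \<longrightarrow> chart u y z \<longrightarrow> transversal g1 g2 y z)"
proof -
  have ind: "a = 0 \<and> b = 0" if "mconst a * g1 + mconst b * g2 = 0" for a b
  proof -
    have "lin (\<lambda>i. a * (if i = 0 then 1 else 0)) * g1 + lin (\<lambda>i. b * (if i = 0 then 1 else 0)) * g2
        = mvar 0 * (mconst a * g1 + mconst b * g2)"
      unfolding lin_scale mvar_eq_lin by (simp add: algebra_simps)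
    also have "\<dots> = 0" using that by simp
    finally have "(\<lambda>i :: 3. a * (if i = 0 then 1 else 0)) = (\<lambda>_. 0)" "(\<lambda>i :: 3. b * (if i = 0 then 1 else 0)) = (\<lambda>_. 0)"
      using rel unfolding no_linear_relation_def by blast+
    from fun_cong[OF this(1), of 0] fun_cong[OF this(2), of 0] show ?thesis by simp
  qed
  let ?Z = "\<lambda>f1 f2. {y. y \<noteq> (\<lambda>_. 0) \<and> ev y f1 = 0 \<and> ev y f2 = (0 :: 'k)}"
  show ?thesis
  proof (cases "projectively_finite (?Z g1 g2)")
    case True
    from generic_transversal_step[OF g _ this mconst_in_poly_comp[of 1]] show ?thesis by simp
  next
    case inf: False
    have "\<exists>u. u \<noteq> (\<lambda>_. 0) \<and> \<not> projectively_finite {y \<in> ?Z g1 g2. dot u y = 0}"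
    proof (rule ccontr)
      assume "\<not> ?thesis"
      then have "\<exists>T. T \<subseteq> ?Z g1 g2 \<and> general_position T \<and> finite T \<and> card T = 10"
        by (intro finite_or_general_position[OF _ _ inf]) auto
      then obtain T where T: "T \<subseteq> ?Z g1 g2" "general_position T" "finite T" "card T = 10" by blast
      show False by (rule ten_common_zeros[OF g rel T(3,4,2)]) (use T(1) in auto)
    qed
    then obtain l where l: "l \<noteq> (\<lambda>_. 0)" "\<not> projectively_finite {y \<in> ?Z g1 g2. dot l y = 0}" by blast
    have div: "\<exists>f\<in>poly_comp 2. g = lin l * f" if "g = g1 \<or> g = g2" for g
    proof -
      have "g \<in> poly_comp 3" using that g by auto
      moreover have "{y \<in> ?Z g1 g2. dot l y = 0} \<subseteq> {y. y \<noteq> (\<lambda>_. 0) \<and> dot l y = 0 \<and> ev y g = 0}" using that by auto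
      ultimately obtain r where "g = lin l * r" using line_divides[OF l(1)] l(2) projectively_finite_subset by blast
      then have "g = lin l * hcomp 2 r"
        using homogeneous_cofactor[of g 2 "lin l" r] \<open>g \<in> poly_comp 3\<close> by (simp add: eval_nat_numeral)
      then show ?thesis by blast
    qed
    obtain f1 where f1: "f1 \<in> poly_comp 2" "g1 = lin l * f1" using div by blast
    obtain f2 where f2: "f2 \<in> poly_comp 2" "g2 = lin l * f2" using div by blast
    have "projectively_finite (?Z f1 f2)"
    proof (rule ccontr)
      assume inf': "\<not> projectively_finite (?Z f1 f2)"
      have "\<exists>u. u \<noteq> (\<lambda>_. 0) \<and> \<not> projectively_finite {y \<in> ?Z f1 f2. dot u y = 0}"
      proof (rule ccontr)
        assume "\<not> ?thesis"
        then have "\<exists>T. T \<subseteq> ?Z f1 f2 \<and> general_position T \<and> finite T \<and> card T = 5"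
          by (intro finite_or_general_position[OF _ _ inf']) auto
        then obtain T where T: "T \<subseteq> ?Z f1 f2" "general_position T" "finite T" "card T = 5" by blast
        let ?W = "{p \<in> poly_comp 2. \<forall>y\<in>T. ev y p = 0}"
        have "MP.dim ?W + card T \<le> MP.dim (poly_comp 2 :: (3, 'k) mpoly set)"
          by (rule general_position_conditions) (use T in auto)
        then have "MP.dim ?W \<le> 1" using T(4) dim_poly_comp_small(2)[where 'k = 'k] by simp
        moreover have "f1 \<noteq> 0" using ind[of 1 0] f1(2) by auto
        moreover have "MP.fin_dim ?W" by (rule MP.fin_dim_subset[OF fin_dim_poly_comp]) auto
        moreover have "f1 \<in> ?W" "f2 \<in> ?W" using T(1) f1(1) f2(1) by auto
        ultimately obtain c where "f2 = mscale c f1" using MP.dim_le_1_multiple[of ?W f1 f2] by blast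
        then have "mconst c * g1 + mconst (-1) * g2 = 0" unfolding f1(2) f2(2) by (simp add: mscale_def mconst_uminus algebra_simps)
        from ind[OF this] show False by simp
      qed
      then obtain v where v: "v \<noteq> (\<lambda>_. 0)" "\<not> projectively_finite {y \<in> ?Z f1 f2. dot v y = 0}" by blast
      have div2: "\<exists>f'\<in>poly_comp 1. f = lin v * f'" if "f = f1 \<or> f = f2" for f
      proof -
        have "f \<in> poly_comp 2" using that f1(1) f2(1) by auto
        moreover have "{y \<in> ?Z f1 f2. dot v y = 0} \<subseteq> {y. y \<noteq> (\<lambda>_. 0) \<and> dot v y = 0 \<and> ev y f = 0}" using that by auto
        ultimately obtain r where "f = lin v * r" using line_divides[OF v(1)] v(2) projectively_finite_subset by blast
        then have "f = lin v * hcomp 1 r"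
          using homogeneous_cofactor[of f 1 "lin v" r] \<open>f \<in> poly_comp 2\<close> by (simp add: eval_nat_numeral)
        then show ?thesis by blast
      qed
      obtain s1 where "s1 \<in> poly_comp 1" "f1 = lin v * s1" using div2 by blast
      then obtain a where a: "f1 = lin v * lin a" using poly_comp_1_lin by metis
      obtain s2 where "s2 \<in> poly_comp 1" "f2 = lin v * s2" using div2 by blast
      then obtain b where b: "f2 = lin v * lin b" using poly_comp_1_lin by metis
      have "lin (\<lambda>i. (- 1) * b i) * g1 + lin a * g2 = 0"
        unfolding lin_scale f1(2) f2(2) a b by (simp add: mconst_uminus algebra_simps)
      then have "a = (\<lambda>_. 0)" using rel unfolding no_linear_relation_def by blast
      then have "g1 = 0" using f1(2) a by simp
      with ind[of 1 0] show False by simp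
    qed
    from generic_transversal_step[OF f1(1) f2(1) _ this lin_in_poly_comp] l(1) show ?thesis
      unfolding f1(2) f2(2) by simp
  qed
qed

section \<open>Conics and cubics in the ideal of the functional\<close>

lemma lin_zero [simp]: "lin (\<lambda>_. 0) = 0" by simp

context lefschetz_failure
begin

text \<open>
  A conic outside \<open>ann\<close> that is killed by two linear forms: its multiples form
  one-dimensional spaces, so that a generic class killed by \<open>u\<close> is also killed by the
  conic, and \<open>iterated_division\<close> applies.
\<close>

lemma no_conic_killed_twice:
  assumes q: "q \<in> poly_comp 2" "q \<notin> ann" and l: "cross l1 l2 \<noteq> (\<lambda>_. 0)" "lin l1 * q \<in> ann" "lin l2 * q \<in> ann"
  shows False
proof -
  have "l1 \<noteq> (\<lambda>_. 0)" using l(1) cross_zero by auto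
  \<comment> \<open>A multiple of \<open>l1\<close> serves as the class \<open>c\<close> that \<open>q\<close> kills.\<close>
  then have "lin l1 \<notin> ann" using ann_1[of "lin l1"] by auto
  then obtain c' where c': "c' \<in> poly_comp (m - 1)" "lin l1 * c' \<notin> ann"
    using ex_multiple_notin_ann[of "lin l1" 1 "m - 1"] m_ge_2 by auto
  define c where "c = lin l1 * c'"
  have c: "c \<in> poly_comp m" "c \<notin> ann" "c * q \<in> ann"
    using poly_comp_mult[OF lin_in_poly_comp c'(1), of l1] c'(2) m_ge_2 ann_mult[OF l(2), of c']
    by (simp_all add: c_def mult_ac)
  from iterated_division[OF q(1) c] obtain Gi where Gi: "generic_linear Gi"
    "\<And>u l1 l2 a. lin u \<in> Gi \<Longrightarrow> det3 l1 l2 u \<noteq> 0 \<Longrightarrow> lin l1 * q \<in> ann \<Longrightarrow> lin l2 * q \<in> ann \<Longrightarrow>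
    (q = 0 \<or> \<phi> (q * lin u ^ (2 * m - 1)) \<noteq> 0) \<Longrightarrow> a \<in> poly_comp m \<Longrightarrow> lin u * a \<in> ann \<Longrightarrow>
    annihilator_generated q u a \<Longrightarrow> a \<in> ann" by blast
  obtain Gg where Gg: "generic_linear Gg" "\<And>u. lin u \<in> Gg \<Longrightarrow> good u" using generic_good by blast
  have "q \<noteq> 0" using q(2) by auto
  then obtain Gd where Gd: "generic_linear Gd" "\<And>u. lin u \<in> Gd \<Longrightarrow> \<nexists>r. q = lin u * r"
    using generic_not_dividing[OF q(1)] by blast
  have Gp: "generic_linear {u. \<phi> (u ^ (2 * m - 1) * q) \<noteq> 0}"
  proof -
    obtain r k where r: "r \<in> poly_comp k" "2 + k = 2 * m + 1" "\<phi> (q * r) \<noteq> 0" using in_annI[OF q(1)] q(2) by blast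
    then have "k = 2 * m - 1" by simp
    with r(1) have "r \<in> poly_comp (2 * m - 1)" by simp
    moreover have "\<phi> (r * q) \<noteq> 0" using r(3) by (simp add: mult.commute)
    ultimately show ?thesis by (rule generic_linear_power[OF linfun_mult[OF linfun]])
  qed
  obtain u where u: "lin u \<in> ((Gi \<inter> Gg) \<inter> Gd) \<inter> {u. \<phi> (u ^ (2 * m - 1) * q) \<noteq> 0}"
    using generic_linear_Int[OF generic_linear_Int[OF generic_linear_Int[OF Gi(1) Gg(1)] Gd(1)] Gp] by (rule generic_linear_witness)
  have good: "good u" using Gg(2) u by blast
  have qu: "\<phi> (q * lin u ^ (2 * m - 1)) \<noteq> 0" using u by (simp add: mult.commute)
  have det: "det3 l1 l2 u \<noteq> 0"
  proof
    assume z: "det3 l1 l2 u = 0"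
    obtain e where e: "dot e (cross l1 l2) = 1" using dot_witness[OF l(1)] by blast
    have e': "det3 l1 l2 e = 1" using e by (simp add: det3_expand dot3 algebra_simps)
    have "u = (\<lambda>i. det3 u l2 e * l1 i + det3 l1 u e * l2 i)"
      by (rule ext) (use cramer[of l1 l2 e u] in \<open>simp add: e' z\<close>)
    then have "lin u = lin (\<lambda>i. det3 u l2 e * l1 i + det3 l1 u e * l2 i)" by simp
    then have "lin u * q = mconst (det3 u l2 e) * (lin l1 * q) + mconst (det3 l1 u e) * (lin l2 * q)"
      unfolding lin_add lin_scale by (simp add: algebra_simps)
    then have "lin u * q \<in> ann" using l by (simp add: ann_add ann_mult')
    then have "\<phi> ((lin u * q) * lin u ^ (2 * m - 2)) = 0" by (rule phi_ann[OF ann_mult])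
    moreover have "(lin u * q) * lin u ^ (2 * m - 2) = q * lin u ^ Suc (2 * m - 2)" by (simp add: mult_ac)
    moreover have "Suc (2 * m - 2) = 2 * m - 1" using m_ge_2 by simp
    ultimately show False using qu by metis
  qed
  obtain a where a: "a \<in> poly_comp m" "a \<notin> ann" "lin u * a \<in> ann" using no_lefschetz[OF lin_in_poly_comp] by blast
  \<comment> \<open>The class of \<open>q a\<close> is \<open>k q u\<^sup>m\<close>, and multiplying by a power of \<open>u\<close> shows \<open>k = 0\<close>.\<close>
  have qa: "q * a \<in> ann"
  proof -
    obtain r r' k where ar: "a = lin l1 * r + lin l2 * r' + mconst k * lin u ^ m"
      using form_mod_two_linear_forms[OF det a(1)] by blast
    have eq: "q * a - mconst k * (q * lin u ^ m) = (lin l1 * q) * r + (lin l2 * q) * r'"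
      unfolding ar by (simp add: algebra_simps)
    have rest: "q * a - mconst k * (q * lin u ^ m) \<in> ann" unfolding eq by (intro ann_add ann_mult l)
    have "mconst k * (q * lin u ^ (2 * m - 1)) = lin u ^ (m - 2) * q * (lin u * a) - lin u ^ (m - 1) * (q * a - mconst k * (q * lin u ^ m))"
    proof -
      have "lin u ^ (m - 1) = lin u ^ (m - 2) * lin u" using m_ge_2 power_Suc2[of "lin u" "m - 2"] by (simp add: Suc_diff_Suc numeral_2_eq_2)
      moreover have "(m - 1) + m = 2 * m - 1" using m_ge_2 by simp
      then have "lin u ^ (2 * m - 1) = lin u ^ (m - 1) * lin u ^ m" by (metis power_add)
      ultimately show ?thesis by (simp add: algebra_simps)
    qed
    also have "\<dots> \<in> ann" by (intro ann_diff ann_mult' a rest)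
    finally have "\<phi> (mconst k * (q * lin u ^ (2 * m - 1))) = 0" by (rule phi_ann)
    then have "k = 0" using qu by (simp add: phi)
    with rest show ?thesis by simp
  qed
  obtain y z where chart: "chart u y z" using ex_chart[OF good_nonzero[OF good]] by blast
  have q0: "on_line y z q \<noteq> 0" using Gd(2)[of u] u chart_kernel[OF chart q(1)] by blast
  have "a \<in> ann"
  proof (rule Gi(2)[OF _ det l(2,3) disjI2[OF qu] a(1,3)])
    show "lin u \<in> Gi" using u by blast
    show "annihilator_generated q u a" unfolding annihilator_generated_def
    proof (intro allI impI)
      fix j b assume "1 \<le> j" "j \<le> m" "b \<in> poly_comp j" "b * a \<in> ann"
      then obtain r s where "r \<in> poly_comp (j - 1)" "b = lin u * r + q * s" "s = 0 \<or> j \<ge> 2 \<and> s \<in> poly_comp (j - 2)"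
        using killed_by_multiples_of_conic[OF good chart a q(1) qa q0] by blast
      then show "\<exists>r\<in>poly_comp (j - 1). \<exists>s. b - (lin u * r + q * s) \<in> ann \<and> (s = 0 \<or> j \<ge> 2 \<and> s \<in> poly_comp (j - 2))"
        by (intro bexI[of _ r] exI[of _ s]) auto
    qed
  qed
  with a(2) show False by blast
qed

text \<open>
  A relation \<open>a g1 + b g2 = 0\<close> with independent \<open>a\<close>, \<open>b\<close> forces \<open>g2 = a q\<close> and \<open>g1 = - b q\<close> for a conic \<open>q\<close>,
  which both \<open>a\<close> and \<open>b\<close> kill.
\<close>

lemma no_linear_relation_in_ann:
  assumes g: "g1 \<in> poly_comp 3" "g2 \<in> poly_comp 3" "g1 \<in> ann" "g2 \<in> ann"
    and ind: "\<And>a b. mconst a * g1 + mconst b * g2 = 0 \<Longrightarrow> a = 0 \<and> b = 0"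
  shows "no_linear_relation g1 g2"
  unfolding no_linear_relation_def
proof (intro allI impI, rule ccontr)
  fix a b assume ab: "lin a * g1 + lin b * g2 = 0" and ne: "\<not> (a = (\<lambda>_. 0) \<and> b = (\<lambda>_. 0))"
  have g0: "g1 \<noteq> 0" "g2 \<noteq> 0" using ind[of 1 0] ind[of 0 1] by auto
  have "a \<noteq> (\<lambda>_. 0)"
  proof
    assume "a = (\<lambda>_. 0)"
    then have "lin b * g2 = 0" using ab lin_eq_0_iff[of a] by simp
    then show False using ne g0(2) \<open>a = _\<close> by simp
  qed
  have ratio: "lin b \<noteq> mconst c * lin a" for c
  proof
    assume "lin b = mconst c * lin a"
    then have "lin a * (mconst 1 * g1 + mconst c * g2) = 0" using ab by (simp add: algebra_simps)
    then have "mconst 1 * g1 + mconst c * g2 = 0" using \<open>a \<noteq> _\<close> by simp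
    from ind[OF this] show False by simp
  qed
  have cross: "cross a b \<noteq> (\<lambda>_. 0)"
  proof
    assume "cross a b = (\<lambda>_. 0)"
    then obtain c where "b = (\<lambda>i. c * a i)" using proportional_if_cross_0[OF _ \<open>a \<noteq> _\<close>] by blast
    then show False using ratio[of c] lin_scale[of c a] by simp
  qed
  obtain y z where chart: "chart a y z" using ex_chart[OF \<open>a \<noteq> _\<close>] by blast
  have "on_line y z (lin b) \<noteq> 0"
  proof
    assume "on_line y z (lin b) = 0"
    then obtain r where r: "lin b = lin a * r" using chart_kernel[OF chart lin_in_poly_comp] by blast
    moreover have "lin b \<in> poly_comp (Suc 0)" by simp
    ultimately have "lin b = lin a * hcomp 0 r" using homogeneous_cofactor[OF _ lin_in_poly_comp] by blast
    moreover obtain k where "hcomp 0 r = mconst k" using poly_comp_0_const[OF hcomp_in_poly_comp] by blast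
    ultimately show False using ratio[of k] by (simp add: mult.commute)
  qed
  moreover have "on_line y z (lin b) * on_line y z g2 = 0"
    using arg_cong[OF ab, of "on_line y z"] chart_lin[OF chart] by simp
  ultimately have "on_line y z g2 = 0" unfolding mult_eq_0_iff by blast
  then obtain r where "g2 = lin a * r" using chart_kernel[OF chart g(2)] by blast
  then have g2: "g2 = lin a * hcomp 2 r"
    using homogeneous_cofactor[of g2 2 "lin a" r] g(2) by (simp add: eval_nat_numeral)
  define q where "q = hcomp 2 r"
  have "lin a * (g1 + lin b * q) = 0" using ab unfolding g2 q_def[symmetric] by (simp add: algebra_simps)
  then have "g1 + lin b * q = 0" using \<open>a \<noteq> _\<close> by simp
  then have g1: "lin b * q = - g1" by (simp add: add_eq_0_iff)
  have "q \<notin> ann"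
  proof
    assume "q \<in> ann"
    then have "q = 0" using ann_2 by (auto simp: q_def)
    with g2 g0 show False by (simp add: q_def)
  qed
  then show False
    using no_conic_killed_twice[of q a b] cross g(3,4) g1 g2 ann_uminus by (simp add: q_def)
qed

text \<open>
  On a generic line the annihilator of \<open>a\<close> has dimension at most two in degree three, so there it is
  spanned by the two cubics. A conic in it would, with its multiple by the coordinate, span the same
  space and be a large common factor of the cubics. So the annihilator is generated by \<open>u\<close> alone up
  to degree three, and \<open>iterated_division\<close> applies with \<open>q = 0\<close>.
\<close>

lemma m_eq_3_contradiction:
  fixes g1 g2 :: "(3, 'k) mpoly"
  assumes m: "m = 3" and g: "g1 \<in> poly_comp 3" "g2 \<in> poly_comp 3" "g1 \<in> ann" "g2 \<in> ann"
    and trans: "\<exists>G. generic_linear G \<and> (\<forall>u y z. lin u \<in> G \<longrightarrow> chart u y z \<longrightarrow> transversal g1 g2 y z)"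
  shows False
proof -
  obtain c where c: "c \<in> poly_comp m" "c \<notin> ann" using no_lefschetz[of 0] by auto
  have "\<exists>G. generic_linear G \<and> (\<forall>u l1 l2 a. lin u \<in> G \<longrightarrow> det3 l1 l2 u \<noteq> 0 \<longrightarrow> a \<in> poly_comp m \<longrightarrow> lin u * a \<in> ann \<longrightarrow>
      annihilator_generated 0 u a \<longrightarrow> a \<in> ann)"
    using iterated_division[OF poly_comp_0 c] by simp
  then obtain Gi where Gi: "generic_linear Gi" "\<And>u l1 l2 a. lin u \<in> Gi \<Longrightarrow> det3 l1 l2 u \<noteq> 0 \<Longrightarrow> a \<in> poly_comp m \<Longrightarrow>
      lin u * a \<in> ann \<Longrightarrow> annihilator_generated 0 u a \<Longrightarrow> a \<in> ann" by blast
  obtain Gg where Gg: "generic_linear Gg" "\<And>u. lin u \<in> Gg \<Longrightarrow> good u" using generic_good by blast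
  obtain Gt where Gt: "generic_linear Gt" "\<And>u y z. lin u \<in> Gt \<Longrightarrow> chart u y z \<Longrightarrow> transversal g1 g2 y z" using trans by blast
  obtain u where u: "lin u \<in> (Gi \<inter> Gg) \<inter> Gt"
    using generic_linear_Int[OF generic_linear_Int[OF Gi(1) Gg(1)] Gt(1)] by (rule generic_linear_witness)
  have good: "good u" using Gg(2) u by blast
  obtain y z where chart: "chart u y z" using ex_chart[OF good_nonzero[OF good]] by blast
  have ind: "\<And>a b. smult a (on_line y z g1) + smult b (on_line y z g2) = 0 \<Longrightarrow> a = 0 \<and> b = 0"
    and nofac: "\<And>t e1 e2. on_line y z g1 = t * e1 \<Longrightarrow> on_line y z g2 = t * e2 \<Longrightarrow> degree e1 \<le> 1 \<Longrightarrow> degree e2 \<le> 1 \<Longrightarrow> False"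
    using Gt(2)[OF _ chart] u unfolding transversal_def by blast+
  \<comment> \<open>Two linear forms that complete \<open>u\<close> to a basis.\<close>
  obtain w where w: "dot w u = 1" using dot_witness[OF good_nonzero[OF good]] by blast
  then have "w \<noteq> (\<lambda>_. 0)" by (auto simp: dot3)
  then obtain l1 l2 where l: "cross l1 l2 = w" using ex_cross_product by blast
  have det: "det3 l1 l2 u \<noteq> 0" using w unfolding l[symmetric] by (simp add: det3_expand dot3 algebra_simps)
  obtain a where a: "a \<in> poly_comp m" "a \<notin> ann" "lin u * a \<in> ann" using no_lefschetz[OF lin_in_poly_comp] by blast
  let ?T = "line_ann y z a"
  have T3: "PS.fin_dim (?T 3)" "PS.dim (?T 3) \<le> 2" "on_line y z g1 \<in> ?T 3" "on_line y z g2 \<in> ?T 3"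
  proof -
    show "PS.fin_dim (?T 3)" by (rule PS.fin_dim_subset[OF fin_dim_polys line_ann_bounds(1)])
    show "PS.dim (?T 3) \<le> 2" using dim_line_ann_m[OF good chart a] m by simp
    show "on_line y z g1 \<in> ?T 3" "on_line y z g2 \<in> ?T 3"
      using in_line_ann_iff[OF good chart a g(1)] in_line_ann_iff[OF good chart a g(2)] g(3,4) ann_mult by blast+
  qed
  have divide: "\<exists>r\<in>poly_comp (j - 1). b = lin u * r" if jb: "1 \<le> j" "b \<in> poly_comp j" "on_line y z b = 0" for j b
  proof -
    obtain r where "b = lin u * r" using chart_kernel[OF chart jb(2,3)] by blast
    then have "b = lin u * hcomp (j - 1) r" using homogeneous_cofactor[of b "j - 1" "lin u" r] jb(1,2) by simp
    then show ?thesis by blast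
  qed
  have "a \<in> ann"
  proof (rule Gi(2)[OF _ det a(1,3)])
    show "lin u \<in> Gi" using u by blast
    show "annihilator_generated 0 u a" unfolding annihilator_generated_def
    proof (intro allI impI)
      fix j b assume j: "1 \<le> j" "j \<le> m" and b: "b \<in> poly_comp j" "b * a \<in> ann"
      have "\<exists>r\<in>poly_comp (j - 1). b - lin u * r \<in> ann"
      proof -
        consider "j = 1" | "j = 2" | "j = 3" using j m by linarith
        then show ?thesis
        proof cases
          case 1
          then have "on_line y z b = 0" using killed_by_linear[OF good chart a] b by blast
          then show ?thesis using divide[OF j(1) b(1)] by force
        next
          case 2
          have "on_line y z b = 0"
          proof (rule ccontr)
            assume t0: "on_line y z b \<noteq> 0"
            define t where "t = on_line y z b"
            have "t \<in> ?T 2" using in_line_ann_iff[OF good chart a, of b 2] b 2 by (simp add: t_def)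
            then have t: "t \<in> ?T 3" "pCons 0 t \<in> ?T 3"
              using line_ann_Suc[OF good chart a, of t 2] by (simp_all add: eval_nat_numeral)
            have indt: "\<alpha> = 0 \<and> \<beta> = 0" if "smult \<alpha> t + smult \<beta> (pCons 0 t) = 0" for \<alpha> \<beta>
            proof -
              have "t * [:\<alpha>, \<beta>:] = smult \<alpha> t + smult \<beta> (pCons 0 t)" by simp
              also have "\<dots> = 0" by (rule that)
              finally have "[:\<alpha>, \<beta>:] = 0" using t0 unfolding mult_eq_0_iff t_def by blast
              then show ?thesis by simp
            qed
            have "\<exists>e. on_line y z g = t * e \<and> degree e \<le> 1" if gT: "on_line y z g \<in> ?T 3" for g
            proof -
              obtain \<alpha> \<beta> where "on_line y z g = smult \<alpha> t + smult \<beta> (pCons 0 t)"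
                using PS.dim_le_2_combination[OF T3(1,2) t gT indt] by blast
              then have "on_line y z g = t * [:\<alpha>, \<beta>:]" by simp
              then show ?thesis by (intro exI[of _ "[:\<alpha>, \<beta>:]"]) simp
            qed
            then show False using nofac T3(3,4) by blast
          qed
          then show ?thesis using divide[OF j(1) b(1)] by force
        next
          case 3
          then have "on_line y z b \<in> ?T 3" using in_line_ann_iff[OF good chart a, of b 3] b by simp
          then obtain \<alpha> \<beta> where "on_line y z b = smult \<alpha> (on_line y z g1) + smult \<beta> (on_line y z g2)"
            using PS.dim_le_2_combination[OF T3 _ ind] by blast
          then have "on_line y z (b - (mconst \<alpha> * g1 + mconst \<beta> * g2)) = 0" by simp
          moreover have "b - (mconst \<alpha> * g1 + mconst \<beta> * g2) \<in> poly_comp j" using b(1) g 3 by auto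
          ultimately obtain r where r: "r \<in> poly_comp (j - 1)" "b - (mconst \<alpha> * g1 + mconst \<beta> * g2) = lin u * r"
            using divide[OF j(1)] by blast
          have "b - lin u * r = mconst \<alpha> * g1 + mconst \<beta> * g2" using r(2) by (simp add: algebra_simps)
          then have "b - lin u * r \<in> ann" using g(3,4) by (simp add: ann_add ann_mult')
          then show ?thesis using r(1) by blast
        qed
      qed
      then show "\<exists>r\<in>poly_comp (j - 1). \<exists>s. b - (lin u * r + 0 * s) \<in> ann \<and> (s = 0 \<or> j \<ge> 2 \<and> s \<in> poly_comp (j - 2))"
        by force
    qed
  qed
  with a(2) show False by blast
qed

end

text \<open>
  There are two independent cubics in \<open>ann\<close>, without a linear relation. Their six linear multiples
  are too many for degree four if \<open>m \<ge> 4\<close>, while smaller \<open>m\<close> have been dealt with.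
\<close>

theorem lefschetz_failure_impossible:
  fixes \<phi> :: "(3, 'k::{field_char_0, alg_closed_field}) mpoly \<Rightarrow> 'k"
  assumes "lefschetz_failure \<phi> m"
    and dim_3: "m \<ge> 3 \<Longrightarrow> MP.dim (poly_comp 3 :: (3, 'k) mpoly set) = MP.dim (gorenstein_functional.ann \<phi> \<inter> poly_comp 3) + 8"
    and dim_4: "m \<ge> 4 \<Longrightarrow> MP.dim (poly_comp 4 :: (3, 'k) mpoly set) = MP.dim (gorenstein_functional.ann \<phi> \<inter> poly_comp 4) + 10"
  shows False
proof -
  interpret lefschetz_failure \<phi> m by fact
  have m3: "m \<ge> 3" using m_ge_2 not_m_2 by simp
  let ?J = "ann \<inter> poly_comp 3"
  have d: "MP.dim ?J = 2" using dim_3[OF m3] dim_poly_comp_small(3)[where 'k = 'k] by simp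
  obtain B where B: "B \<subseteq> ?J" "MP.independent B" "finite B" "card B = 2"
    using MP.fin_dim_basis[OF fin_dim_sub[of ?J 3]] d by (metis inf_le2)
  then obtain g1 g2 where g12: "B = {g1, g2}" "g1 \<noteq> g2" by (auto simp: card_2_iff)
  have g: "g1 \<in> poly_comp 3" "g2 \<in> poly_comp 3" "g1 \<in> ann" "g2 \<in> ann" using B(1) g12 by auto
  have ind: "a = 0 \<and> b = 0" if z: "mconst a * g1 + mconst b * g2 = 0" for a b
  proof -
    define f where "f = (\<lambda>x. if x = g1 then a else b)"
    have "(\<Sum>x\<in>B. mscale (f x) x) = 0" using z g12 by (simp add: f_def mscale_def)
    then have "f x = 0" if "x \<in> B" for x
      using B(2,3) that unfolding MP.dependent_finite[OF B(3)] by blast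
    from this[of g1] this[of g2] show ?thesis using g12 by (simp add: f_def)
  qed
  have rel: "no_linear_relation g1 g2" by (rule no_linear_relation_in_ann[OF g ind])
  show False
  proof (cases "m = 3")
    case True
    then show False using m_eq_3_contradiction[OF _ g generic_transversal[OF g(1,2) rel]] by blast
  next
    case False
    then have m4: "m \<ge> 4" using m3 by simp
    have "6 \<le> MP.dim (ann \<inter> poly_comp 4)"
    proof (rule six_multiples[OF rel])
      show "MP.fin_dim (ann \<inter> poly_comp 4)" by (rule fin_dim_sub[of _ 4]) simp
      show "mvar i * g1 \<in> ann \<inter> poly_comp 4" "mvar i * g2 \<in> ann \<inter> poly_comp 4" for i
        using g poly_comp_mult[OF mvar_in_poly_comp g(1), of i] poly_comp_mult[OF mvar_in_poly_comp g(2), of i]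
        by (simp_all add: ann_mult')
    qed
    then show False using dim_4[OF m4] dim_poly_comp_small(4)[where 'k = 'k] by simp
  qed
qed

section \<open>Graded quotients and their socles\<close>

lemma mpoly_ring_simps [simp]:
  "carrier mpoly_ring = UNIV" "p \<otimes>\<^bsub>mpoly_ring\<^esub> q = p * q" "p \<oplus>\<^bsub>mpoly_ring\<^esub> q = p + q"
  "\<zero>\<^bsub>mpoly_ring\<^esub> = 0" "\<one>\<^bsub>mpoly_ring\<^esub> = 1"
  by (simp_all add: ring_of_type_algebra_def)

lemma mpoly_ring_cring: "cring (mpoly_ring :: ('v, 'k::field) mpoly ring)"
  by (rule cring_from_type_algebra)

lemma mpoly_ideal_iff:
  fixes I :: "('v, 'k::field) mpoly set"
  shows "ideal I mpoly_ring \<longleftrightarrow> 0 \<in> I \<and> (\<forall>p\<in>I. \<forall>q\<in>I. p + q \<in> I) \<and> (\<forall>p\<in>I. \<forall>r. r * p \<in> I)"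
proof
  assume "ideal I mpoly_ring"
  then interpret ideal I "mpoly_ring :: ('v, 'k) mpoly ring" .
  show "0 \<in> I \<and> (\<forall>p\<in>I. \<forall>q\<in>I. p + q \<in> I) \<and> (\<forall>p\<in>I. \<forall>r. r * p \<in> I)"
    using additive_subgroup.zero_closed[OF is_additive_subgroup] additive_subgroup.a_closed[OF is_additive_subgroup] I_l_closed
    by simp
next
  assume h: "0 \<in> I \<and> (\<forall>p\<in>I. \<forall>q\<in>I. p + q \<in> I) \<and> (\<forall>p\<in>I. \<forall>r. r * p \<in> I)"
  interpret cring "mpoly_ring :: ('v, 'k) mpoly ring" by (rule mpoly_ring_cring)
  have neg: "\<exists>q\<in>I. p + q = 0" if "p \<in> I" for p
    using h that by (intro bexI[of _ "- p"]) (auto dest!: bspec[of _ _ p] spec[of _ "-1"])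
  have "\<ominus>\<^bsub>mpoly_ring\<^esub> p \<in> I" if p: "p \<in> I" for p
  proof -
    obtain q where q: "q \<in> I" "p + q = 0" using neg[OF p] by blast
    have "\<ominus>\<^bsub>mpoly_ring\<^esub> p = q"
      by (rule minus_equality) (use q in \<open>simp_all add: add.commute\<close>)
    then show ?thesis using q by simp
  qed
  then have "subgroup I (add_monoid (mpoly_ring :: ('v, 'k) mpoly ring))"
    using h by (intro subgroup.intro) (auto simp: a_inv_def)
  then show "ideal I mpoly_ring"
    using h by (intro idealI ring_axioms) (auto simp: mult.commute)
qed

locale proper_homogeneous_ideal =
  fixes I :: "(3, 'k::field_char_0) mpoly set"
  assumes homogeneous: "homogeneous_ideal I" and proper: "1 \<notin> I"
begin

lemma I_ideal: "ideal I mpoly_ring"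
proof -
  interpret cring "mpoly_ring :: (3, 'k) mpoly ring" by (rule mpoly_ring_cring)
  show ?thesis using homogeneous genideal_ideal unfolding homogeneous_ideal_def by auto
qed

lemma I_0 [simp]: "0 \<in> I" and I_add: "p \<in> I \<Longrightarrow> q \<in> I \<Longrightarrow> p + q \<in> I" and I_mult: "p \<in> I \<Longrightarrow> r * p \<in> I"
  using I_ideal unfolding mpoly_ideal_iff by blast+

lemma I_uminus: "p \<in> I \<Longrightarrow> - p \<in> I"
  using I_mult[of p "-1"] by simp

lemma I_diff: "p \<in> I \<Longrightarrow> q \<in> I \<Longrightarrow> p - q \<in> I"
  using I_add[of p "- q"] I_uminus by simp

lemma I_cancel: "mconst c * p \<in> I \<Longrightarrow> c \<noteq> 0 \<Longrightarrow> p \<in> I"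
  using I_mult[of "mconst c * p" "mconst (1 / c)"] by (simp flip: mult.assoc mconst_mult)

text \<open>
  The elements of \<open>I\<close> all of whose components lie in \<open>I\<close> form an ideal that contains the homogeneous
  generators.
\<close>

lemma hcomp_in_I:
  assumes "p \<in> I" shows "hcomp n p \<in> I"
proof -
  interpret cring "mpoly_ring :: (3, 'k) mpoly ring" by (rule mpoly_ring_cring)
  obtain S where S: "S \<subseteq> (\<Union>i. poly_comp i)" "I = genideal mpoly_ring S"
    using homogeneous unfolding homogeneous_ideal_def by blast
  let ?J = "{p \<in> I. \<forall>n. hcomp n p \<in> I}"
  have closed: "hcomp n (r * p) \<in> I" if p: "p \<in> ?J" for n r p
  proof -
    obtain N where N: "r = (\<Sum>i<N. hcomp i r)" using hcomp_decompose by blast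
    have "hcomp n (hcomp i r * p) \<in> I" for i
    proof (cases "i \<le> n")
      case True
      then show ?thesis using hcomp_mult[of "hcomp i r" i "n - i" p] p by (auto intro: I_mult)
    next
      case False
      obtain M where M: "p = (\<Sum>j<M. hcomp j p)" using hcomp_decompose by blast
      have "hcomp i r * p = (\<Sum>j<M. hcomp i r * hcomp j p)"
        unfolding sum_distrib_left[symmetric] using M by simp
      moreover have "hcomp n (hcomp i r * hcomp j p) = 0" for j
        by (rule hcomp_other[OF poly_comp_mult[OF hcomp_in_poly_comp hcomp_in_poly_comp]]) (use False in simp)
      ultimately show ?thesis by (simp add: hcomp_sum)
    qed
    then have "(\<Sum>i<N. hcomp n (hcomp i r * p)) \<in> I"
      by (induction N) (auto intro: I_add)
    then have "hcomp n ((\<Sum>i<N. hcomp i r) * p) \<in> I" by (simp add: sum_distrib_right hcomp_sum)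
    with N show ?thesis by simp
  qed
  have "S \<subseteq> ?J"
  proof
    fix s :: "(3, 'k) mpoly" assume "s \<in> S"
    then have s: "s \<in> I" using genideal_self[of S] S(2) by auto
    obtain i where i: "s \<in> poly_comp i" using S(1) \<open>s \<in> S\<close> by auto
    have "hcomp n s \<in> I" for n
      using hcomp_same[OF i] hcomp_other[OF i, of n] s by (cases "i = n") auto
    with s show "s \<in> ?J" by blast
  qed
  moreover have "ideal ?J mpoly_ring"
    unfolding mpoly_ideal_iff using closed by (auto simp: hcomp_add intro: I_add I_mult)
  ultimately have "I \<subseteq> ?J" unfolding S(2) using genideal_minimal by blast
  with assms show ?thesis by blast
qed

abbreviation A :: "(3, 'k) mpoly set ring" where "A \<equiv> quot_alg I"

lemma A_cring: "cring A"
  by (rule ideal.quotient_is_cring[OF I_ideal mpoly_ring_cring])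

lemma A_ring: "ring A"
  by (rule cring.axioms(1)[OF A_cring])

lemma residue_eq_iff: "residue I p = residue I q \<longleftrightarrow> p - q \<in> I"
proof -
  have mem: "x \<in> residue I p \<longleftrightarrow> x - p \<in> I" for x p
  proof -
    have "x \<in> residue I p \<longleftrightarrow> (\<exists>h\<in>I. x = h + p)"
      by (simp add: residue_def a_r_coset_def r_coset_def)
    also have "\<dots> \<longleftrightarrow> x - p \<in> I" by (auto intro!: bexI[of _ "x - p"])
    finally show ?thesis .
  qed
  show ?thesis
  proof
    assume "residue I p = residue I q"
    then show "p - q \<in> I" using mem[of p p] mem[of p q] by simp
  next
    assume pq: "p - q \<in> I"
    have "x - p \<in> I \<longleftrightarrow> x - q \<in> I" for x
      using I_add[OF _ pq, of "x - p"] I_diff[OF _ pq, of "x - q"] by auto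
    then show "residue I p = residue I q" using mem by blast
  qed
qed

lemma residue_0: "residue I 0 = I"
  by (auto simp: residue_def a_r_coset_def r_coset_def)

lemma A_zero: "\<zero>\<^bsub>A\<^esub> = residue I 0"
  by (simp add: FactRing_def residue_0)

lemma A_one: "\<one>\<^bsub>A\<^esub> = residue I 1"
  by (simp add: FactRing_def residue_def)

lemma A_mult: "residue I p \<otimes>\<^bsub>A\<^esub> residue I q = residue I (p * q)"
  using ideal.rcoset_mult_add[OF I_ideal, of p q] by (simp add: FactRing_def residue_def)

lemma A_add: "residue I p \<oplus>\<^bsub>A\<^esub> residue I q = residue I (p + q)"
  using ideal.a_rcos_sum[OF I_ideal, of p q] by (simp add: FactRing_def residue_def)

lemma carrier_A: "carrier A = range (residue I)"
  by (auto simp: FactRing_def A_RCOSETS_def' residue_def)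

lemma residue_eq_0_iff: "residue I p = \<zero>\<^bsub>A\<^esub> \<longleftrightarrow> p \<in> I"
  by (simp add: A_zero residue_eq_iff)

lemma scalars_subfield: "subfield (scalars I) A"
proof -
  interpret F: Ring.field "ring_of_type_algebra :: 'k ring" by (rule field_from_type_algebra)
  have "ring_hom_ring ring_of_type_algebra A (\<lambda>c. residue I (mconst c))"
  proof (intro ring_hom_ringI2 F.is_ring A_ring ring_hom_memI)
    fix x y :: 'k
    have "x \<otimes>\<^bsub>ring_of_type_algebra\<^esub> y = x * y" "x \<oplus>\<^bsub>ring_of_type_algebra\<^esub> y = x + y" "\<one>\<^bsub>ring_of_type_algebra\<^esub> = (1 :: 'k)"
      by (simp_all add: ring_of_type_algebra_def)
    then show "residue I (mconst x) \<in> carrier A"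
      "residue I (mconst (x \<otimes>\<^bsub>ring_of_type_algebra\<^esub> y)) = residue I (mconst x) \<otimes>\<^bsub>A\<^esub> residue I (mconst y)"
      "residue I (mconst (x \<oplus>\<^bsub>ring_of_type_algebra\<^esub> y)) = residue I (mconst x) \<oplus>\<^bsub>A\<^esub> residue I (mconst y)"
      "residue I (mconst \<one>\<^bsub>ring_of_type_algebra\<^esub>) = \<one>\<^bsub>A\<^esub>"
      by (simp_all add: carrier_A A_mult A_add A_one mconst_mult mconst_add)
  qed
  from ring_hom_ring.img_is_subfield(2)[OF this F.carrier_is_subfield]
  have "subfield ((\<lambda>c. residue I (mconst c)) ` carrier (ring_of_type_algebra :: 'k ring)) A"
    using proper by (simp add: A_one residue_eq_0_iff)
  also have "(\<lambda>c. residue I (mconst c)) ` carrier (ring_of_type_algebra :: 'k ring) = scalars I"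
    by (auto simp: scalars_def ring_of_type_algebra_def)
  finally show ?thesis .
qed

text \<open>
  Spans over the field of scalars in the quotient come from spans of polynomials; the factor \<open>e\<close>
  will be \<open>1\<close> or a linear form.
\<close>

lemma Span_residues:
  "ring.Span A (scalars I) (map (\<lambda>p. residue I (e * p)) ps) = (\<lambda>x. residue I (e * x)) ` MP.span (set ps)"
proof -
  interpret A: ring A by (rule A_ring)
  show ?thesis
  proof (induction ps)
    case Nil
    then show ?case by (simp add: A_zero)
  next
    case (Cons p ps)
    let ?f = "\<lambda>x. residue I (e * x)"
    have eq: "residue I (mconst c) \<otimes>\<^bsub>A\<^esub> ?f p \<oplus>\<^bsub>A\<^esub> ?f x = ?f (mscale c p + x)" for c x
      by (simp add: A_mult A_add mscale_def algebra_simps)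
    have "A.Span (scalars I) (map ?f (p # ps)) = A.line_extension (scalars I) (?f p) (?f ` MP.span (set ps))"
      using Cons by simp
    also have "\<dots> = {?f (mscale c p + x) | c x. x \<in> MP.span (set ps)}"
    proof (intro Set.equalityI subsetI)
      fix z assume "z \<in> A.line_extension (scalars I) (?f p) (?f ` MP.span (set ps))"
      then obtain c x where "x \<in> MP.span (set ps)" "z = residue I (mconst c) \<otimes>\<^bsub>A\<^esub> ?f p \<oplus>\<^bsub>A\<^esub> ?f x"
        unfolding A.line_extension_mem_iff scalars_def by blast
      then show "z \<in> {?f (mscale c p + x) | c x. x \<in> MP.span (set ps)}" unfolding eq by blast
    next
      fix z assume "z \<in> {?f (mscale c p + x) | c x. x \<in> MP.span (set ps)}"
      then obtain c x where "x \<in> MP.span (set ps)" "z = ?f (mscale c p + x)" by blast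
      then show "z \<in> A.line_extension (scalars I) (?f p) (?f ` MP.span (set ps))"
        unfolding A.line_extension_mem_iff scalars_def using eq[of c x] by blast
    qed
    also have "\<dots> = ?f ` MP.span (set (p # ps))"
    proof -
      have "\<exists>c x. y = mscale c p + x \<and> x \<in> MP.span (set ps)" if y: "y \<in> MP.span (insert p (set ps))" for y
      proof -
        obtain c where "y - mscale c p \<in> MP.span (set ps)" using y by (auto simp: MP.span_insert)
        then show ?thesis by (intro exI[of _ c] exI[of _ "y - mscale c p"]) simp
      qed
      moreover have "mscale c p + x \<in> MP.span (insert p (set ps))" if "x \<in> MP.span (set ps)" for c x
        using that MP.span_mono[OF subset_insertI, of "set ps" p]
        by (intro MP.span_add MP.span_scale MP.span_base[of p]) auto
      ultimately show ?thesis unfolding list.set by blast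
    qed
    finally show ?case .
  qed
qed

lemma independent_residues:
  assumes "MP.independent (B \<union> set ps)" "distinct ps" "B \<inter> set ps = {}"
    and "\<And>x. x \<in> MP.span (set ps) \<Longrightarrow> e * x \<in> I \<Longrightarrow> x \<in> MP.span B"
  shows "ring.independent A (scalars I) (map (\<lambda>p. residue I (e * p)) ps)"
  using assms
proof (induction ps)
  case Nil
  then show ?case using ring.li_Nil[OF A_ring] by simp
next
  case (Cons p ps)
  have mono: "MP.span (set ps) \<subseteq> MP.span (set (p # ps))" by (intro MP.span_mono) auto
  have "MP.independent (B \<union> set ps)"
    using Cons.prems(1) MP.independent_mono[of "B \<union> set (p # ps)" "B \<union> set ps"] by auto
  then have IH: "ring.independent A (scalars I) (map (\<lambda>p. residue I (e * p)) ps)"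
    using Cons.IH Cons.prems mono by auto
  have "residue I (e * p) \<notin> ring.Span A (scalars I) (map (\<lambda>p. residue I (e * p)) ps)"
  proof
    assume "residue I (e * p) \<in> ring.Span A (scalars I) (map (\<lambda>p. residue I (e * p)) ps)"
    then obtain x where x: "x \<in> MP.span (set ps)" "e * (p - x) \<in> I"
      unfolding Span_residues by (auto simp: residue_eq_iff right_diff_distrib)
    have "p - x \<in> MP.span (set (p # ps))"
      using x(1) mono by (intro MP.span_diff) (auto intro: MP.span_base)
    then have "p - x \<in> MP.span B" using Cons.prems(4) x(2) by blast
    then have "p - x \<in> MP.span (B \<union> set ps)" by (rule subsetD[OF MP.span_mono[OF Un_upper1]])
    moreover have "x \<in> MP.span (B \<union> set ps)" by (rule subsetD[OF MP.span_mono[OF Un_upper2] x(1)])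
    ultimately have "(p - x) + x \<in> MP.span (B \<union> set ps)" by (rule MP.span_add)
    moreover have "(B \<union> set (p # ps)) - {p} = B \<union> set ps"
      using Cons.prems(2,3) by auto
    ultimately have "p \<in> MP.span ((B \<union> set (p # ps)) - {p})" by simp
    moreover have "p \<in> B \<union> set (p # ps)" by simp
    ultimately show False using Cons.prems(1) unfolding MP.dependent_def by blast
  qed
  moreover have "residue I (e * p) \<in> carrier A" unfolding carrier_A by blast
  ultimately show ?case unfolding list.map by (intro ring.li_Cons[OF A_ring] IH)
qed

text \<open>
  A basis \<open>B\<close> of \<open>I\<close> in degree \<open>i\<close> is extended to a basis of all forms; the residues of the added
  elements \<open>ps\<close> are a basis of the component of the quotient.
\<close>

lemma graded_comp_basis:
  obtains B ps where "MP.independent (B \<union> set ps)" "distinct ps" "B \<inter> set ps = {}"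
    "I \<inter> poly_comp i \<subseteq> MP.span B" "set ps \<subseteq> poly_comp i"
    "ring.dimension A (length ps) (scalars I) (graded_comp I i)"
    "MP.dim (poly_comp i :: (3, 'k) mpoly set) = MP.dim (I \<inter> poly_comp i) + length ps"
proof -
  have sub: "MP.fin_dim (I \<inter> poly_comp i)"
    by (rule MP.fin_dim_subset[OF fin_dim_poly_comp]) blast
  obtain B where B: "B \<subseteq> I \<inter> poly_comp i" "MP.independent B" "finite B" "I \<inter> poly_comp i \<subseteq> MP.span B"
      "card B = MP.dim (I \<inter> poly_comp i)"
    using MP.fin_dim_basis[OF sub] by blast
  obtain D where D: "B \<subseteq> D" "D \<subseteq> poly_comp i" "MP.independent D" "poly_comp i \<subseteq> MP.span D"
    using MP.maximal_independent_subset_extend[of B "poly_comp i"] B by blast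
  have D': "finite D" "card D = MP.dim (poly_comp i :: (3, 'k) mpoly set)"
    using MP.independent_card_le[OF fin_dim_poly_comp D(2,3)] MP.basis_card_eq_dim[OF D(2,4,3)] by auto
  obtain ps where ps: "set ps = D - B" "distinct ps"
    using finite_distinct_list[of "D - B"] D'(1) by blast
  have BD: "B \<union> set ps = D" using ps D by auto
  have sp: "MP.span (set ps) \<subseteq> poly_comp i"
    using ps D(2) subspace_poly_comp by (intro MP.span_minimal) auto
  have inIB: "x \<in> MP.span B" if "x \<in> MP.span (set ps)" "1 * x \<in> I" for x
    using that sp B(4) by auto
  have ind: "MP.independent (B \<union> set ps)" "B \<inter> set ps = {}" using BD D(3) ps by auto
  have "graded_comp I i = ring.Span A (scalars I) (map (\<lambda>p. residue I (1 * p)) ps)"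
  proof -
    have "residue I p \<in> residue I ` MP.span (set ps)" if "p \<in> poly_comp i" for p
    proof -
      have "p \<in> MP.span (B \<union> set ps)" using that D(4) BD by auto
      then obtain b c where bc: "p = b + c" "b \<in> MP.span B" "c \<in> MP.span (set ps)"
        unfolding MP.span_Un by blast
      have "MP.span B \<subseteq> I"
        using B(1) by (intro MP.span_minimal) (auto simp: MP.subspace_def mscale_def I_add I_mult)
      then have "residue I p = residue I c" using bc by (auto simp: residue_eq_iff)
      with bc(3) show ?thesis by blast
    qed
    then show ?thesis unfolding Span_residues graded_comp_def using sp by auto
  qed
  then have "ring.dimension A (length ps) (scalars I) (graded_comp I i)"
    using ring.dimensionI[OF A_ring scalars_subfield independent_residues[OF ind(1) ps(2) ind(2) inIB]] by (simp del: mult_1)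
  moreover have "MP.dim (poly_comp i :: (3, 'k) mpoly set) = MP.dim (I \<inter> poly_comp i) + length ps"
    using B(3,5) D' D(1) ps distinct_card[OF ps(2)] card_Diff_subset[OF B(3) D(1)] card_mono[OF D'(1) D(1)] by simp
  ultimately show ?thesis using that[OF ind(1) ps(2) ind(2) B(4)] ps(1) D(2) by blast
qed

lemma hilb_eq: "ring.dimension A n (scalars I) (graded_comp I i) \<Longrightarrow> hilb I i = n"
  using ring.dimI[OF A_ring scalars_subfield] unfolding hilb_def over_def by blast

lemma dim_hilb: "MP.dim (poly_comp i :: (3, 'k) mpoly set) = MP.dim (I \<inter> poly_comp i) + hilb I i"
  by (rule graded_comp_basis[of i]) (use hilb_eq in force)

lemma I_if_hilb_full:
  assumes "hilb I i = MP.dim (poly_comp i :: (3, 'k) mpoly set)"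
  shows "I \<inter> poly_comp i = {0}"
proof -
  have "MP.fin_dim (I \<inter> poly_comp i)"
    by (rule MP.fin_dim_subset[OF fin_dim_poly_comp]) blast
  then obtain B where B: "finite B" "I \<inter> poly_comp i \<subseteq> MP.span B" "card B = MP.dim (I \<inter> poly_comp i)"
    using MP.fin_dim_basis by metis
  with dim_hilb[of i] assms have "B = {}" by simp
  with B(2) show ?thesis by auto
qed

text \<open>
  The images of a basis stay independent, and there are as many of them as the target has dimensions.
\<close>

lemma surjective_if_injective:
  assumes u: "u \<in> poly_comp 1" and inj: "\<And>a. a \<in> poly_comp i \<Longrightarrow> u * a \<in> I \<Longrightarrow> a \<in> I"
    and h: "hilb I (Suc i) = hilb I i" and q: "q \<in> poly_comp (Suc i)"
  shows "\<exists>a\<in>poly_comp i. q - u * a \<in> I"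
proof -
  interpret A: ring A by (rule A_ring)
  obtain B ps where ps: "MP.independent (B \<union> set ps)" "distinct ps" "B \<inter> set ps = {}"
    "I \<inter> poly_comp i \<subseteq> MP.span B" "set ps \<subseteq> poly_comp i" "A.dimension (length ps) (scalars I) (graded_comp I i)"
    by (rule graded_comp_basis[of i]) blast
  have sp: "MP.span (set ps) \<subseteq> poly_comp i"
    using ps(5) subspace_poly_comp by (intro MP.span_minimal)
  let ?Us = "map (\<lambda>p. residue I (u * p)) ps"
  have "x \<in> MP.span B" if "x \<in> MP.span (set ps)" "u * x \<in> I" for x
    using that sp inj ps(4) by blast
  from independent_residues[OF ps(1-3) this] have ind: "A.independent (scalars I) ?Us" .
  have len: "length ?Us = hilb I (Suc i)" using hilb_eq[OF ps(6)] h by simp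
  obtain n where "A.dimension n (scalars I) (graded_comp I (Suc i))"
    using graded_comp_basis[of "Suc i"] by metis
  then have d: "A.dimension (hilb I (Suc i)) (scalars I) (graded_comp I (Suc i))"
    using hilb_eq by metis
  have "set ?Us \<subseteq> graded_comp I (Suc i)"
    using ps(5) poly_comp_mult[OF u, of _ i] by (auto simp: graded_comp_def)
  then have "A.Span (scalars I) ?Us = graded_comp I (Suc i)"
    using A.independent_length_eq_dimension[OF scalars_subfield d ind] len by blast
  then have "residue I q \<in> (\<lambda>x. residue I (u * x)) ` MP.span (set ps)"
    using q unfolding Span_residues graded_comp_def by blast
  then show ?thesis using sp by (auto simp: residue_eq_iff)
qed

text \<open>
  The forms of degree \<open>j + 1\<close> are combinations of multiples of forms of degree \<open>j\<close> by variables, and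
  multiplication by \<open>u\<close> commutes with the variables.
\<close>

lemma surjective_above:
  assumes surj: "\<And>q. q \<in> poly_comp (Suc i) \<Longrightarrow> \<exists>a\<in>poly_comp i. q - u * a \<in> I"
    and "i \<le> j" "q \<in> poly_comp (Suc j)"
  shows "\<exists>a\<in>poly_comp j. q - u * a \<in> I"
  using assms(2,3)
proof (induction j arbitrary: q rule: dec_induct)
  case base
  then show ?case by (rule surj)
next
  case (step j)
  have "\<forall>j'. k = Suc (Suc j') \<longrightarrow> j' = j \<longrightarrow> (\<exists>a\<in>poly_comp (Suc j'). q - u * a \<in> I)" if "q \<in> poly_comp k" for k q
    using that
  proof (induction rule: form_induct)
    case (const c)
    then show ?case by simp
  next
    case (add k p q)
    show ?case
    proof (intro allI impI)
      fix j' assume "k = Suc (Suc j')" "j' = j"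
      then obtain a b where ab: "a \<in> poly_comp (Suc j')" "b \<in> poly_comp (Suc j')" "p - u * a \<in> I" "q - u * b \<in> I"
        using add by blast
      have "(p + q) - u * (a + b) = (p - u * a) + (q - u * b)" by (simp add: distrib_left)
      then show "\<exists>a\<in>poly_comp (Suc j'). p + q - u * a \<in> I"
        using I_add[OF ab(3,4)] ab(1,2) by (intro bexI[of _ "a + b"]) (simp_all only: poly_comp_add)
    qed
  next
    case (mult k p v)
    show ?case
    proof (intro allI impI)
      fix j' assume j': "Suc k = Suc (Suc j')" "j' = j"
      then obtain a where a: "a \<in> poly_comp j" "p - u * a \<in> I" using step.IH mult(1) by auto
      have "mvar v * p - u * (mvar v * a) = mvar v * (p - u * a)" by (simp add: algebra_simps)
      then show "\<exists>a\<in>poly_comp (Suc j'). mvar v * p - u * a \<in> I"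
        using a j' poly_comp_mult[OF mvar_in_poly_comp a(1), of v]
        by (intro bexI[of _ "mvar v * a"]) (auto intro: I_mult)
    qed
  qed
  with step.prems show ?case by blast
qed

lemma graded_comp_eq_0_iff: "graded_comp I i = {\<zero>\<^bsub>A\<^esub>} \<longleftrightarrow> poly_comp i \<subseteq> I"
proof -
  have "\<zero>\<^bsub>A\<^esub> \<in> graded_comp I i" unfolding graded_comp_def A_zero by auto
  then have "graded_comp I i = {\<zero>\<^bsub>A\<^esub>} \<longleftrightarrow> (\<forall>p\<in>poly_comp i. residue I p = \<zero>\<^bsub>A\<^esub>)"
    unfolding graded_comp_def by blast
  then show ?thesis unfolding residue_eq_0_iff by blast
qed

text \<open>Finitely many polynomials span the quotient, and their degrees are bounded.\<close>

lemma artinian_bounded: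
  assumes "artinian I"
  shows "\<exists>N. \<forall>i\<ge>N. poly_comp i \<subseteq> I"
proof -
  interpret A: ring A by (rule A_ring)
  obtain n where "A.dimension n (scalars I) (carrier A)"
    using assms unfolding artinian_def A.finite_dimension_def by blast
  then obtain Vs where Vs: "set Vs \<subseteq> carrier A" "A.Span (scalars I) Vs = carrier A"
    using A.exists_base[OF scalars_subfield] by blast
  from Vs(1) have "\<exists>ps. Vs = map (\<lambda>p. residue I (1 * p)) ps"
    by (induction Vs) (auto simp: carrier_A, metis list.simps(9))
  then obtain ps where ps: "Vs = map (\<lambda>p. residue I (1 * p)) ps" by blast
  have "\<exists>N. \<forall>p\<in>set ps. \<forall>n\<ge>N. hcomp n p = 0"
  proof (induction ps)
    case (Cons p ps)
    then obtain N where N: "\<forall>p\<in>set ps. \<forall>n\<ge>N. hcomp n p = 0" by blast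
    obtain M where "\<forall>n\<ge>M. hcomp n p = 0" using hcomp_decompose by blast
    with N show ?case by (intro exI[of _ "max M N"]) auto
  qed simp
  then obtain N where N: "\<And>p n. p \<in> set ps \<Longrightarrow> n \<ge> N \<Longrightarrow> hcomp n p = 0" by blast
  have span: "hcomp n x = 0" if "x \<in> MP.span (set ps)" "n \<ge> N" for x n
    using that(1)
  proof (induction rule: MP.span_induct_alt)
    case (step c p y)
    have "hcomp (0 + n) (mconst c * p) = mconst c * hcomp n p" by (rule hcomp_mult) simp
    with step N that(2) show ?case by (simp add: hcomp_add mscale_def)
  qed simp
  have "q \<in> I" if "i \<ge> N" "q \<in> poly_comp i" for i q
  proof -
    have "residue I q \<in> (\<lambda>x. residue I (1 * x)) ` MP.span (set ps)"
      using Vs(2) unfolding ps Span_residues by (simp add: carrier_A)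
    then obtain x where x: "x \<in> MP.span (set ps)" "q - x \<in> I" by (auto simp: residue_eq_iff)
    have "hcomp i q = hcomp i (q - x) + hcomp i x" by (simp flip: hcomp_add)
    then have "q = hcomp i (q - x)" using span[OF x(1) that(1)] hcomp_same[OF that(2)] by simp
    with hcomp_in_I[OF x(2), of i] show ?thesis by simp
  qed
  then show ?thesis by blast
qed

lemma socle_degree_props:
  assumes "artinian I"
  shows "\<not> poly_comp (socle_degree I) \<subseteq> I" and "i > socle_degree I \<Longrightarrow> poly_comp i \<subseteq> I"
proof -
  obtain N where N: "\<And>i. i \<ge> N \<Longrightarrow> poly_comp i \<subseteq> I" using artinian_bounded[OF assms] by blast
  have eq: "socle_degree I = (GREATEST i. \<not> poly_comp i \<subseteq> I)"
    unfolding socle_degree_def graded_comp_eq_0_iff by simp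
  have bound: "\<And>i. \<not> poly_comp i \<subseteq> I \<Longrightarrow> i \<le> N" using N by (metis nat_le_linear)
  have "mconst 1 \<in> poly_comp 0" by blast
  then have "\<not> poly_comp 0 \<subseteq> I" using proper by auto
  from GreatestI_nat[of "\<lambda>i. \<not> poly_comp i \<subseteq> I", OF this bound] show "\<not> poly_comp (socle_degree I) \<subseteq> I"
    unfolding eq .
  show "poly_comp i \<subseteq> I" if "i > socle_degree I"
    using Greatest_le_nat[of "\<lambda>i. \<not> poly_comp i \<subseteq> I" i, OF _ bound] that unfolding eq by auto
qed

text \<open>
  The annihilator of a residue class is an ideal, so it is enough to look at the variables.
\<close>

lemma residue_in_socle:
  assumes "\<And>v. mvar v * p \<in> I"
  shows "residue I p \<in> socle I"
proof -
  interpret A: ring A by (rule A_ring)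
  \<comment> \<open>The image of this ideal in the quotient is the annihilator of the residue class.\<close>
  let ?J = "{q. q * p \<in> I}"
  have J: "ideal ?J mpoly_ring"
    unfolding mpoly_ideal_iff by (auto simp: distrib_right mult.assoc intro: I_add I_mult)
  have "ideal (residue I ` ?J) A"
    using ring.ring_ideal_imp_quot_ideal[OF cring.axioms(1)[OF mpoly_ring_cring] I_ideal J]
    by (simp add: residue_def[abs_def])
  then have "irrelevant_ideal I \<subseteq> residue I ` ?J"
    unfolding irrelevant_ideal_def by (rule A.genideal_minimal) (use assms in auto)
  moreover have "residue I q \<otimes>\<^bsub>A\<^esub> residue I p = \<zero>\<^bsub>A\<^esub>" if "q * p \<in> I" for q
    using that unfolding A_mult residue_eq_0_iff .
  ultimately show ?thesis unfolding socle_def carrier_A by blast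
qed

end

text \<open>The socle is one-dimensional, so the quotient is not the zero ring.\<close>

lemma gorenstein_proper:
  fixes I :: "(3, 'k::field_char_0) mpoly set"
  assumes "homogeneous_ideal I" "gorenstein I"
  shows "1 \<notin> I"
proof
  assume "1 \<in> I"
  interpret R: cring "mpoly_ring :: (3, 'k) mpoly ring" by (rule mpoly_ring_cring)
  have id: "ideal I mpoly_ring" using assms(1) R.genideal_ideal unfolding homogeneous_ideal_def by auto
  interpret A: ring "quot_alg I" by (rule ideal.quotient_is_ring[OF id])
  have "I = UNIV" using id \<open>1 \<in> I\<close> unfolding mpoly_ideal_iff by (metis UNIV_eq_I mult_1_right)
  have "x \<in> UNIV +>\<^bsub>mpoly_ring\<^esub> p" for x p :: "(3, 'k) mpoly"
    by (auto simp: a_r_coset_def' intro: exI[of _ "x - p"])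
  then have "UNIV +>\<^bsub>mpoly_ring\<^esub> p = (UNIV :: (3, 'k) mpoly set)" for p by blast
  with \<open>I = UNIV\<close> have "carrier (quot_alg I) = {\<zero>\<^bsub>quot_alg I\<^esub>}"
    unfolding FactRing_def A_RCOSETS_def' by simp
  moreover have "A.dimension 1 (scalars I) (socle I)" using assms(2) unfolding gorenstein_def by blast
  ultimately show False by (auto elim!: A.dimension.cases)
qed

locale gorenstein_ideal = proper_homogeneous_ideal I
  for I :: "(3, 'k::field_char_0) mpoly set" +
  assumes art: "artinian I" and gor: "gorenstein I"
begin

abbreviation d :: nat where "d \<equiv> socle_degree I"

text \<open>
  The component of degree \<open>d\<close> is killed by all variables and so lies in the socle, which is
  one-dimensional.
\<close>

lemma socle_generator: "\<exists>p\<in>poly_comp d. p \<notin> I \<and> (\<forall>q\<in>poly_comp d. \<exists>c. q - mconst c * p \<in> I)"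
proof -
  interpret A: ring A by (rule A_ring)
  have dim1: "A.dimension 1 (scalars I) (socle I)" and soc: "socle I \<subseteq> graded_comp I d"
    using gor unfolding gorenstein_def by auto
  obtain Vs where Vs: "set Vs \<subseteq> carrier A" "length Vs = 1" "A.Span (scalars I) Vs = socle I"
    using A.exists_base[OF scalars_subfield dim1] by blast
  obtain v where v: "Vs = [v]" using Vs(2) by (cases Vs) auto
  have "v \<in> socle I" using A.Span_base_incl[OF scalars_subfield Vs(1)] Vs(3) v by auto
  then obtain p where p: "p \<in> poly_comp d" "v = residue I p" using soc unfolding graded_comp_def by auto
  have span: "socle I = residue I ` MP.span {p}"
    using Span_residues[of 1 "[p]"] Vs(3) v p by simp
  have ex: "\<exists>c. q - mconst c * p \<in> I" if q: "q \<in> poly_comp d" for q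
  proof -
    have "mvar w * q \<in> I" for w
      using socle_degree_props(2)[OF art, of "Suc d"] poly_comp_mult[OF mvar_in_poly_comp q, of w] by auto
    then have "residue I q \<in> residue I ` MP.span {p}" using residue_in_socle span by blast
    then show ?thesis by (auto simp: MP.span_singleton residue_eq_iff mscale_def)
  qed
  have "p \<notin> I"
  proof
    assume "p \<in> I"
    then have "q \<in> I" if "q \<in> poly_comp d" for q
      using ex[OF that] I_add[OF _ I_mult] by (metis diff_add_cancel)
    with socle_degree_props(1)[OF art] show False by blast
  qed
  with p ex show ?thesis by blast
qed

text \<open>The socle lies in degree \<open>d\<close>.\<close>

lemma in_I_if_multiples_in_I:
  assumes p: "p \<in> poly_comp i" "i \<noteq> d" and "\<And>v. mvar v * p \<in> I"
  shows "p \<in> I"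
proof -
  have "residue I p \<in> graded_comp I d"
    using residue_in_socle[OF assms(3)] gor unfolding gorenstein_def by blast
  then obtain q where q: "q \<in> poly_comp d" "p - q \<in> I" by (auto simp: graded_comp_def residue_eq_iff)
  have "hcomp i p = hcomp i (p - q) + hcomp i q" by (simp flip: hcomp_add)
  then have "p = hcomp i (p - q)" using hcomp_same[OF p(1)] hcomp_other[OF q(1)] p(2) by simp
  with hcomp_in_I[OF q(2), of i] show ?thesis by simp
qed

text \<open>
  The functional takes the coordinate of the component of degree \<open>d\<close> with respect to a generator of
  the socle. Its ideal agrees with \<open>I\<close> in degree \<open>d\<close> by construction, and in smaller degrees because
  a form whose multiples by variables all lie in \<open>I\<close> lies in \<open>I\<close> itself.
\<close>

lemma ex_functional:
  "\<exists>\<phi>. gorenstein_functional \<phi> d \<and> (\<forall>i. gorenstein_functional.ann \<phi> \<inter> poly_comp i = I \<inter> poly_comp i)"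
proof -
  obtain p where p: "p \<in> poly_comp d" "p \<notin> I" "\<And>q. q \<in> poly_comp d \<Longrightarrow> \<exists>c. q - mconst c * p \<in> I"
    using socle_generator by blast
  define \<phi> where "\<phi> q = (THE c :: 'k. hcomp d q - mconst c * p \<in> I)" for q
  have unique: "c = c'" if "q - mconst c * p \<in> I" "q - mconst c' * p \<in> I" for c c' and q :: "(3, 'k) mpoly"
  proof (rule ccontr)
    assume "c \<noteq> c'"
    have "mconst (c' - c) * p = (q - mconst c * p) - (q - mconst c' * p)"
      by (simp add: mconst_diff algebra_simps)
    also have "\<dots> \<in> I" by (rule I_diff[OF that])
    finally show False using I_cancel p(2) \<open>c \<noteq> c'\<close> by simp
  qed
  have phi_eq: "\<phi> q = c" if "hcomp d q - mconst c * p \<in> I" for q c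
    unfolding \<phi>_def using that unique by blast
  have phi_mod: "hcomp d q - mconst (\<phi> q) * p \<in> I" for q
    using p(3)[OF hcomp_in_poly_comp] phi_eq by metis
  have add: "\<phi> (q + r) = \<phi> q + \<phi> r" for q r
  proof (rule phi_eq)
    have "hcomp d (q + r) - mconst (\<phi> q + \<phi> r) * p = (hcomp d q - mconst (\<phi> q) * p) + (hcomp d r - mconst (\<phi> r) * p)"
      by (simp add: hcomp_add mconst_add algebra_simps)
    also have "\<dots> \<in> I" by (rule I_add[OF phi_mod phi_mod])
    finally show "hcomp d (q + r) - mconst (\<phi> q + \<phi> r) * p \<in> I" .
  qed
  have scale: "\<phi> (mconst c * q) = c * \<phi> q" for c q
  proof (rule phi_eq)
    have h: "hcomp (0 + d) (mconst c * q) = mconst c * hcomp d q" by (rule hcomp_mult) simp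
    have "hcomp d (mconst c * q) - mconst (c * \<phi> q) * p = mconst c * (hcomp d q - mconst (\<phi> q) * p)"
      using h by (simp add: mconst_mult algebra_simps)
    also have "\<dots> \<in> I" by (rule I_mult[OF phi_mod])
    finally show "hcomp d (mconst c * q) - mconst (c * \<phi> q) * p \<in> I" .
  qed
  have in_I: "\<phi> q = 0" if "q \<in> I" for q
    by (rule phi_eq) (use hcomp_in_I[OF that] in simp)
  interpret gorenstein_functional \<phi> d
  proof
    show "linfun \<phi>" using add scale by (simp add: linfun_def)
    show "\<phi> q = 0" if "q \<in> poly_comp n" "n \<noteq> d" for q n
      by (rule phi_eq) (use hcomp_other[OF that] in simp)
  qed
  have above: "q \<in> I" if "q \<in> poly_comp i" "i > d" for q i
    using socle_degree_props(2)[OF art that(2)] that(1) by blast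
  have down: "q \<in> I" if "q \<in> poly_comp i" "q \<in> ann" "i \<le> d" for q i
    using that(3,1,2)
  proof (induction i arbitrary: q rule: inc_induct)
    case base
    have "\<phi> q = 0" using phi_ann base by blast
    with phi_mod[of q] base show ?case by (simp add: hcomp_same)
  next
    case (step i)
    have "mvar v * q \<in> I" for v
      using step.IH[of "mvar v * q"] poly_comp_mult[OF mvar_in_poly_comp step.prems(1), of v] ann_mult'[OF step.prems(2)] by simp
    then show ?case using in_I_if_multiples_in_I[OF step.prems(1)] step.hyps by simp
  qed
  have "q \<in> ann \<longleftrightarrow> q \<in> I" if "q \<in> poly_comp i" for q i
  proof
    assume "q \<in> ann"
    then show "q \<in> I" using down above that by (metis not_le)
  next
    assume "q \<in> I"
    then have "r * q \<in> I" for r by (rule I_mult)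
    then show "q \<in> ann" unfolding ann_def using in_I by (simp add: mult.commute)
  qed
  then have "\<forall>i. ann \<inter> poly_comp i = I \<inter> poly_comp i" by blast
  with gorenstein_functional_axioms show ?thesis by blast
qed

text \<open>
  A form killed by \<open>u\<close> in a smaller degree is multiplied up to degree \<open>m\<close> by the variables, and
  then comes down again, as there is no socle on the way.
\<close>

lemma injective_below:
  assumes inj: "\<And>a. a \<in> poly_comp m \<Longrightarrow> u * a \<in> I \<Longrightarrow> a \<in> I"
    and "m \<le> d" "i \<le> m" "a \<in> poly_comp i" "u * a \<in> I"
  shows "a \<in> I"
  using assms(3-5)
proof (induction i arbitrary: a rule: inc_induct)
  case base
  then show ?case by (rule inj)
next
  case (step i)
  have "mvar v * a \<in> I" for v
    using step.IH[of "mvar v * a"] poly_comp_mult[OF mvar_in_poly_comp step.prems(1), of v] I_mult[OF step.prems(2), of "mvar v"]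
    by (simp add: mult_ac)
  then show ?case using in_I_if_multiples_in_I[OF step.prems(1)] step.hyps assms(2) by simp
qed

end

text \<open>
  One degree decides: injectivity is inherited by smaller degrees, and surjectivity, which is
  equivalent to injectivity here, by larger ones.
\<close>

lemma weak_lefschetz_if_injective:
  fixes I :: "(3, 'k::field_char_0) mpoly set"
  assumes "gorenstein_ideal I" and u: "u \<in> poly_comp 1" and inj: "\<And>a. a \<in> poly_comp m \<Longrightarrow> u * a \<in> I \<Longrightarrow> a \<in> I"
    and "m \<le> socle_degree I" "hilb I (Suc m) = hilb I m"
  shows "weak_lefschetz I"
proof -
  interpret gorenstein_ideal I by fact
  have surj: "\<exists>a\<in>poly_comp i. q - u * a \<in> I" if "m \<le> i" "q \<in> poly_comp (Suc i)" for i q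
    by (rule surjective_above[OF surjective_if_injective[OF u inj assms(5)] that])
  have "inj_on (\<lambda>a. residue I u \<otimes>\<^bsub>A\<^esub> a) (graded_comp I i)" if "i \<le> m" for i
  proof (rule inj_onI)
    fix a b assume "a \<in> graded_comp I i" "b \<in> graded_comp I i" and eq: "residue I u \<otimes>\<^bsub>A\<^esub> a = residue I u \<otimes>\<^bsub>A\<^esub> b"
    then obtain p q where pq: "a = residue I p" "b = residue I q" "p \<in> poly_comp i" "q \<in> poly_comp i"
      by (auto simp: graded_comp_def)
    have "u * (p - q) \<in> I" using eq by (simp add: pq A_mult residue_eq_iff right_diff_distrib)
    then have "p - q \<in> I" using injective_below[OF inj assms(4) that poly_comp_diff[OF pq(3,4)]] by blast
    then show "a = b" by (simp add: pq residue_eq_iff)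
  qed
  moreover have "(\<lambda>a. residue I u \<otimes>\<^bsub>A\<^esub> a) ` graded_comp I i = graded_comp I (Suc i)" if "m \<le> i" for i
  proof -
    have "u * a \<in> poly_comp (Suc i)" if "a \<in> poly_comp i" for a using poly_comp_mult[OF u that] by simp
    moreover have "residue I q \<in> (\<lambda>a. residue I (u * a)) ` poly_comp i" if "q \<in> poly_comp (Suc i)" for q
      using surj[OF \<open>m \<le> i\<close> that] by (auto simp: residue_eq_iff)
    ultimately show ?thesis by (auto simp: graded_comp_def image_image A_mult)
  qed
  ultimately have "\<forall>i. inj_on (\<lambda>a. residue I u \<otimes>\<^bsub>A\<^esub> a) (graded_comp I i) \<or>
      (\<lambda>a. residue I u \<otimes>\<^bsub>A\<^esub> a) ` graded_comp I i = graded_comp I (Suc i)"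
    by (meson nat_le_linear)
  moreover have "residue I u \<in> graded_comp I 1" using u unfolding graded_comp_def by blast
  ultimately show ?thesis unfolding weak_lefschetz_def by blast
qed

theorem theorem3p2:
  fixes I :: "(3, 'k :: {alg_closed_field, field_char_0}) mpoly set"
    and m :: nat
  assumes "m \<ge> 2"
    and "homogeneous_ideal I"
    and "artinian I"
    and "gorenstein I"
    and "socle_degree I = 2 * m + 1"
    and "hilb I 0 = 1"
    and "hilb I 1 = 3"
    and "\<And>i. 2 \<le> i \<Longrightarrow> i \<le> m \<Longrightarrow> hilb I i = 2 * i + 2"
    and "\<And>i. i \<le> m \<Longrightarrow> hilb I (2 * m + 1 - i) = hilb I i"
  shows "weak_lefschetz I"
proof -
  interpret gorenstein_ideal I
    by unfold_locales (use assms gorenstein_proper in auto)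
  obtain \<phi> where \<phi>: "gorenstein_functional \<phi> (2 * m + 1)"
    and ann: "\<And>i. gorenstein_functional.ann \<phi> \<inter> poly_comp i = I \<inter> poly_comp i"
    using ex_functional assms(5) by auto
  have mem: "p \<in> gorenstein_functional.ann \<phi> \<longleftrightarrow> p \<in> I" if "p \<in> poly_comp i" for p i
    using ann[of i] that by blast
  have hm: "hilb I m = 2 * m + 2" and hm1: "hilb I (m + 1) = 2 * m + 2"
    using assms(8)[of m] assms(9)[of m] \<open>m \<ge> 2\<close> by auto
  have "\<exists>u\<in>poly_comp 1. \<forall>a\<in>poly_comp m. u * a \<in> I \<longrightarrow> a \<in> I"
  proof (rule ccontr)
    assume neg: "\<not> (\<exists>u\<in>poly_comp 1. \<forall>a\<in>poly_comp m. u * a \<in> I \<longrightarrow> a \<in> I)"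
    have "lefschetz_failure \<phi> m"
    proof (intro lefschetz_failure.intro \<phi> lefschetz_failure_axioms.intro)
      show "m \<ge> 2" by fact
      show "MP.dim (poly_comp m :: (3, 'k) mpoly set) = MP.dim (gorenstein_functional.ann \<phi> \<inter> poly_comp m) + (2 * m + 2)"
        unfolding ann using dim_hilb[of m] hm by simp
      show "MP.dim (poly_comp (m + 1) :: (3, 'k) mpoly set) = MP.dim (gorenstein_functional.ann \<phi> \<inter> poly_comp (m + 1)) + (2 * m + 2)"
        unfolding ann using dim_hilb[of "m + 1"] hm1 by simp
      show "gorenstein_functional.ann \<phi> \<inter> poly_comp 2 = {0}"
        unfolding ann by (rule I_if_hilb_full) (use assms(8)[of 2] \<open>m \<ge> 2\<close> in \<open>simp add: dim_poly_comp_small\<close>)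
      fix u :: "(3, 'k) mpoly" assume u: "u \<in> poly_comp 1"
      then obtain a where a: "a \<in> poly_comp m" "u * a \<in> I" "a \<notin> I" using neg by blast
      then show "\<exists>a\<in>poly_comp m. a \<notin> gorenstein_functional.ann \<phi> \<and> u * a \<in> gorenstein_functional.ann \<phi>"
        using mem[OF a(1)] mem[OF poly_comp_mult[OF u a(1)]] by blast
    qed
    then show False
      by (rule lefschetz_failure_impossible)
         (use dim_hilb[of 3] dim_hilb[of 4] assms(8)[of 3] assms(8)[of 4] in \<open>simp_all add: ann\<close>)
  qed
  then obtain u where "u \<in> poly_comp 1" "\<And>a. a \<in> poly_comp m \<Longrightarrow> u * a \<in> I \<Longrightarrow> a \<in> I" by blast
  then show ?thesis
    using weak_lefschetz_if_injective[OF gorenstein_ideal_axioms, of u m] hm hm1 assms(5) by simp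
qed

end
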